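(* There exist closed Riemannian manifolds for which the first positive eigenvalue of the rough Laplacian on $1$-forms does not satisfy a Li-Yau-type inequality. Precisely: there is a dimension $n$ such that for every constant $C>0$ there exist a closed connected smooth $n$-dimensional Riemannian manifold $(X,g)$ and numbers $\kappa\geq 0$, $D>0$ with $$\operatorname{Ric}(g)\geq -(n-1)\kappa,\qquad \operatorname{diam}(X)\leq D,$$ such that $$\lambda_1^{(1)}D^2 < C\,e^{-C\sqrt{\kappa D^2}} .$$
   Context: The rough Laplacian is $\overline{\Delta}=\nabla^{*}\nabla$, where $\nabla$ is the Levi-Civita connection of $g$ acting on differential forms and $\nabla^*$ is its formal $L^2$-adjoint. $\lambda^{(1)}_1$ denotes the smallest strictly positive eigenvalue of $\overline{\Delta}$ acting on smooth $1$-forms. For a closed $n$-dimensional $(X,g)$ with $\operatorname{Ric}(g)\geq -(n-1)\kappa$ (i.e. $\operatorname{Ric}(v,v)\ge -(n-1)\kappa\, g(v,v)$ for all tangent vectors $v$) and $\operatorname{diam}(X)\leq D$, one says that the first eigenvalue of the rough Laplacian on $1$-forms satisfies a Li-Yau type inequality if $\lambda^{(1)}_{1}D^2\geq C(n)e^{-C(n)\sqrt{\kappa D^2}}$, where $C(n)$ is a positive constant depending only on the dimension $n$. *)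

theory Defs
  imports
    "Jordan_Normal_Form.Determinant"
    "Jordan_Normal_Form.Gauss_Jordan_Elimination"
    "HOL-Analysis.Analysis"
begin

section \<open>Smooth functions on open subsets of Euclidean space\<close>

text \<open>
  Since the dimension is quantified over, n-dimensional space is modelled as the space of
  extensional functions on \<open>{..<n}\<close>, which is the carrier both of \<^term>\<open>powertop_real {..<n}\<close> and
  of the product measure \<^term>\<open>PiM {..<n} (\<lambda>_. lborel)\<close>. Updating a coordinate below \<open>n\<close>
  stays inside this carrier.
\<close>

type_synonym coord = "nat \<Rightarrow> real"

abbreviation euclid :: "nat \<Rightarrow> coord topology" where
  "euclid n \<equiv> powertop_real {..<n}"

abbreviation lebesgue_n :: "nat \<Rightarrow> coord measure" where
  "lebesgue_n n \<equiv> PiM {..<n} (\<lambda>_. lborel)"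

definition pderiv_at :: "nat \<Rightarrow> (coord \<Rightarrow> real) \<Rightarrow> coord \<Rightarrow> real" where
  "pderiv_at i f x = deriv (\<lambda>t. f (x(i := t))) (x i)"

primrec Ck_on :: "nat \<Rightarrow> nat \<Rightarrow> coord set \<Rightarrow> (coord \<Rightarrow> real) \<Rightarrow> bool" where
  "Ck_on 0 n U f \<longleftrightarrow> continuous_map (subtopology (euclid n) U) euclideanreal f"
| "Ck_on (Suc k) n U f \<longleftrightarrow>
     continuous_map (subtopology (euclid n) U) euclideanreal f \<and>
     (\<forall>i<n. (\<forall>x\<in>U. (\<lambda>t. f (x(i := t))) differentiable at (x i)) \<and> Ck_on k n U (pderiv_at i f))"

definition smooth_fun :: "nat \<Rightarrow> coord set \<Rightarrow> (coord \<Rightarrow> real) \<Rightarrow> bool" where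
  "smooth_fun n U f \<longleftrightarrow> (\<forall>k. Ck_on k n U f)"


section \<open>Smooth manifolds\<close>

text \<open>A chart is a pair of its domain and its coordinate map.\<close>

type_synonym 'a chart = "'a set \<times> ('a \<Rightarrow> coord)"

definition chart_image :: "'a chart \<Rightarrow> coord set" where
  "chart_image c = snd c ` fst c"

definition overlap :: "'a chart \<Rightarrow> 'a chart \<Rightarrow> coord set" where
  "overlap c c' = snd c ` (fst c \<inter> fst c')"

definition transition :: "'a chart \<Rightarrow> 'a chart \<Rightarrow> coord \<Rightarrow> coord" where
  "transition c c' x = snd c' (inv_into (fst c) (snd c) x)"

text \<open>\<open>jacobian c c' x j i\<close> is the derivative of the \<open>j\<close>-th coordinate of \<open>c'\<close> with respect to
  the \<open>i\<close>-th coordinate of \<open>c\<close>.\<close>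

definition jacobian :: "'a chart \<Rightarrow> 'a chart \<Rightarrow> coord \<Rightarrow> nat \<Rightarrow> nat \<Rightarrow> real" where
  "jacobian c c' x j i = pderiv_at i (\<lambda>y. transition c c' y j) x"

definition smooth_atlas :: "nat \<Rightarrow> 'a topology \<Rightarrow> 'a chart set \<Rightarrow> bool" where
  "smooth_atlas n X A \<longleftrightarrow>
     (\<forall>c\<in>A. openin X (fst c) \<and> openin (euclid n) (chart_image c) \<and>
             embedding_map (subtopology X (fst c)) (euclid n) (snd c)) \<and>
     (\<Union>c\<in>A. fst c) = topspace X \<and>
     (\<forall>c\<in>A. \<forall>c'\<in>A. \<forall>j<n. smooth_fun n (overlap c c') (\<lambda>x. transition c c' x j))"

definition smooth_manifold :: "nat \<Rightarrow> 'a topology \<Rightarrow> 'a chart set \<Rightarrow> bool" where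
  "smooth_manifold n X A \<longleftrightarrow> Hausdorff_space X \<and> second_countable X \<and> smooth_atlas n X A"


section \<open>Tensor fields and Riemannian metrics\<close>

text \<open>
  Covariant tensor fields are given by their components in the charts of the atlas, subject to the
  usual transformation law on overlaps. Component values outside the image of a chart, at indices
  not below the dimension, or in charts not in the atlas carry no information.
\<close>

type_synonym 'a field1 = "'a chart \<Rightarrow> coord \<Rightarrow> nat \<Rightarrow> real"
type_synonym 'a field2 = "'a chart \<Rightarrow> coord \<Rightarrow> nat \<Rightarrow> nat \<Rightarrow> real"

definition one_form :: "nat \<Rightarrow> 'a chart set \<Rightarrow> 'a field1 \<Rightarrow> bool" where
  "one_form n A \<omega> \<longleftrightarrow>
     (\<forall>c\<in>A. \<forall>i<n. smooth_fun n (chart_image c) (\<lambda>x. \<omega> c x i)) \<and>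
     (\<forall>c\<in>A. \<forall>c'\<in>A. \<forall>x\<in>overlap c c'. \<forall>i<n.
        \<omega> c x i = (\<Sum>j<n. jacobian c c' x j i * \<omega> c' (transition c c' x) j))"

definition two_tensor :: "nat \<Rightarrow> 'a chart set \<Rightarrow> 'a field2 \<Rightarrow> bool" where
  "two_tensor n A T \<longleftrightarrow>
     (\<forall>c\<in>A. \<forall>i<n. \<forall>j<n. smooth_fun n (chart_image c) (\<lambda>x. T c x i j)) \<and>
     (\<forall>c\<in>A. \<forall>c'\<in>A. \<forall>x\<in>overlap c c'. \<forall>i<n. \<forall>j<n.
        T c x i j = (\<Sum>k<n. \<Sum>l<n. jacobian c c' x k i * jacobian c c' x l j *
                                     T c' (transition c c' x) k l))"

definition riemannian_metric :: "nat \<Rightarrow> 'a chart set \<Rightarrow> 'a field2 \<Rightarrow> bool" where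
  "riemannian_metric n A g \<longleftrightarrow>
     two_tensor n A g \<and>
     (\<forall>c\<in>A. \<forall>x\<in>chart_image c.
        (\<forall>i<n. \<forall>j<n. g c x i j = g c x j i) \<and>
        (\<forall>v. (\<exists>i<n. v i \<noteq> 0) \<longrightarrow> (\<Sum>i<n. \<Sum>j<n. g c x i j * v i * v j) > 0))"

record 'a riemannian =
  mdim :: nat
  mtop :: "'a topology"
  atlas :: "'a chart set"
  metric :: "'a field2"

definition riemannian_manifold :: "'a riemannian \<Rightarrow> bool" where
  "riemannian_manifold M \<longleftrightarrow>
     smooth_manifold (mdim M) (mtop M) (atlas M) \<and>
     riemannian_metric (mdim M) (atlas M) (metric M)"

definition closed_connected :: "'a riemannian \<Rightarrow> bool" where
  "closed_connected M \<longleftrightarrow>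
     topspace (mtop M) \<noteq> {} \<and> compact_space (mtop M) \<and> connected_space (mtop M)"

definition metric_matrix :: "'a riemannian \<Rightarrow> 'a chart \<Rightarrow> coord \<Rightarrow> real Matrix.mat" where
  "metric_matrix M c x = Matrix.mat (mdim M) (mdim M) (\<lambda>(i, j). metric M c x i j)"

definition cometric :: "'a riemannian \<Rightarrow> 'a chart \<Rightarrow> coord \<Rightarrow> nat \<Rightarrow> nat \<Rightarrow> real" where
  "cometric M c x i j = index_mat (the (mat_inverse (metric_matrix M c x))) (i, j)"

text \<open>Evaluation of a quantity that does not depend on the chart.\<close>

definition chart_at :: "'a riemannian \<Rightarrow> 'a \<Rightarrow> 'a chart" where
  "chart_at M p = (SOME c. c \<in> atlas M \<and> p \<in> fst c)"

definition at_point :: "'a riemannian \<Rightarrow> ('a chart \<Rightarrow> coord \<Rightarrow> real) \<Rightarrow> 'a \<Rightarrow> real" where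
  "at_point M F p = (let c = chart_at M p in F c (snd c p))"


section \<open>Levi-Civita connection and Ricci curvature\<close>

text \<open>\<open>christoffel M c x k i j\<close> has upper index \<open>k\<close> and lower indices \<open>i\<close>, \<open>j\<close>.\<close>

definition christoffel :: "'a riemannian \<Rightarrow> 'a chart \<Rightarrow> coord \<Rightarrow> nat \<Rightarrow> nat \<Rightarrow> nat \<Rightarrow> real" where
  "christoffel M c x k i j =
     (1/2) * (\<Sum>l<mdim M. cometric M c x k l *
       (pderiv_at i (\<lambda>y. metric M c y j l) x + pderiv_at j (\<lambda>y. metric M c y i l) x
        - pderiv_at l (\<lambda>y. metric M c y i j) x))"

text \<open>The first index of \<open>nabla M \<omega>\<close> is the direction of differentiation.\<close>

definition nabla :: "'a riemannian \<Rightarrow> 'a field1 \<Rightarrow> 'a field2" where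
  "nabla M \<omega> c x i j =
     pderiv_at i (\<lambda>y. \<omega> c y j) x - (\<Sum>k<mdim M. christoffel M c x k i j * \<omega> c x k)"

text \<open>\<open>riemann M c x l k i j\<close> is the \<open>l\<close>-th component of \<open>R(\<partial>\<^sub>i, \<partial>\<^sub>j) \<partial>\<^sub>k\<close>, where
  \<open>R(X, Y) Z = \<nabla>\<^sub>X \<nabla>\<^sub>Y Z - \<nabla>\<^sub>Y \<nabla>\<^sub>X Z - \<nabla>\<^bsub>[X, Y]\<^esub> Z\<close>. The Ricci tensor \<open>Ric(Y, Z)\<close> is the trace of
  \<open>X \<mapsto> R(X, Y) Z\<close>; with these signs round spheres have positive Ricci curvature.\<close>

definition riemann ::
  "'a riemannian \<Rightarrow> 'a chart \<Rightarrow> coord \<Rightarrow> nat \<Rightarrow> nat \<Rightarrow> nat \<Rightarrow> nat \<Rightarrow> real" where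
  "riemann M c x l k i j =
     pderiv_at i (\<lambda>y. christoffel M c y l j k) x - pderiv_at j (\<lambda>y. christoffel M c y l i k) x
     + (\<Sum>m<mdim M. christoffel M c x l i m * christoffel M c x m j k
                    - christoffel M c x l j m * christoffel M c x m i k)"

definition ricci :: "'a riemannian \<Rightarrow> 'a field2" where
  "ricci M c x j k = (\<Sum>i<mdim M. riemann M c x i k i j)"

definition ricci_ge :: "'a riemannian \<Rightarrow> real \<Rightarrow> bool" where
  "ricci_ge M b \<longleftrightarrow>
     (\<forall>c\<in>atlas M. \<forall>x\<in>chart_image c. \<forall>v :: nat \<Rightarrow> real.
        (\<Sum>i<mdim M. \<Sum>j<mdim M. ricci M c x i j * v i * v j)
          \<ge> b * (\<Sum>i<mdim M. \<Sum>j<mdim M. metric M c x i j * v i * v j))"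


section \<open>Riemannian distance and diameter\<close>

definition piecewise_C1_curve :: "'a riemannian \<Rightarrow> (real \<Rightarrow> 'a) \<Rightarrow> bool" where
  "piecewise_C1_curve M \<gamma> \<longleftrightarrow>
     pathin (mtop M) \<gamma> \<and>
     (\<forall>c\<in>atlas M. \<forall>a b. 0 \<le> a \<and> a \<le> b \<and> b \<le> 1 \<and> \<gamma> ` {a..b} \<subseteq> fst c \<longrightarrow>
        (\<forall>i<mdim M. (\<lambda>t. snd c (\<gamma> t) i) piecewise_C1_differentiable_on {a..b}))"

definition velocity :: "'a chart \<Rightarrow> (real \<Rightarrow> 'a) \<Rightarrow> real \<Rightarrow> nat \<Rightarrow> real" where
  "velocity c \<gamma> t i = deriv (\<lambda>s. snd c (\<gamma> s) i) t"

definition speed :: "'a riemannian \<Rightarrow> (real \<Rightarrow> 'a) \<Rightarrow> real \<Rightarrow> real" where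
  "speed M \<gamma> t = at_point M (\<lambda>c x. sqrt (\<Sum>i<mdim M. \<Sum>j<mdim M.
     metric M c x i j * velocity c \<gamma> t i * velocity c \<gamma> t j)) (\<gamma> t)"

definition curve_length :: "'a riemannian \<Rightarrow> (real \<Rightarrow> 'a) \<Rightarrow> ennreal" where
  "curve_length M \<gamma> = (\<integral>\<^sup>+t\<in>{0..1}. ennreal (speed M \<gamma> t) \<partial>lborel)"

definition riemannian_dist :: "'a riemannian \<Rightarrow> 'a \<Rightarrow> 'a \<Rightarrow> ennreal" where
  "riemannian_dist M p q =
     (INF \<gamma>\<in>{\<gamma>. piecewise_C1_curve M \<gamma> \<and> \<gamma> 0 = p \<and> \<gamma> 1 = q}. curve_length M \<gamma>)"

definition riemannian_diameter :: "'a riemannian \<Rightarrow> ennreal" where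
  "riemannian_diameter M =
     (SUP p\<in>topspace (mtop M). SUP q\<in>topspace (mtop M). riemannian_dist M p q)"


section \<open>The rough Laplacian on 1-forms\<close>

text \<open>The Borel measure which in every chart has density \<open>\<surd>det g\<close> with respect to Lebesgue measure;
  it is unique because countably many charts cover the manifold.\<close>

definition volume_measure :: "'a riemannian \<Rightarrow> 'a measure" where
  "volume_measure M = (THE \<mu>.
     sets \<mu> = sigma_sets (topspace (mtop M)) {U. openin (mtop M) U} \<and>
     (\<forall>c\<in>atlas M. \<forall>B\<in>sets \<mu>. B \<subseteq> fst c \<longrightarrow>
        emeasure \<mu> B =
          (\<integral>\<^sup>+x\<in>snd c ` B. ennreal (sqrt (Determinant.det (metric_matrix M c x)))
             \<partial>lebesgue_n (mdim M))))"

definition inner1 :: "'a riemannian \<Rightarrow> 'a field1 \<Rightarrow> 'a field1 \<Rightarrow> 'a \<Rightarrow> real" where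
  "inner1 M \<alpha> \<beta> = at_point M (\<lambda>c x.
     \<Sum>i<mdim M. \<Sum>j<mdim M. cometric M c x i j * \<alpha> c x i * \<beta> c x j)"

definition inner2 :: "'a riemannian \<Rightarrow> 'a field2 \<Rightarrow> 'a field2 \<Rightarrow> 'a \<Rightarrow> real" where
  "inner2 M S T = at_point M (\<lambda>c x.
     \<Sum>i<mdim M. \<Sum>j<mdim M. \<Sum>k<mdim M. \<Sum>l<mdim M.
       cometric M c x i k * cometric M c x j l * S c x i j * T c x k l)"

definition L2_inner1 :: "'a riemannian \<Rightarrow> 'a field1 \<Rightarrow> 'a field1 \<Rightarrow> real" where
  "L2_inner1 M \<alpha> \<beta> = (LINT p|volume_measure M. inner1 M \<alpha> \<beta> p)"

definition L2_inner2 :: "'a riemannian \<Rightarrow> 'a field2 \<Rightarrow> 'a field2 \<Rightarrow> real" where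
  "L2_inner2 M S T = (LINT p|volume_measure M. inner2 M S T p)"

text \<open>
  \<open>\<nabla>\<^sup>* T = \<eta>\<close>, as a relation: the form \<open>\<eta>\<close> is determined by \<open>T\<close> on the images of the charts,
  but its components elsewhere are arbitrary. On a closed manifold the test forms need no support
  condition.
\<close>

definition nabla_adjoint :: "'a riemannian \<Rightarrow> 'a field2 \<Rightarrow> 'a field1 \<Rightarrow> bool" where
  "nabla_adjoint M T \<eta> \<longleftrightarrow>
     two_tensor (mdim M) (atlas M) T \<and> one_form (mdim M) (atlas M) \<eta> \<and>
     (\<forall>\<alpha>. one_form (mdim M) (atlas M) \<alpha> \<longrightarrow> L2_inner2 M (nabla M \<alpha>) T = L2_inner1 M \<alpha> \<eta>)"

definition rough_laplacian :: "'a riemannian \<Rightarrow> 'a field1 \<Rightarrow> 'a field1 \<Rightarrow> bool" where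
  "rough_laplacian M \<omega> \<eta> \<longleftrightarrow>
     one_form (mdim M) (atlas M) \<omega> \<and> nabla_adjoint M (nabla M \<omega>) \<eta>"

definition nonzero_form :: "'a riemannian \<Rightarrow> 'a field1 \<Rightarrow> bool" where
  "nonzero_form M \<omega> \<longleftrightarrow> (\<exists>c\<in>atlas M. \<exists>x\<in>chart_image c. \<exists>i<mdim M. \<omega> c x i \<noteq> 0)"

definition rough_eigenvalue :: "'a riemannian \<Rightarrow> real \<Rightarrow> bool" where
  "rough_eigenvalue M ev \<longleftrightarrow>
     (\<exists>\<omega>. nonzero_form M \<omega> \<and> rough_laplacian M \<omega> (\<lambda>c x i. ev * \<omega> c x i))"

definition first_positive_rough_eigenvalue :: "'a riemannian \<Rightarrow> real \<Rightarrow> bool" where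
  "first_positive_rough_eigenvalue M ev \<longleftrightarrow>
     ev > 0 \<and> rough_eigenvalue M ev \<and> (\<forall>ev'. ev' > 0 \<and> rough_eigenvalue M ev' \<longrightarrow> ev \<le> ev')"

end

(*
  For small e > 0 consider the 3-torus with the metric
    exp(2 h_0(z)) dx^2 + exp(2 h_1(z)) dy^2 + dz^2,
    h_0 = e sin(2 pi z) / (2 pi),  h_1 = e cos(2 pi z) / (2 pi).
  The Hessian of z is diagonal with eigenvalues h_0', h_1', 0, and h_0'^2 + h_1'^2 = e^2 is constant, so
  dz is an eigenform of the rough Laplacian with eigenvalue e^2; the integration by parts involves only the
  x- and y-directions, in which the metric is constant.  As e tends to 0 the metric converges to
  a flat one: the diameter stays bounded, the Ricci curvature is at least -20 e, and e^2 tends to 0.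

  That a smallest positive eigenvalue exists does not need the spectral theorem: four distinct eigenvalues
  below 1/10 would give four orthogonal eigenforms, some nontrivial combination of which has three
  components of mean zero, and this contradicts the Poincare inequality on the unit cube.
*)
theory Submission
  imports Defs "HOL-Complex_Analysis.Complex_Analysis" "HOL-Probability.Probability"
begin

section \<open>The three-dimensional torus\<close>

text \<open>On the flat torus the constant 1-forms are parallel, so 0 is an eigenvalue of
  multiplicity three. For functions the kernel consists of the constants whatever the metric is; for
  1-forms a small perturbation can destroy parallel forms, and the eigenvalue released in this way
  is as small as one likes. This is why curvature and diameter cannot control it. Dimension three
  comes from the wish for an explicit eigenform: with a single warping function h the eigenvalue
  would have to be h'^2, and a smooth periodic h with h'^2 constant has h' = 0. A sine and a cosine
  share the load, and the divisor 2 pi gives their derivatives amplitude exactly e. The obstacle is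
  formal: the volume is a definite description, charts are picked by a choice operator, inverse
  matrices come out of an algorithm. Since all transition maps are local translations by integers,
  tensors become periodic functions on R^3, every integral is moved to the unit cube, and the
  analysis takes place there.\<close>

definition shift_into :: "real \<Rightarrow> real \<Rightarrow> real" where
  "shift_into a t = t - of_int \<lfloor>t - a\<rfloor>"

lemma shift_into_bounds: "a \<le> shift_into a t" "shift_into a t < a + 1"
  unfolding shift_into_def by linarith+

lemma frac_shift_into [simp]: "frac (shift_into a t) = frac t"
  unfolding shift_into_def by (simp add: frac_def)

text \<open>Congruence modulo 1 is written as equality of \<open>frac\<close> from here on;
  periodicity of a function then has the shape of a congruence rule.\<close>

lemma frac_eq_iff_Ints: "frac x = frac y \<longleftrightarrow> x - y \<in> \<int>" for x y :: real
proof
  assume "frac x = frac y"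
  then have "x - y = of_int (\<lfloor>x\<rfloor> - \<lfloor>y\<rfloor>)" by (simp add: frac_def)
  then show "x - y \<in> \<int>" by (metis Ints_of_int)
next
  assume "x - y \<in> \<int>"
  then obtain k where "x - y = of_int k" by (auto elim: Ints_cases)
  then have "x = y + of_int k" by simp
  then show "frac x = frac y" by (metis frac_add_of_int_right)
qed

lemma shift_into_unique: "a \<le> s \<Longrightarrow> s < a + 1 \<Longrightarrow> frac s = frac t \<Longrightarrow> shift_into a t = s"
proof -
  assume s: "a \<le> s" "s < a + 1" "frac s = frac t"
  have "frac s = frac (shift_into a t)" using s by simp
  then have "s - shift_into a t \<in> \<int>" by (simp only: frac_eq_iff_Ints)
  then obtain k where k: "s - shift_into a t = of_int k" by (auto elim: Ints_cases)
  have "\<bar>s - shift_into a t\<bar> < 1" using shift_into_bounds[of a t] s by linarith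
  then have "k = 0" unfolding k by linarith
  then show ?thesis using k by simp
qed

lemma shift_into_id: "a \<le> s \<Longrightarrow> s < a + 1 \<Longrightarrow> shift_into a s = s"
  by (rule shift_into_unique) auto

lemma shift_into_strict: "frac t \<noteq> frac a \<Longrightarrow> a < shift_into a t"
  using shift_into_bounds[of a t] frac_shift_into[of a t] by (cases "shift_into a t = a") auto

lemma frac_neq_in_interval:
  fixes a t :: real
  assumes "a < t" "t < a + 1"
  shows "frac t \<noteq> frac a"
proof
  assume "frac t = frac a"
  then have "shift_into a t = a" by (intro shift_into_unique) auto
  then show False using shift_into_id[of a t] assms by simp
qed

text \<open>Off the cut the integer part is locally constant. This is what makes every transition
  map of the atlas a local translation by integers.\<close>

lemma shift_into_locally_translation:
  assumes "frac t \<noteq> frac a"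
  shows "eventually (\<lambda>s. shift_into a s = s + (shift_into a t - t)) (nhds t)"
proof -
  let ?u = "shift_into a t"
  have u: "a < ?u" "?u < a + 1" using shift_into_strict[OF assms] shift_into_bounds by auto
  have "eventually (\<lambda>s. s \<in> {t + (a - ?u)<..<t + (a + 1 - ?u)}) (nhds t)"
    by (rule eventually_nhds_in_open) (use u in auto)
  then show ?thesis
  proof eventually_elim
    case (elim s)
    show ?case
    proof (rule shift_into_unique)
      have "s + (?u - t) - s = of_int (- \<lfloor>t - a\<rfloor>)" by (simp add: shift_into_def)
      then show "frac (s + (?u - t)) = frac s" by (metis Ints_of_int frac_eq_iff_Ints)
    qed (use elim in auto)
  qed
qed

lemma cis_2pi_cong: "frac s = frac t \<Longrightarrow> cis (2 * pi * s) = cis (2 * pi * t)"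
proof -
  assume "frac s = frac t"
  then obtain k where "s - t = of_int k" unfolding frac_eq_iff_Ints by (auto elim: Ints_cases)
  then have "2 * pi * s = 2 * pi * t + 2 * pi * of_int k" by (simp add: algebra_simps)
  then have "cis (2 * pi * s) = cis (2 * pi * t) * cis (2 * pi * of_int k)" by (simp only: cis_mult)
  also have "cis (2 * pi * of_int k) = 1" by (rule cis_multiple_2pi) simp
  finally show ?thesis by (simp only: mult_1_right)
qed

lemma cis_2pi_eq_iff: "cis (2 * pi * s) = cis (2 * pi * t) \<longleftrightarrow> frac s = frac t"
proof
  assume "cis (2 * pi * s) = cis (2 * pi * t)"
  then obtain n where "2 * pi * s = 2 * pi * t + 2 * pi * of_int n"
    unfolding complex_eq_iff cis.sel using sin_cos_eq_iff[of "2 * pi * s" "2 * pi * t"] by auto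
  then have "2 * pi * (s - t - of_int n) = 0" by (simp add: algebra_simps)
  then have "s - t = of_int n" by simp
  then show "frac s = frac t" unfolding frac_eq_iff_Ints by simp
qed (rule cis_2pi_cong)

lemma cis_2pi_frac [simp]: "cis (2 * pi * frac t) = cis (2 * pi * t)"
  by (rule cis_2pi_cong) (simp add: frac_eq)

text \<open>Rotating the circle so that the cut point lands on the negative real axis turns the
  representative into a branch of the argument: with u the offset from the cut, the rotated point is
  \<open>cis (2 * pi * u - pi)\<close>. The topology of the torus is given through
  \<open>cis\<close>, so this is the route to continuity of the charts.\<close>

lemma cis_shift_into_Arg:
  assumes "frac t \<noteq> frac a"
  shows "shift_into a t = a + 1/2 + Arg (- cis (2 * pi * t) * cis (- 2 * pi * a)) / (2 * pi)"
    and "- cis (2 * pi * t) * cis (- 2 * pi * a) \<notin> \<real>\<^sub>\<le>\<^sub>0"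
proof -
  let ?u = "shift_into a t - a"
  have u: "0 < ?u" "?u < 1" using shift_into_strict[OF assms] shift_into_bounds[of a t] by auto
  have "- cis (2 * pi * t) * cis (- 2 * pi * a) = cis (- pi) * cis (2 * pi * shift_into a t) * cis (- 2 * pi * a)"
    using cis_2pi_cong[of "shift_into a t" t] by (simp add: cis_pi cis_cnj[symmetric] flip: cis_inverse)
  also have "\<dots> = cis (2 * pi * ?u - pi)" by (simp add: cis_mult algebra_simps)
  finally have eq: "- cis (2 * pi * t) * cis (- 2 * pi * a) = cis (2 * pi * ?u - pi)" .
  have rng: "2 * pi * ?u - pi \<in> {- pi<..<pi}"
  proof -
    have "0 < 2 * pi * ?u" using u by simp
    moreover have "2 * pi * ?u < 2 * pi * 1" using u by (intro mult_strict_left_mono) auto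
    ultimately show ?thesis by auto
  qed
  have A: "Arg (cis (2 * pi * ?u - pi)) = 2 * pi * ?u - pi" by (rule Arg_cis) (use rng in auto)
  show "shift_into a t = a + 1/2 + Arg (- cis (2 * pi * t) * cis (- 2 * pi * a)) / (2 * pi)"
    unfolding eq A by (simp add: field_simps)
  have "cis (2 * pi * ?u - pi) \<notin> \<real>\<^sub>\<le>\<^sub>0"
  proof
    assume "cis (2 * pi * ?u - pi) \<in> \<real>\<^sub>\<le>\<^sub>0"
    then have "sin (2 * pi * ?u - pi) = 0" "cos (2 * pi * ?u - pi) \<le> 0"
      unfolding complex_nonpos_Reals_iff cis.sel by auto
    moreover have "2 * pi * ?u - pi = 0"
      by (rule sin_eq_0_pi[OF _ _ calculation(1)]) (use rng in simp_all)
    ultimately show False by (metis cos_zero not_one_le_zero)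
  qed
  then show "- cis (2 * pi * t) * cis (- 2 * pi * a) \<notin> \<real>\<^sub>\<le>\<^sub>0" unfolding eq .
qed

section \<open>The torus: representatives, topology, compactness and connectedness\<close>

definition vec3 :: "real \<times> real \<times> real \<Rightarrow> coord" where
  "vec3 v = (\<lambda>i\<in>{..<3}. if i = 0 then fst v else if i = 1 then fst (snd v) else snd (snd v))"

lemma less_3_iff: "i < 3 \<longleftrightarrow> i = 0 \<or> i = 1 \<or> i = (2::nat)" by auto

lemma all_less_3: "(\<forall>i<3. P i) \<longleftrightarrow> P 0 \<and> P 1 \<and> P (2::nat)" by (auto simp: less_3_iff)

lemma sum_less_3: "(\<Sum>i<3. f i) = f 0 + f 1 + f (2::nat)" for f :: "nat \<Rightarrow> 'a::comm_monoid_add"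
  by (simp add: eval_nat_numeral)

lemma vec3_simps [simp]: "vec3 v 0 = fst v" "vec3 v (Suc 0) = fst (snd v)" "vec3 v 2 = snd (snd v)"
  by (auto simp: vec3_def)

lemma vec3_extensional [simp]: "vec3 v \<in> extensional {..<3}" by (simp add: vec3_def)

lemma vec3_coords: "x \<in> extensional {..<3} \<Longrightarrow> vec3 (x 0, x 1, x 2) = x"
  by (rule ext) (auto simp: vec3_def less_3_iff extensional_def)

text \<open>The points are the representatives in \<open>[0, 1)\<^sup>3\<close>; the topology identifies opposite faces.\<close>

definition torus_set :: "coord set" where
  "torus_set = PiE {..<3} (\<lambda>_. {0..<1})"

text \<open>The value 0 at the remaining indices makes the target a full function type, so that the
  Hausdorff property and second countability of the torus are inherited from
  \<open>nat \<Rightarrow> complex\<close>.\<close>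

definition torus_embed :: "coord \<Rightarrow> nat \<Rightarrow> complex" where
  "torus_embed p i = (if i < 3 then cis (2 * pi * p i) else 0)"

definition torus_top :: "coord topology" where
  "torus_top = pullback_topology torus_set torus_embed euclidean"

text \<open>The covering map from R^3 onto the torus.\<close>

definition wrap :: "coord \<Rightarrow> coord" where
  "wrap x = (\<lambda>i\<in>{..<3}. frac (x i))"

lemma topspace_torus [simp]: "topspace torus_top = torus_set"
  by (simp add: torus_top_def topspace_pullback_topology)

lemma wrap_in_torus [simp]: "wrap x \<in> torus_set"
  by (auto simp: wrap_def torus_set_def frac_lt_1)

lemma wrap_id: "p \<in> torus_set \<Longrightarrow> wrap p = p"
  by (rule ext) (auto simp: wrap_def torus_set_def PiE_iff extensional_def frac_eq)

lemma torus_embed_wrap [simp]: "torus_embed (wrap x) i = (if i < 3 then cis (2 * pi * x i) else 0)"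
  by (simp add: torus_embed_def wrap_def)

lemma inj_on_torus_embed: "inj_on torus_embed torus_set"
proof (rule inj_onI)
  fix p q assume pq: "p \<in> torus_set" "q \<in> torus_set" "torus_embed p = torus_embed q"
  show "p = q"
  proof
    fix i show "p i = q i"
    proof (cases "i < 3")
      case True
      then have p: "0 \<le> p i" "p i < 1" "0 \<le> q i" "q i < 1" using pq by (auto simp: torus_set_def PiE_iff)
      have "cis (2 * pi * p i) = cis (2 * pi * q i)" using fun_cong[OF pq(3), of i] True by (simp add: torus_embed_def)
      then have "frac (p i) = frac (q i)" unfolding cis_2pi_eq_iff .
      then show ?thesis using p by (simp add: frac_eq)
    next
      case False
      then show ?thesis using pq by (auto simp: torus_set_def PiE_iff extensional_def)
    qed
  qed
qed

text \<open>The open sets of a pullback topology are exactly the preimages of open sets, so their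
  images are traces of open sets on the image of the map; injectivity supplies the rest.\<close>

lemma embedding_map_torus_embed: "embedding_map torus_top euclidean torus_embed"
  unfolding embedding_map_def
proof (rule bijective_open_imp_homeomorphic_map)
  show "continuous_map torus_top (subtopology euclidean (torus_embed ` topspace torus_top)) torus_embed"
    unfolding continuous_map_in_subtopology torus_top_def
    using continuous_map_pullback[OF continuous_map_id[of euclidean], of torus_set torus_embed]
    by (auto simp: topspace_pullback_topology)
  show "open_map torus_top (subtopology euclidean (torus_embed ` topspace torus_top)) torus_embed"
    unfolding open_map_def
  proof clarify
    fix U assume "openin torus_top U"
    then obtain V where V: "open V" "U = torus_embed -` V \<inter> torus_set"
      by (auto simp: torus_top_def openin_pullback_topology)
    then have "torus_embed ` U = V \<inter> torus_embed ` torus_set" by auto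
    then show "openin (subtopology euclidean (torus_embed ` topspace torus_top)) (torus_embed ` U)"
      using V by (auto simp: openin_subtopology)
  qed
qed (use inj_on_torus_embed in auto)

lemma torus_homeomorphic: "torus_top homeomorphic_space top_of_set (torus_embed ` torus_set)"
  using embedding_map_torus_embed embedding_map_imp_homeomorphic_space by fastforce

lemma second_countable_euclidean: "second_countable (euclidean :: 'a::second_countable_topology topology)"
proof -
  obtain B :: "'a set set" where "countable B" "topological_basis B"
    using ex_countable_basis by blast
  show ?thesis unfolding second_countable_def
  proof (intro exI[of _ B] conjI ballI allI impI)
    show "countable B" by fact
    show "openin euclidean V" if "V \<in> B" for V
      using topological_basis_open[OF \<open>topological_basis B\<close> that] by simp
    fix U and x :: 'a assume "openin euclidean U \<and> x \<in> U"
    then have "open U" "x \<in> U" by auto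
    then show "\<exists>V\<in>B. x \<in> V \<and> V \<subseteq> U"
      using topological_basisE[OF \<open>topological_basis B\<close>] by metis
  qed
qed

lemma Hausdorff_torus: "Hausdorff_space torus_top"
  unfolding homeomorphic_Hausdorff_space[OF torus_homeomorphic]
  by (rule Hausdorff_space_subtopology[OF Hausdorff_space_euclidean])

lemma second_countable_torus: "second_countable torus_top"
  unfolding homeomorphic_space_second_countability[OF torus_homeomorphic]
  by (rule second_countable_subtopology[OF second_countable_euclidean])

text \<open>Continuity into the torus is tested on the circle coordinates only; the real coordinates
  of \<open>f\<close> may jump by integers.\<close>

lemma continuous_map_into_torus:
  assumes "\<And>p. p \<in> topspace X \<Longrightarrow> f p \<in> torus_set"
    and "\<And>i. i < 3 \<Longrightarrow> continuous_map X euclidean (\<lambda>p. cis (2 * pi * f p i))"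
  shows "continuous_map X torus_top f"
  unfolding torus_top_def
proof (rule continuous_map_pullback')
  have "continuous_map X (product_topology (\<lambda>_. euclidean) UNIV) (torus_embed \<circ> f)"
    unfolding continuous_map_componentwise_UNIV
  proof
    fix k show "continuous_map X euclidean (\<lambda>p. (torus_embed \<circ> f) p k)"
      by (cases "k < 3") (simp_all add: torus_embed_def assms(2))
  qed
  then show "continuous_map X euclidean (torus_embed \<circ> f)" by (simp add: euclidean_product_topology)
qed (use assms in auto)

lemma continuous_map_wrap:
  assumes "\<And>i. i < 3 \<Longrightarrow> continuous_map X euclideanreal (\<lambda>p. f p i)"
  shows "continuous_map X torus_top (\<lambda>p. wrap (f p))"
proof (rule continuous_map_into_torus)
  fix i :: nat assume i: "i < 3"
  have "continuous_map euclideanreal euclidean (\<lambda>t. cis (2 * pi * t))"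
    unfolding continuous_map_iff_continuous2 by (intro continuous_intros)
  from continuous_map_compose[OF assms[OF i] this]
  show "continuous_map X euclidean (\<lambda>p. cis (2 * pi * wrap (f p) i))"
    using i by (simp add: o_def wrap_def)
qed simp

lemma continuous_map_vec3_wrap: "continuous_map euclidean torus_top (\<lambda>v. wrap (vec3 v))"
proof (rule continuous_map_wrap)
  fix i :: nat assume "i < 3"
  then consider "i = 0" | "i = Suc 0" | "i = 2" by linarith
  then show "continuous_map euclidean euclideanreal (\<lambda>v. vec3 v i)"
    unfolding continuous_map_iff_continuous2 by cases (simp_all, (intro continuous_intros)+)
qed

text \<open>The closed box is compact and convex, and the covering map is continuous; compactness
  and connectedness of the torus are read off from this.\<close>

lemma torus_image: "(\<lambda>v. wrap (vec3 v)) ` cbox (0,0,0) (1,1,1) = torus_set"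
proof (intro equalityI subsetI)
  fix p assume p: "p \<in> torus_set"
  then have "p \<in> extensional {..<3}" by (simp add: torus_set_def PiE_iff)
  then have "p = wrap (vec3 (p 0, p 1, p 2))" using p by (simp only: vec3_coords wrap_id)
  moreover have "(p 0, p 1, p 2) \<in> cbox (0,0,0) (1,1,1)"
    using p by (simp add: torus_set_def PiE_iff cbox_Pair_eq less_imp_le)
  ultimately show "p \<in> (\<lambda>v. wrap (vec3 v)) ` cbox (0,0,0) (1,1,1)" by (rule image_eqI)
next
  fix p assume "p \<in> (\<lambda>v. wrap (vec3 v)) ` cbox (0,0,0) (1,1,1)"
  then show "p \<in> torus_set" by (elim imageE) simp
qed

lemma compact_torus: "compact_space torus_top"
proof -
  have "compactin torus_top ((\<lambda>v. wrap (vec3 v)) ` cbox (0,0,0) (1,1,1))"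
    by (rule image_compactin[OF _ continuous_map_vec3_wrap])
      (unfold compactin_euclidean_iff, rule compact_cbox)
  then show ?thesis unfolding torus_image compact_space_def by simp
qed

lemma connected_torus: "connected_space torus_top"
proof -
  have "connectedin torus_top ((\<lambda>v. wrap (vec3 v)) ` cbox (0,0,0) (1,1,1))"
    by (rule connectedin_continuous_map_image[OF continuous_map_vec3_wrap])
      (unfold connectedin_iff_connected, rule convex_connected[OF convex_box(1)])
  then have "connectedin torus_top (topspace torus_top)" unfolding torus_image by simp
  then show ?thesis unfolding connectedin_topspace .
qed

section \<open>Smooth functions and the atlas\<close>

lemma topspace_euclid: "topspace (euclid n) = extensional {..<n}"
  by (simp add: PiE_def)

lemma continuous_map_euclid_upd:
  assumes "x \<in> extensional {..<n}" "i < n"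
  shows "continuous_map euclideanreal (euclid n) (\<lambda>t. x(i := t))"
  unfolding continuous_map_componentwise
proof (intro conjI ballI subsetI)
  fix y assume "y \<in> (\<lambda>t. x(i := t)) ` topspace euclideanreal"
  then show "y \<in> extensional {..<n}" using assms by (auto simp: extensional_def)
next
  fix k assume "k \<in> {..<n}"
  show "continuous_map euclideanreal euclideanreal (\<lambda>t. (x(i := t)) k)"
    by (cases "k = i") simp_all
qed

text \<open>An open set contains a piece of each coordinate line through each of its points. Hence
  \<open>pderiv_at\<close> is a local operation, although the line itself may leave the set.\<close>

lemma eventually_upd_in_open:
  assumes "openin (euclid n) U" "x \<in> U" "i < n"
  shows "eventually (\<lambda>t. x(i := t) \<in> U) (nhds (x i))"
proof -
  have "x \<in> extensional {..<n}" using openin_subset[OF assms(1)] assms(2) unfolding topspace_euclid by blast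
  from openin_continuous_map_preimage[OF continuous_map_euclid_upd[OF this assms(3)] assms(1)]
  have "open {t. x(i := t) \<in> U}" by simp
  then have "eventually (\<lambda>t. t \<in> {t. x(i := t) \<in> U}) (nhds (x i))"
    by (rule eventually_nhds_in_open) (use assms(2) in simp)
  then show ?thesis by simp
qed

lemma pderiv_at_cong:
  assumes "openin (euclid n) U" "x \<in> U" "i < n" "\<And>y. y \<in> U \<Longrightarrow> f y = g y"
  shows "pderiv_at i f x = pderiv_at i g x"
  unfolding pderiv_at_def
proof (rule deriv_cong_ev)
  show "eventually (\<lambda>t. f (x(i := t)) = g (x(i := t))) (nhds (x i))"
    using eventually_upd_in_open[OF assms(1-3)] by eventually_elim (rule assms(4))
qed simp

lemma differentiable_upd_cong:
  fixes f g :: "coord \<Rightarrow> real"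
  assumes "openin (euclid n) U" "x \<in> U" "i < n" "\<And>y. y \<in> U \<Longrightarrow> f y = g y"
    and "(\<lambda>t. f (x(i := t))) differentiable at (x i)"
  shows "(\<lambda>t. g (x(i := t))) differentiable at (x i)"
proof -
  have ev: "eventually (\<lambda>t. f (x(i := t)) = g (x(i := t))) (nhds (x i))"
    using eventually_upd_in_open[OF assms(1-3)] by eventually_elim (rule assms(4))
  obtain D where "((\<lambda>t. f (x(i := t))) has_real_derivative D) (at (x i))"
    using assms(5) unfolding real_differentiable_def by blast
  then have "((\<lambda>t. g (x(i := t))) has_real_derivative D) (at (x i))"
    using DERIV_cong_ev[OF refl ev refl] by blast
  then show ?thesis unfolding real_differentiable_def by blast
qed

text \<open>Transition maps have an explicit formula only on overlaps, so smoothness has to depend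
  on the values on \<open>U\<close> alone. The induction generalizes over both functions because the
  derivatives agree on \<open>U\<close> again.\<close>

lemma Ck_on_cong:
  assumes "openin (euclid n) U" "\<And>y. y \<in> U \<Longrightarrow> f y = g y" "Ck_on k n U f"
  shows "Ck_on k n U g"
proof -
  have c: "continuous_map (subtopology (euclid n) U) euclideanreal g'"
    if "continuous_map (subtopology (euclid n) U) euclideanreal f'" "\<And>y. y \<in> U \<Longrightarrow> f' y = g' y" for f' g'
    by (rule continuous_map_eq[OF that(1)]) (use that(2) in simp)
  show ?thesis using assms(2,3)
  proof (induction k arbitrary: f g)
    case 0
    then show ?case unfolding Ck_on.simps by (intro c[of f g])
  next
    case (Suc k)
    note S = Suc.prems(2)[unfolded Ck_on.simps]
    show ?case unfolding Ck_on.simps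
    proof (intro conjI allI impI ballI)
      show "continuous_map (subtopology (euclid n) U) euclideanreal g"
        by (rule c[OF conjunct1[OF S] Suc.prems(1)])
    next
      fix i x assume i: "i < n" "x \<in> U"
      show "(\<lambda>t. g (x(i := t))) differentiable at (x i)"
        by (rule differentiable_upd_cong[OF assms(1) i(2,1) Suc.prems(1)]) (use S i in blast)+
    next
      fix i assume i: "i < n"
      then have f: "Ck_on k n U (pderiv_at i f)" using S by blast
      show "Ck_on k n U (pderiv_at i g)"
        by (rule Suc.IH[OF pderiv_at_cong[OF assms(1) _ i Suc.prems(1)] f])
    qed
  qed
qed

lemma smooth_fun_cong:
  assumes "openin (euclid n) U" "smooth_fun n U f" "\<And>y. y \<in> U \<Longrightarrow> f y = g y"
  shows "smooth_fun n U g"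
  using assms Ck_on_cong unfolding smooth_fun_def by metis

lemma pderiv_at_const [simp]: "pderiv_at i (\<lambda>_. c) = (\<lambda>_. 0)"
  by (rule ext) (simp add: pderiv_at_def)

lemma Ck_on_const: "Ck_on k n U (\<lambda>_. c)"
  by (induction k arbitrary: c) auto

lemma smooth_fun_const [simp]: "smooth_fun n U (\<lambda>_. c)"
  by (simp add: smooth_fun_def Ck_on_const)

lemma continuous_map_coord:
  assumes "j < n" "continuous_on S \<phi>" "\<And>x. x \<in> U \<Longrightarrow> x j \<in> S"
  shows "continuous_map (subtopology (euclid n) U) euclideanreal (\<lambda>x. \<phi> (x j))"
proof -
  have "continuous_map (euclid n) euclideanreal (\<lambda>x. x j)"
    using assms(1) by (intro continuous_map_product_projection) simp
  then have "continuous_map (subtopology (euclid n) U) (top_of_set S) (\<lambda>x. x j)"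
    unfolding continuous_map_in_subtopology
    using assms(3) by (auto intro: continuous_map_from_subtopology)
  moreover have "continuous_map (top_of_set S) euclideanreal \<phi>" using assms(2) by simp
  ultimately show ?thesis using continuous_map_compose[of _ _ "\<lambda>x. x j" _ \<phi>] by (simp add: o_def)
qed

lemma pderiv_at_coord:
  assumes "(\<phi> has_real_derivative D) (at (x j))"
  shows "pderiv_at i (\<lambda>y. \<phi> (y j)) x = (if i = j then D else 0)"
    and "(\<lambda>t. \<phi> ((x(i := t)) j)) differentiable at (x i)"
proof -
  have e: "(\<lambda>t. \<phi> ((x(i := t)) j)) = (if i = j then \<phi> else (\<lambda>_. \<phi> (x j)))" by auto
  have d: "((\<lambda>t. \<phi> ((x(i := t)) j)) has_real_derivative (if i = j then D else 0)) (at (x i))"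
    unfolding e using assms by simp
  show "pderiv_at i (\<lambda>y. \<phi> (y j)) x = (if i = j then D else 0)"
    unfolding pderiv_at_def by (rule DERIV_imp_deriv[OF d])
  show "(\<lambda>t. \<phi> ((x(i := t)) j)) differentiable at (x i)"
    unfolding real_differentiable_def by (rule exI) (rule d)
qed

text \<open>The induction on the order needs a class of functions closed under differentiation; real
  parts of entire functions, restricted to the real line, form one. Functions of a single coordinate
  suffice for a metric that varies with z alone.\<close>

lemma smooth_fun_holomorphic:
  assumes "f holomorphic_on UNIV" "j < n"
  shows "smooth_fun n U (\<lambda>x. Re (f (of_real (x j))))"
proof -
  have d: "((\<lambda>t. Re (f (complex_of_real t))) has_real_derivative Re (deriv f (of_real t))) (at t)"
    if "f holomorphic_on UNIV" for f t
    by (intro has_field_derivative_Re has_vector_derivative_real_field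
        holomorphic_derivI[OF that open_UNIV UNIV_I])
  have c: "continuous_map (subtopology (euclid n) U) euclideanreal (\<lambda>x. Re (f (of_real (x j))))"
    if "f holomorphic_on UNIV" for f
  proof -
    have "continuous_on UNIV (\<lambda>t. Re (f (complex_of_real t)))"
      by (rule DERIV_continuous_on) (rule has_field_derivative_at_within[OF d[OF that]])
    from continuous_map_coord[OF assms(2) this] show ?thesis by simp
  qed
  have "Ck_on k n U (\<lambda>x. Re (f (of_real (x j))))" for k
    using assms(1)
  proof (induction k arbitrary: f)
    case 0
    then show ?case unfolding Ck_on.simps by (rule c)
  next
    case (Suc k)
    note d = d[OF Suc.prems]
    have "Ck_on k n U (pderiv_at i (\<lambda>x. Re (f (of_real (x j)))))" for i
    proof -
      have "pderiv_at i (\<lambda>x. Re (f (of_real (x j)))) x = (if i = j then Re (deriv f (of_real (x j))) else 0)" for x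
        by (rule pderiv_at_coord(1)[where \<phi> = "\<lambda>t. Re (f (of_real t))", OF d])
      then have e: "pderiv_at i (\<lambda>x. Re (f (of_real (x j))))
          = (if i = j then (\<lambda>x. Re (deriv f (of_real (x j)))) else (\<lambda>_. 0))" by auto
      have "Ck_on k n U (\<lambda>x. Re (deriv f (of_real (x j))))"
        by (rule Suc.IH[OF holomorphic_deriv[OF Suc.prems open_UNIV]])
      then show ?thesis unfolding e by (simp add: Ck_on_const)
    qed
    moreover have "(\<lambda>t. Re (f (of_real ((x(i := t)) j)))) differentiable at (x i)" for x i
      by (rule pderiv_at_coord(2)[where \<phi> = "\<lambda>t. Re (f (of_real t))", OF d])
    ultimately show ?case unfolding Ck_on.simps using c[OF Suc.prems] by blast
  qed
  then show ?thesis unfolding smooth_fun_def by blast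
qed

lemma shift_into_has_derivative:
  assumes "frac t \<noteq> frac a"
  shows "(shift_into a has_real_derivative 1) (at t)"
proof -
  have "((\<lambda>s. s + (shift_into a t - t)) has_real_derivative 1) (at t)" by (auto intro!: derivative_eq_intros)
  then show ?thesis using DERIV_cong_ev[OF refl shift_into_locally_translation[OF assms] refl] by blast
qed

lemma pderiv_at_shift_into:
  assumes "frac (x j) \<noteq> frac a"
  shows "pderiv_at i (\<lambda>y. shift_into a (y j)) x = (if i = j then 1 else 0)"
    and "(\<lambda>t. shift_into a ((x(i := t)) j)) differentiable at (x i)"
  using pderiv_at_coord[where \<phi> = "shift_into a" and x = x and j = j, OF shift_into_has_derivative[OF assms]]
  by auto

text \<open>The first partial derivatives are constant on \<open>U\<close>, so a case distinction on
  the order replaces an induction.\<close>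

lemma smooth_fun_shift_into:
  assumes "openin (euclid n) U" "j < n" "\<And>x. x \<in> U \<Longrightarrow> frac (x j) \<noteq> frac a"
  shows "smooth_fun n U (\<lambda>x. shift_into a (x j))"
  unfolding smooth_fun_def
proof
  have "continuous_on {t. frac t \<noteq> frac a} (shift_into a)"
    by (rule DERIV_continuous_on[of _ _ "\<lambda>_. 1"])
      (auto intro: has_field_derivative_at_within shift_into_has_derivative)
  then have c: "continuous_map (subtopology (euclid n) U) euclideanreal (\<lambda>x. shift_into a (x j))"
    by (rule continuous_map_coord[OF assms(2)]) (use assms(3) in simp)
  fix k show "Ck_on k n U (\<lambda>x. shift_into a (x j))"
  proof (cases k)
    case 0
    then show ?thesis using c by simp
  next
    case (Suc k')
    have "Ck_on k' n U (pderiv_at i (\<lambda>x. shift_into a (x j)))" if "i < n" for i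
      by (rule Ck_on_cong[OF assms(1) _ Ck_on_const[where c = "if i = j then 1 else 0"]])
        (use assms(3) in \<open>simp add: pderiv_at_shift_into\<close>)
    then show ?thesis using Suc c assms(3) pderiv_at_shift_into(2) by simp
  qed
qed

section \<open>Charts of the torus and their transition maps\<close>

lemma shift_into_frac [simp]: "shift_into a (frac t) = shift_into a t"
  by (rule shift_into_unique) (auto simp: shift_into_bounds frac_eq)

text \<open>The chart cuts the torus along the planes \<open>x\<^sub>i = a\<^sub>i\<close>, so that transition maps are locally integer translations.\<close>

definition torus_chart :: "coord \<Rightarrow> coord chart" where
  "torus_chart a = ({p \<in> torus_set. \<forall>i<3. p i \<noteq> frac (a i)}, \<lambda>p. \<lambda>i\<in>{..<3}. shift_into (a i) (p i))"

definition cube :: "coord \<Rightarrow> coord set" where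
  "cube a = PiE {..<3} (\<lambda>i. {a i<..<a i + 1})"

lemma cube_iff: "x \<in> cube a \<longleftrightarrow> x \<in> extensional {..<3} \<and> (\<forall>i<3. a i < x i \<and> x i < a i + 1)"
  by (auto simp: cube_def PiE_iff)

lemma openin_cube: "openin (euclid 3) (cube a)"
  unfolding cube_def by (subst openin_PiE) auto

lemma wrap_apply: "i < 3 \<Longrightarrow> wrap x i = frac (x i)"
  by (simp add: wrap_def)

lemma torus_set_frac: "p \<in> torus_set \<Longrightarrow> i < 3 \<Longrightarrow> frac (p i) = p i"
  by (simp add: torus_set_def PiE_iff frac_eq)

lemma wrap_in_chart: "x \<in> cube a \<Longrightarrow> wrap x \<in> fst (torus_chart a)"
  using frac_neq_in_interval by (auto simp: torus_chart_def cube_iff wrap_apply)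

lemma chart_wrap: "x \<in> cube a \<Longrightarrow> snd (torus_chart a) (wrap x) = x"
proof
  fix i assume x: "x \<in> cube a"
  show "snd (torus_chart a) (wrap x) i = x i"
  proof (cases "i < 3")
    case True
    then show ?thesis using x
      by (auto simp: torus_chart_def cube_iff wrap_def less_imp_le intro!: shift_into_unique)
  next
    case False
    then show ?thesis using x by (auto simp: torus_chart_def cube_iff extensional_def)
  qed
qed

lemma wrap_chart: "p \<in> fst (torus_chart a) \<Longrightarrow> wrap (snd (torus_chart a) p) = p"
proof
  fix i assume p: "p \<in> fst (torus_chart a)"
  show "wrap (snd (torus_chart a) p) i = p i"
  proof (cases "i < 3")
    case True
    then show ?thesis using p by (auto simp: torus_chart_def wrap_def torus_set_frac)
  next
    case False
    then show ?thesis using p by (auto simp: torus_chart_def torus_set_def PiE_iff extensional_def wrap_def)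
  qed
qed

lemma chart_in_cube: "p \<in> fst (torus_chart a) \<Longrightarrow> snd (torus_chart a) p \<in> cube a"
  unfolding cube_iff
  by (auto simp: torus_chart_def shift_into_bounds torus_set_frac intro!: shift_into_strict)

lemma chart_image_torus [simp]: "chart_image (torus_chart a) = cube a"
  unfolding chart_image_def
proof (intro equalityI subsetI)
  fix x assume x: "x \<in> cube a"
  show "x \<in> snd (torus_chart a) ` fst (torus_chart a)"
    using chart_wrap[OF x] wrap_in_chart[OF x] by (metis image_eqI)
qed (auto intro: chart_in_cube)

lemma continuous_map_torus_cis:
  assumes "i < 3"
  shows "continuous_map torus_top euclidean (\<lambda>p. cis (2 * pi * p i))"
proof -
  have "continuous_map (euclidean :: (nat \<Rightarrow> complex) topology) euclidean (\<lambda>z. z i)"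
    unfolding continuous_map_iff_continuous2 by (rule continuous_on_product_coordinates)
  from continuous_map_pullback[OF this, of torus_set torus_embed]
  show ?thesis using assms by (simp add: torus_top_def o_def torus_embed_def)
qed

lemma openin_torus_chart: "openin torus_top (fst (torus_chart a))"
proof -
  have o: "openin torus_top {p \<in> torus_set. cis (2 * pi * p i) \<in> - {cis (2 * pi * a i)}}" if "i < 3" for i
    using openin_continuous_map_preimage[OF continuous_map_torus_cis[OF that], of "- {cis (2 * pi * a i)}"]
    by (simp add: open_Compl)
  \<comment> \<open>The coordinate \<open>p i\<close> is not continuous on the torus, so the cut is
    expressed as a point removed from the circle.\<close>
  have "fst (torus_chart a) = (\<Inter>i\<in>{..<3}. {p \<in> torus_set. cis (2 * pi * p i) \<in> - {cis (2 * pi * a i)}})"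
  proof (rule Set.set_eqI)
    fix p show "p \<in> fst (torus_chart a) \<longleftrightarrow> p \<in> (\<Inter>i\<in>{..<3}. {p \<in> torus_set. cis (2 * pi * p i) \<in> - {cis (2 * pi * a i)}})"
      unfolding INT_iff Ball_def lessThan_iff all_less_3
      by (cases "p \<in> torus_set") (simp_all add: torus_chart_def cis_2pi_eq_iff torus_set_frac all_less_3)
  qed
  also have "openin torus_top \<dots>" by (rule openin_INT2) (use o in \<open>simp_all add: lessThan_empty_iff\<close>)
  finally show ?thesis .
qed

lemma continuous_map_torus_chart:
  "continuous_map (subtopology torus_top (fst (torus_chart a))) (euclid 3) (snd (torus_chart a))"
  unfolding continuous_map_componentwise
proof (intro conjI ballI)
  show "snd (torus_chart a) ` topspace (subtopology torus_top (fst (torus_chart a))) \<subseteq> extensional {..<3}"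
    by (auto simp: torus_chart_def)
  fix k :: nat assume "k \<in> {..<3}"
  then have k: "k < 3" by simp
  \<comment> \<open>The plane slit along the ray through the cut point; there the rotated argument
    is continuous.\<close>
  let ?S = "{z. - z * cis (- 2 * pi * a k) \<notin> \<real>\<^sub>\<le>\<^sub>0}"
  let ?X = "subtopology torus_top (fst (torus_chart a))"
  have fr: "frac (p k) \<noteq> frac (a k)" if "p \<in> fst (torus_chart a)" for p
    using that k by (simp add: torus_chart_def torus_set_frac)
  have "continuous_map ?X (top_of_set ?S) (\<lambda>p. cis (2 * pi * p k))"
    unfolding continuous_map_in_subtopology
    using cis_shift_into_Arg(2)[OF fr] continuous_map_from_subtopology[OF continuous_map_torus_cis[OF k]]
    by auto
  moreover have "continuous_map (top_of_set ?S) euclideanreal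
      (\<lambda>z. a k + 1/2 + Arg (- z * cis (- 2 * pi * a k)) / (2 * pi))"
    by (simp, intro continuous_intros continuous_on_Arg') auto
  ultimately have "continuous_map ?X euclideanreal
      (\<lambda>p. a k + 1/2 + Arg (- cis (2 * pi * p k) * cis (- 2 * pi * a k)) / (2 * pi))"
    using continuous_map_compose[of ?X "top_of_set ?S" "\<lambda>p. cis (2 * pi * p k)" euclideanreal
        "\<lambda>z. a k + 1/2 + Arg (- z * cis (- 2 * pi * a k)) / (2 * pi)"] by (simp add: o_def)
  then show "continuous_map ?X euclideanreal (\<lambda>p. snd (torus_chart a) p k)"
  proof (rule continuous_map_eq)
    fix p assume "p \<in> topspace ?X"
    then have "p \<in> fst (torus_chart a)" by simp
    from cis_shift_into_Arg(1)[OF fr[OF this]]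
    show "a k + 1/2 + Arg (- cis (2 * pi * p k) * cis (- 2 * pi * a k)) / (2 * pi) = snd (torus_chart a) p k"
      using k by (simp add: torus_chart_def)
  qed
qed

text \<open>The covering map, restricted to the open cube, is the continuous inverse of the
  chart.\<close>

lemma embedding_map_torus_chart:
  "embedding_map (subtopology torus_top (fst (torus_chart a))) (euclid 3) (snd (torus_chart a))"
proof -
  let ?X = "subtopology torus_top (fst (torus_chart a))"
  have dom: "topspace ?X = fst (torus_chart a)" by (auto simp: torus_chart_def)
  have im: "snd (torus_chart a) ` topspace ?X = cube a"
    using chart_image_torus[of a] unfolding dom chart_image_def .
  have top: "topspace (subtopology (euclid 3) (cube a)) = cube a"
    using openin_subset[OF openin_cube[of a]] by auto
  have "continuous_map (subtopology (euclid 3) (cube a)) torus_top (\<lambda>x. wrap x)"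
    by (rule continuous_map_wrap) (intro continuous_map_from_subtopology continuous_map_product_projection, simp)
  then have "homeomorphic_maps ?X (subtopology (euclid 3) (cube a)) (snd (torus_chart a)) wrap"
    unfolding homeomorphic_maps_def continuous_map_in_subtopology
    using continuous_map_torus_chart[of a] wrap_chart[of _ a] chart_wrap[of _ a] wrap_in_chart[of _ a] im top dom
    by auto
  then show ?thesis unfolding embedding_map_def im by (rule homeomorphic_maps_imp_map)
qed

lemma inj_on_torus_chart: "inj_on (snd (torus_chart a)) (fst (torus_chart a))"
  by (rule inj_on_inverseI) (rule wrap_chart)

lemma transition_torus:
  assumes "x \<in> cube a"
  shows "transition (torus_chart a) (torus_chart b) x = (\<lambda>i\<in>{..<3}. shift_into (b i) (x i))"
proof -
  have "inv_into (fst (torus_chart a)) (snd (torus_chart a)) x = wrap x"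
    using inv_into_f_f[OF inj_on_torus_chart wrap_in_chart[OF assms]] chart_wrap[OF assms] by simp
  then show ?thesis unfolding transition_def
    by (auto simp: torus_chart_def wrap_apply)
qed

lemma overlap_torus:
  "overlap (torus_chart a) (torus_chart b) = {x \<in> cube a. \<forall>i<3. frac (x i) \<noteq> frac (b i)}"
proof (intro equalityI subsetI)
  fix x assume "x \<in> overlap (torus_chart a) (torus_chart b)"
  then obtain p where p: "p \<in> fst (torus_chart a)" "p \<in> fst (torus_chart b)" "x = snd (torus_chart a) p"
    by (auto simp: overlap_def)
  have "frac (x i) \<noteq> frac (b i)" if "i < 3" for i
    using p that by (simp add: torus_chart_def torus_set_frac)
  then show "x \<in> {x \<in> cube a. \<forall>i<3. frac (x i) \<noteq> frac (b i)}" using chart_in_cube p by blast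
next
  fix x assume x: "x \<in> {x \<in> cube a. \<forall>i<3. frac (x i) \<noteq> frac (b i)}"
  then have "wrap x \<in> fst (torus_chart b)" by (auto simp: torus_chart_def wrap_apply)
  then show "x \<in> overlap (torus_chart a) (torus_chart b)" unfolding overlap_def
    using x chart_wrap[of x a] wrap_in_chart[of x a] by (metis (lifting) IntI image_eqI mem_Collect_eq)
qed

text \<open>The conditions on \<open>frac\<close> do not display openness, so it is transported: the
  intersection of the two domains is open in the first one, its image is open in the image cube, and
  that cube is open.\<close>

lemma openin_overlap_torus: "openin (euclid 3) (overlap (torus_chart a) (torus_chart b))"
proof -
  have "openin (subtopology torus_top (fst (torus_chart a))) (fst (torus_chart a) \<inter> fst (torus_chart b))"
    unfolding openin_subtopology using openin_torus_chart by blast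
  then have "openin (subtopology (euclid 3) (snd (torus_chart a) ` topspace (subtopology torus_top (fst (torus_chart a)))))
      (overlap (torus_chart a) (torus_chart b))"
    using embedding_map_torus_chart[of a] unfolding embedding_map_def overlap_def
    by (metis homeomorphic_map_openness_eq)
  moreover have "snd (torus_chart a) ` topspace (subtopology torus_top (fst (torus_chart a))) = cube a"
    using chart_image_torus[of a] by (auto simp: chart_image_def torus_chart_def)
  ultimately show ?thesis using openin_cube openin_trans_full by metis
qed

text \<open>Transition maps are local translations. All tensor transformation laws on this atlas
  therefore reduce to equality of components.\<close>

lemma jacobian_torus:
  assumes "x \<in> overlap (torus_chart a) (torus_chart b)" "i < 3" "j < 3"
  shows "jacobian (torus_chart a) (torus_chart b) x j i = (if i = j then 1 else 0)"
proof -
  have "jacobian (torus_chart a) (torus_chart b) x j i = pderiv_at i (\<lambda>y. shift_into (b j) (y j)) x"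
    unfolding jacobian_def
    by (rule pderiv_at_cong[OF openin_overlap_torus assms(1,2)]) (use assms(3) in \<open>simp add: overlap_torus transition_torus\<close>)
  also have "\<dots> = (if i = j then 1 else 0)"
    by (rule pderiv_at_shift_into) (use assms in \<open>simp add: overlap_torus\<close>)
  finally show ?thesis .
qed

definition torus_atlas :: "coord chart set" where
  "torus_atlas = range torus_chart"

text \<open>Each coordinate is cut away from its own value: at 0 when the value is not 0, and at 1/2
  when it is.\<close>

lemma torus_set_covered:
  assumes "p \<in> torus_set"
  shows "p \<in> fst (torus_chart (\<lambda>i. if p i = 0 then 1/2 else 0))"
  using assms by (auto simp: torus_chart_def frac_eq)

lemma smooth_manifold_torus: "smooth_manifold 3 torus_top torus_atlas"
  unfolding smooth_manifold_def smooth_atlas_def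
proof (intro conjI Hausdorff_torus second_countable_torus ballI allI impI)
  fix c assume "c \<in> torus_atlas"
  then obtain a where "c = torus_chart a" by (auto simp: torus_atlas_def)
  then show "openin torus_top (fst c)" "openin (euclid 3) (chart_image c)"
    "embedding_map (subtopology torus_top (fst c)) (euclid 3) (snd c)"
    using openin_torus_chart openin_cube embedding_map_torus_chart by simp_all
next
  show "\<Union> (fst ` torus_atlas) = topspace torus_top"
  proof (intro equalityI subsetI)
    fix p assume "p \<in> \<Union> (fst ` torus_atlas)"
    then show "p \<in> topspace torus_top" by (auto simp: torus_atlas_def torus_chart_def)
  next
    fix p assume "p \<in> topspace torus_top"
    then show "p \<in> \<Union> (fst ` torus_atlas)"
      unfolding topspace_torus using torus_set_covered[of p] unfolding torus_atlas_def by blast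
  qed
next
  fix c c' j assume "c \<in> torus_atlas" "c' \<in> torus_atlas" and j: "j < (3::nat)"
  then obtain a b where ab: "c = torus_chart a" "c' = torus_chart b" by (auto simp: torus_atlas_def)
  show "smooth_fun 3 (overlap c c') (\<lambda>x. transition c c' x j)"
    unfolding ab
  proof (rule smooth_fun_cong[OF openin_overlap_torus])
    show "smooth_fun 3 (overlap (torus_chart a) (torus_chart b)) (\<lambda>x. shift_into (b j) (x j))"
      by (rule smooth_fun_shift_into[OF openin_overlap_torus j]) (use j in \<open>simp add: overlap_torus\<close>)
  qed (use j in \<open>simp add: overlap_torus transition_torus\<close>)
qed

section \<open>The Poincare inequality on the unit cube\<close>

text \<open>With the conditional means \<open>g(y)\<close>, \<open>k(x)\<close> and the mean \<open>m\<close>, this is the expansion of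
  \<open>\<integral> (f - g - k + m)\<^sup>2 \<ge> 0\<close>.\<close>

lemma (in pair_prob_space) variance_pair_le:
  fixes f :: "'a \<times> 'b \<Rightarrow> real"
  assumes [measurable]: "f \<in> borel_measurable (M1 \<Otimes>\<^sub>M M2)"
    and B: "\<And>z. z \<in> space (M1 \<Otimes>\<^sub>M M2) \<Longrightarrow> \<bar>f z\<bar> \<le> B"
  shows "(\<integral>z. (f z)\<^sup>2 \<partial>(M1 \<Otimes>\<^sub>M M2)) - (\<integral>z. f z \<partial>(M1 \<Otimes>\<^sub>M M2))\<^sup>2
    \<le> (\<integral>y. (\<integral>x. (f (x, y))\<^sup>2 \<partial>M1) - (\<integral>x. f (x, y) \<partial>M1)\<^sup>2 \<partial>M2)
     + (\<integral>x. (\<integral>y. (f (x, y))\<^sup>2 \<partial>M2) - (\<integral>y. f (x, y) \<partial>M2)\<^sup>2 \<partial>M1)"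
proof -
  let ?P = "M1 \<Otimes>\<^sub>M M2"
  define g where "g y = (\<integral>x. f (x, y) \<partial>M1)" for y
  define k where "k x = (\<integral>y. f (x, y) \<partial>M2)" for x
  define m where "m = (\<integral>z. f z \<partial>?P)"
  have [measurable]: "g \<in> borel_measurable M2" "k \<in> borel_measurable M1"
    unfolding g_def k_def by measurable
  have bnd: "\<bar>f (x, y)\<bar> \<le> B" if "x \<in> space M1" "y \<in> space M2" for x y
    using B that by (simp add: space_pair_measure)
  have B0: "0 \<le> B" using bnd M1.not_empty M2.not_empty by (meson abs_ge_zero equals0I order_trans)
  have gB: "\<bar>g y\<bar> \<le> B" if "y \<in> space M2" for y
  proof -
    have "norm (g y) \<le> (\<integral>x. norm (f (x, y)) \<partial>M1)" unfolding g_def by (rule integral_norm_bound)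
    also have "\<dots> \<le> B" by (rule M1.integral_le_const)
      (use bnd that in \<open>auto intro!: M1.integrable_const_bound[where B = B]\<close>)
    finally show ?thesis by simp
  qed
  have kB: "\<bar>k x\<bar> \<le> B" if "x \<in> space M1" for x
  proof -
    have "norm (k x) \<le> (\<integral>y. norm (f (x, y)) \<partial>M2)" unfolding k_def by (rule integral_norm_bound)
    also have "\<dots> \<le> B" by (rule M2.integral_le_const)
      (use bnd that in \<open>auto intro!: M2.integrable_const_bound[where B = B]\<close>)
    finally show ?thesis by simp
  qed
  have intP: "integrable ?P h" if "h \<in> borel_measurable ?P" "\<And>z. z \<in> space ?P \<Longrightarrow> \<bar>h z\<bar> \<le> C" for h :: "_ \<Rightarrow> real" and C
    by (rule P.integrable_const_bound[where B = C]) (use that in auto)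
  have prodB: "\<bar>a * b\<bar> \<le> B * B" if "\<bar>a\<bar> \<le> B" "\<bar>b\<bar> \<le> B" for a b :: real
    unfolding abs_mult by (rule mult_mono) (use that B0 in auto)
  have bz: "\<bar>f z\<bar> \<le> B" "\<bar>g (snd z)\<bar> \<le> B" "\<bar>k (fst z)\<bar> \<le> B" if "z \<in> space ?P" for z
    using that B[OF that] gB kB by (auto simp: space_pair_measure)
  have i_ff: "integrable ?P (\<lambda>z. f z * f z)" and i_fg: "integrable ?P (\<lambda>z. f z * g (snd z))"
    and i_fk: "integrable ?P (\<lambda>z. f z * k (fst z))" and i_gk: "integrable ?P (\<lambda>z. g (snd z) * k (fst z))"
    and i_gg: "integrable ?P (\<lambda>z. g (snd z) * g (snd z))" and i_kk: "integrable ?P (\<lambda>z. k (fst z) * k (fst z))"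
    by (rule intP[of _ "B * B"], measurable, intro prodB, simp_all add: bz)+
  have i_f: "integrable ?P f" and i_g: "integrable ?P (\<lambda>z. g (snd z))" and i_k: "integrable ?P (\<lambda>z. k (fst z))"
    by (rule intP[of _ B], measurable, simp add: bz)+
  have fst_i: "(\<integral>x. (\<integral>y. h (x, y) \<partial>M2) \<partial>M1) = (\<integral>z. h z \<partial>?P)" if "integrable ?P h" for h :: "_ \<Rightarrow> real"
    using that by (rule integral_fst')
  have snd_i: "(\<integral>y. (\<integral>x. h (x, y) \<partial>M1) \<partial>M2) = (\<integral>z. h z \<partial>?P)" if "integrable ?P h" for h :: "_ \<Rightarrow> real"
    using integral_snd[of "\<lambda>x y. h (x, y)"] that by simp
  have e_g: "(\<integral>z. g (snd z) \<partial>?P) = m" "(\<integral>y. g y \<partial>M2) = m"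
    using snd_i[OF i_g] snd_i[OF i_f] by (simp_all add: g_def m_def M1.prob_space)
  have e_k: "(\<integral>z. k (fst z) \<partial>?P) = m" "(\<integral>x. k x \<partial>M1) = m"
    using fst_i[OF i_k] fst_i[OF i_f] by (simp_all add: k_def m_def M2.prob_space)
  have e_fg: "(\<integral>z. f z * g (snd z) \<partial>?P) = (\<integral>y. g y * g y \<partial>M2)"
    using snd_i[OF i_fg] by (simp add: g_def)
  have e_fk: "(\<integral>z. f z * k (fst z) \<partial>?P) = (\<integral>x. k x * k x \<partial>M1)"
    using fst_i[OF i_fk] by (simp add: k_def)
  have e_gg: "(\<integral>z. g (snd z) * g (snd z) \<partial>?P) = (\<integral>y. g y * g y \<partial>M2)"
    using snd_i[OF i_gg] by (simp add: M1.prob_space)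
  have e_kk: "(\<integral>z. k (fst z) * k (fst z) \<partial>?P) = (\<integral>x. k x * k x \<partial>M1)"
    using fst_i[OF i_kk] by (simp add: M2.prob_space)
  \<comment> \<open>A function of x times a function of y integrates to the product of the two
    integrals, and both of these are the overall mean.\<close>
  have e_gk: "(\<integral>z. g (snd z) * k (fst z) \<partial>?P) = m * m"
    using snd_i[OF i_gk] e_g e_k by simp
  have "0 \<le> (\<integral>z. (f z - g (snd z) - k (fst z) + m)\<^sup>2 \<partial>?P)" by simp
  also have "(\<lambda>z. (f z - g (snd z) - k (fst z) + m)\<^sup>2) = (\<lambda>z. f z * f z + g (snd z) * g (snd z)
      + k (fst z) * k (fst z) + m * m - 2 * (f z * g (snd z)) - 2 * (f z * k (fst z)) + (2 * m) * f z
      + 2 * (g (snd z) * k (fst z)) - (2 * m) * g (snd z) - (2 * m) * k (fst z))"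
    by (rule ext) (simp add: power2_eq_square algebra_simps)
  also have "(\<integral>z. \<dots> z \<partial>?P) = (\<integral>z. f z * f z \<partial>?P) + (\<integral>y. g y * g y \<partial>M2) + (\<integral>x. k x * k x \<partial>M1) + m * m
      - 2 * (\<integral>y. g y * g y \<partial>M2) - 2 * (\<integral>x. k x * k x \<partial>M1) + (2 * m) * m + 2 * (m * m) - (2 * m) * m - (2 * m) * m"
    using i_ff i_fg i_fk i_gk i_gg i_kk i_f i_g i_k e_g e_k e_fg e_fk e_gg e_kk e_gk
    by (simp add: m_def[symmetric] P.prob_space)
  \<comment> \<open>The right-hand side of the claim is 2 int f^2 - int g^2 - int k^2, so this
    inequality is the claim rearranged.\<close>
  finally have main: "(\<integral>y. g y * g y \<partial>M2) + (\<integral>x. k x * k x \<partial>M1) \<le> (\<integral>z. f z * f z \<partial>?P) + m * m" by simp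
  have "integrable M2 (\<lambda>y. g y * g y)"
  proof (rule M2.integrable_const_bound[where B = "B * B"])
    show "AE x in M2. norm (g x * g x) \<le> B * B"
      unfolding real_norm_def by (rule AE_I2) (rule prodB; rule gB)
  qed measurable
  moreover have "integrable M1 (\<lambda>x. k x * k x)"
  proof (rule M1.integrable_const_bound[where B = "B * B"])
    show "AE x in M1. norm (k x * k x) \<le> B * B"
      unfolding real_norm_def by (rule AE_I2) (rule prodB; rule kB)
  qed measurable
  moreover have "integrable M2 (\<lambda>y. \<integral>x. f (x, y) * f (x, y) \<partial>M1)" "integrable M1 (\<lambda>x. \<integral>y. f (x, y) * f (x, y) \<partial>M2)"
    using integrable_snd[of "\<lambda>x y. f (x, y) * f (x, y)"] integrable_fst'[OF i_ff] i_ff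
    by (simp_all add: split_def)
  ultimately show ?thesis
    using main snd_i[OF i_ff] fst_i[OF i_ff]
    by (simp add: power2_eq_square g_def[symmetric] k_def[symmetric] m_def[symmetric])
qed

section \<open>Integrals over the unit interval, square and cube\<close>

definition unit_measure :: "real measure" where
  "unit_measure = restrict_space lborel {0..1}"

text \<open>Closed intervals make the underlying space compact, which bounds continuous functions;
  total mass 1 turns integrals into means. The product is nested to the right to match
  triples.\<close>

definition cube_measure :: "(real \<times> real \<times> real) measure" where
  "cube_measure = unit_measure \<Otimes>\<^sub>M (unit_measure \<Otimes>\<^sub>M unit_measure)"

lemma space_unit_measure: "space unit_measure = {0..1}"
  by (simp add: unit_measure_def space_restrict_space)

lemma prob_space_unit_measure: "prob_space unit_measure"
  unfolding unit_measure_def by (rule prob_space_restrict_space) auto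

lemma measurable_unit_measure: "(\<lambda>x. x) \<in> unit_measure \<rightarrow>\<^sub>M borel"
  unfolding unit_measure_def by (intro measurable_restrict_space1) simp

interpretation UM: prob_space unit_measure by (rule prob_space_unit_measure)
interpretation UM2: pair_prob_space unit_measure unit_measure ..
interpretation UM3: pair_prob_space unit_measure "unit_measure \<Otimes>\<^sub>M unit_measure" ..

lemma measurable_unit_pair: "(\<lambda>x. x) \<in> unit_measure \<Otimes>\<^sub>M unit_measure \<rightarrow>\<^sub>M borel"
proof -
  have "(\<lambda>x. (fst x, snd x)) \<in> unit_measure \<Otimes>\<^sub>M unit_measure \<rightarrow>\<^sub>M borel \<Otimes>\<^sub>M borel"
    by (intro measurable_Pair measurable_compose[OF measurable_fst measurable_unit_measure]
        measurable_compose[OF measurable_snd measurable_unit_measure])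
  then show ?thesis by (simp add: borel_prod)
qed

lemma measurable_cube_measure: "(\<lambda>x. x) \<in> cube_measure \<rightarrow>\<^sub>M borel"
proof -
  have "(\<lambda>x. (fst x, snd x)) \<in> cube_measure \<rightarrow>\<^sub>M borel \<Otimes>\<^sub>M borel"
    unfolding cube_measure_def
    by (intro measurable_Pair measurable_compose[OF measurable_fst measurable_unit_measure]
        measurable_compose[OF measurable_snd measurable_unit_pair])
  then show ?thesis by (simp add: borel_prod)
qed

interpretation CM: prob_space cube_measure
  unfolding cube_measure_def by (rule UM3.P.prob_space_axioms)

lemma space_cube_measure: "space cube_measure = {0..1} \<times> {0..1} \<times> {0..1}"
  by (simp add: cube_measure_def space_pair_measure space_unit_measure)

lemma continuous_cube:
  fixes f :: "real \<times> real \<times> real \<Rightarrow> real"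
  assumes "continuous_on UNIV f"
  shows "f \<in> borel_measurable cube_measure"
    and "\<exists>B. \<forall>v\<in>space cube_measure. \<bar>f v\<bar> \<le> B"
    and "integrable cube_measure f"
proof -
  show m: "f \<in> borel_measurable cube_measure"
    by (rule measurable_compose[OF measurable_cube_measure borel_measurable_continuous_onI[OF assms]])
  have "compact (space cube_measure)" unfolding space_cube_measure by (intro compact_Times compact_Icc)
  then have "bounded (f ` space cube_measure)"
    by (intro compact_imp_bounded compact_continuous_image continuous_on_subset[OF assms]) auto
  then show b: "\<exists>B. \<forall>v\<in>space cube_measure. \<bar>f v\<bar> \<le> B" by (auto simp: bounded_iff)
  then obtain B where "\<forall>v\<in>space cube_measure. \<bar>f v\<bar> \<le> B" by blast
  then show "integrable cube_measure f"
    by (intro CM.integrable_const_bound[where B = B]) (use m in auto)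
qed

lemma continuous_square:
  fixes f :: "real \<times> real \<Rightarrow> real"
  assumes "continuous_on UNIV f"
  shows "integrable (unit_measure \<Otimes>\<^sub>M unit_measure) f"
proof -
  let ?V = "unit_measure \<Otimes>\<^sub>M unit_measure"
  have m: "f \<in> borel_measurable ?V"
    by (rule measurable_compose[OF measurable_unit_pair borel_measurable_continuous_onI[OF assms]])
  have "compact (space ?V)" unfolding space_pair_measure space_unit_measure by (intro compact_Times compact_Icc)
  then have "bounded (f ` space ?V)"
    by (intro compact_imp_bounded compact_continuous_image continuous_on_subset[OF assms]) auto
  then obtain B where "\<forall>v\<in>space ?V. \<bar>f v\<bar> \<le> B" by (auto simp: bounded_iff)
  then show ?thesis by (intro UM2.P.integrable_const_bound[where B = B]) (use m in auto)
qed

lemma continuous_unit: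
  fixes f :: "real \<Rightarrow> real"
  assumes "continuous_on UNIV f"
  shows "integrable unit_measure f"
proof -
  have m: "f \<in> borel_measurable unit_measure"
    by (rule measurable_compose[OF measurable_unit_measure borel_measurable_continuous_onI[OF assms]])
  have "bounded (f ` {0..1})"
    by (intro compact_imp_bounded compact_continuous_image continuous_on_subset[OF assms]) auto
  then obtain B where "\<forall>v\<in>{0..1}. \<bar>f v\<bar> \<le> B" by (auto simp: bounded_iff)
  then show ?thesis
    by (intro UM.integrable_const_bound[where B = B]) (use m space_unit_measure in auto)
qed

lemma integral_unit_deriv:
  assumes "\<And>x. (g has_real_derivative g' x) (at x)" "continuous_on UNIV g'"
  shows "(\<integral>x. g' x \<partial>unit_measure) = g 1 - g 0"
proof -
  have "(\<integral>x. g' x \<partial>unit_measure) = (\<integral>x. indicator {0..1} x *\<^sub>R g' x \<partial>lborel)"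
    unfolding unit_measure_def by (subst integral_restrict_space) auto
  also have "\<dots> = g 1 - g 0"
    by (rule integral_FTC_Icc)
      (auto intro: has_field_derivative_at_within assms continuous_on_subset[OF assms(2)]
        simp flip: has_real_derivative_iff_has_vector_derivative)
  finally show ?thesis .
qed

text \<open>Cauchy-Schwarz by completing a square. With k the increment of \<open>g\<close> and
  1_{[a,b]} the indicator, integrating 0 <= (k - 1_{[a,b]} g')^2 gives 2 k^2 <= k^2 + int g'^2,
  because the total mass is 1 and the indicator can only lower the square of g'.\<close>

lemma diff_sq_le_integral:
  assumes d: "\<And>x. (g has_real_derivative g' x) (at x)" and c: "continuous_on UNIV g'"
    and ab: "0 \<le> a" "a \<le> b" "b \<le> 1"
  shows "(g b - g a)\<^sup>2 \<le> (\<integral>x. (g' x)\<^sup>2 \<partial>unit_measure)"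
proof -
  define k where "k = g b - g a"
  have i: "integrable unit_measure (\<lambda>x. indicator {a..b} x * g' x)"
    using integrable_real_mult_indicator[OF _ continuous_unit[OF c], of "{a..b}"]
    by (simp add: mult.commute unit_measure_def sets_restrict_space_iff ab)
  have "(\<integral>x. indicator {a..b} x * g' x \<partial>unit_measure) = (\<integral>x. indicator {0..1} x *\<^sub>R (indicator {a..b} x * g' x) \<partial>lborel)"
    unfolding unit_measure_def by (subst integral_restrict_space) auto
  also have "\<dots> = (\<integral>x. indicator {a..b} x *\<^sub>R g' x \<partial>lborel)"
    by (rule Bochner_Integration.integral_cong) (use ab in \<open>auto simp: indicator_def\<close>)
  also have "\<dots> = k" unfolding k_def
    by (rule integral_FTC_Icc)
      (auto intro: has_field_derivative_at_within assms continuous_on_subset[OF c]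
        simp flip: has_real_derivative_iff_has_vector_derivative)
  finally have e: "(\<integral>x. indicator {a..b} x * g' x \<partial>unit_measure) = k" .
  have i2: "integrable unit_measure (\<lambda>x. (g' x)\<^sup>2)"
    by (intro continuous_unit continuous_intros c)
  have "(\<integral>x. 2 * k * (indicator {a..b} x * g' x) \<partial>unit_measure) \<le> (\<integral>x. k\<^sup>2 + (g' x)\<^sup>2 \<partial>unit_measure)"
  proof (rule integral_mono)
    fix x
    have "0 \<le> (k - indicator {a..b} x * g' x)\<^sup>2" by simp
    also have "\<dots> \<le> k\<^sup>2 + (g' x)\<^sup>2 - 2 * k * (indicator {a..b} x * g' x)"
      by (auto simp: indicator_def power2_diff)
    finally show "2 * k * (indicator {a..b} x * g' x) \<le> k\<^sup>2 + (g' x)\<^sup>2" by simp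
  qed (use i i2 in auto)
  then have "2 * k * k \<le> k\<^sup>2 + (\<integral>x. (g' x)\<^sup>2 \<partial>unit_measure)"
    using i i2 e by (simp add: UM.prob_space)
  then have "k\<^sup>2 \<le> (\<integral>x. (g' x)\<^sup>2 \<partial>unit_measure)" by (simp add: power2_eq_square)
  then show ?thesis unfolding k_def .
qed

text \<open>Any two values of \<open>g\<close> differ by at most the square root of the energy, and
  the mean lies between the extreme values, so g - m is bounded pointwise by the same quantity. The
  constant 1 is not sharp, but no boundary condition enters.\<close>

lemma poincare_unit:
  assumes d: "\<And>x. (g has_real_derivative g' x) (at x)" and c: "continuous_on UNIV g'"
  shows "(\<integral>x. (g x)\<^sup>2 \<partial>unit_measure) - (\<integral>x. g x \<partial>unit_measure)\<^sup>2 \<le> (\<integral>x. (g' x)\<^sup>2 \<partial>unit_measure)"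
proof -
  define K where "K = (\<integral>x. (g' x)\<^sup>2 \<partial>unit_measure)"
  define m where "m = (\<integral>x. g x \<partial>unit_measure)"
  have K0: "0 \<le> K" unfolding K_def by simp
  have cg: "continuous_on UNIV g" by (rule DERIV_continuous_on) (rule has_field_derivative_at_within[OF d])
  have i: "integrable unit_measure g" "integrable unit_measure (\<lambda>x. (g x)\<^sup>2)"
    by (intro continuous_unit continuous_intros cg)+
  have le: "(g b - g a)\<^sup>2 \<le> K" if "a \<in> {0..1}" "b \<in> {0..1}" for a b
    using diff_sq_le_integral[OF d c, of a b] diff_sq_le_integral[OF d c, of b a] that
    unfolding K_def by (cases "a \<le> b") (auto simp: power2_commute)
  have pt: "(g b - m)\<^sup>2 \<le> K" if "b \<in> {0..1}" for b
  proof -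
    have "\<bar>g b - g a\<bar> \<le> sqrt K" if "a \<in> {0..1}" for a
      using real_sqrt_le_mono[OF le[OF that \<open>b \<in> {0..1}\<close>]] by simp
    then have r: "g b - sqrt K \<le> g a" "g a \<le> g b + sqrt K" if "a \<in> space unit_measure" for a
      using that unfolding space_unit_measure by (auto simp: abs_le_iff) (smt (verit) atLeastAtMost_iff)+
    have "m \<le> g b + sqrt K" unfolding m_def
      by (rule UM.integral_le_const[OF i(1)]) (use r in auto)
    moreover have "g b - sqrt K \<le> m" unfolding m_def
      by (rule UM.integral_ge_const[OF i(1)]) (use r in auto)
    ultimately have "\<bar>g b - m\<bar> \<le> sqrt K" by linarith
    then have "\<bar>g b - m\<bar>\<^sup>2 \<le> (sqrt K)\<^sup>2" by (rule power_mono) simp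
    then show ?thesis using K0 by simp
  qed
  have ie: "integrable unit_measure (\<lambda>x. (g x - m)\<^sup>2)" by (intro continuous_unit continuous_intros cg)
  have "(\<integral>x. (g x - m)\<^sup>2 \<partial>unit_measure) \<le> K"
    by (rule UM.integral_le_const[OF ie]) (use pt space_unit_measure in auto)
  moreover have "(\<integral>x. (g x - m)\<^sup>2 \<partial>unit_measure) = (\<integral>x. (g x)\<^sup>2 - (2 * m) * g x + m\<^sup>2 \<partial>unit_measure)"
    by (rule Bochner_Integration.integral_cong) (auto simp: power2_eq_square algebra_simps)
  moreover have "\<dots> = (\<integral>x. (g x)\<^sup>2 \<partial>unit_measure) - 2 * m * m + m\<^sup>2"
    using i by (simp add: m_def[symmetric] UM.prob_space)
  ultimately show ?thesis unfolding K_def[symmetric] m_def[symmetric] by (simp add: power2_eq_square)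
qed

text \<open>Splitting the variance over the factors, x against (y, z) and then y against z, reduces
  the claim to the interval without loss in the constant.\<close>

lemma poincare_cube:
  fixes f fx fy fz :: "real \<times> real \<times> real \<Rightarrow> real"
  assumes c: "continuous_on UNIV f" "continuous_on UNIV fx" "continuous_on UNIV fy" "continuous_on UNIV fz"
    and dx: "\<And>x y z. ((\<lambda>t. f (t, y, z)) has_real_derivative fx (x, y, z)) (at x)"
    and dy: "\<And>x y z. ((\<lambda>t. f (x, t, z)) has_real_derivative fy (x, y, z)) (at y)"
    and dz: "\<And>x y z. ((\<lambda>t. f (x, y, t)) has_real_derivative fz (x, y, z)) (at z)"
  shows "(\<integral>v. (f v)\<^sup>2 \<partial>cube_measure) - (\<integral>v. f v \<partial>cube_measure)\<^sup>2
    \<le> (\<integral>v. (fx v)\<^sup>2 \<partial>cube_measure) + (\<integral>v. (fy v)\<^sup>2 \<partial>cube_measure) + (\<integral>v. (fz v)\<^sup>2 \<partial>cube_measure)"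
proof -
  let ?U = unit_measure
  let ?V = "?U \<Otimes>\<^sub>M ?U"
  obtain B where B: "\<And>v. v \<in> space cube_measure \<Longrightarrow> \<bar>f v\<bar> \<le> B" using continuous_cube(2)[OF c(1)] by blast
  have sec: "continuous_on UNIV (\<lambda>t. h (t, y, z))" "continuous_on UNIV (\<lambda>t. h (x, t, z))" "continuous_on UNIV (\<lambda>t. h (x, y, t))"
    "continuous_on UNIV (\<lambda>w. h (x, w))"
    if "continuous_on UNIV h" for h :: "real \<times> real \<times> real \<Rightarrow> real" and x y z
    by (rule continuous_on_compose2[OF that], intro continuous_intros, simp)+
  have iV: "integrable ?V (\<lambda>w. (h (x, w))\<^sup>2)" if "continuous_on UNIV h" for h :: "real \<times> real \<times> real \<Rightarrow> real" and x
    by (intro continuous_square continuous_intros sec(4)[OF that])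
  have iQ: "integrable (?U \<Otimes>\<^sub>M ?V) (\<lambda>v. (h v)\<^sup>2)" if "continuous_on UNIV h" for h :: "real \<times> real \<times> real \<Rightarrow> real"
    unfolding cube_measure_def[symmetric] by (intro continuous_cube(3) continuous_intros that)
  have mf: "f \<in> borel_measurable (?U \<Otimes>\<^sub>M ?V)" using continuous_cube(1)[OF c(1)] unfolding cube_measure_def .
  have mfx: "(\<lambda>w. f (x, w)) \<in> borel_measurable ?V" for x
    by (rule measurable_compose[OF measurable_unit_pair borel_measurable_continuous_onI[OF sec(4)[OF c(1)]]])
  have 1: "(\<integral>w. (\<integral>x. (f (x, w))\<^sup>2 \<partial>?U) - (\<integral>x. f (x, w) \<partial>?U)\<^sup>2 \<partial>?V) \<le> (\<integral>v. (fx v)\<^sup>2 \<partial>cube_measure)"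
  proof -
    have "(\<integral>w. (\<integral>x. (f (x, w))\<^sup>2 \<partial>?U) - (\<integral>x. f (x, w) \<partial>?U)\<^sup>2 \<partial>?V) \<le> (\<integral>w. (\<integral>x. (fx (x, w))\<^sup>2 \<partial>?U) \<partial>?V)"
    \<comment> \<open>Only the nonnegative upper bound has to be shown integrable here; the
      conditional variance needs no such argument of its own.\<close>
    proof (rule integral_mono')
      show "integrable ?V (\<lambda>w. \<integral>x. (fx (x, w))\<^sup>2 \<partial>?U)"
        using UM3.integrable_snd[of "\<lambda>x w. (fx (x, w))\<^sup>2"] iQ[OF c(2)] by (simp add: split_def)
      fix w :: "real \<times> real"
      obtain y z where w: "w = (y, z)" by (cases w)
      show "(\<integral>x. (f (x, w))\<^sup>2 \<partial>?U) - (\<integral>x. f (x, w) \<partial>?U)\<^sup>2 \<le> (\<integral>x. (fx (x, w))\<^sup>2 \<partial>?U)"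
        unfolding w by (rule poincare_unit[OF dx sec(1)[OF c(2)]])
    qed simp
    also have "\<dots> = (\<integral>v. (fx v)\<^sup>2 \<partial>cube_measure)"
      using UM3.integral_snd[of "\<lambda>x w. (fx (x, w))\<^sup>2"] iQ[OF c(2)] by (simp add: cube_measure_def split_def)
    finally show ?thesis .
  qed
  have 2: "(\<integral>w. (f (x, w))\<^sup>2 \<partial>?V) - (\<integral>w. f (x, w) \<partial>?V)\<^sup>2
      \<le> (\<integral>w. (fy (x, w))\<^sup>2 \<partial>?V) + (\<integral>w. (fz (x, w))\<^sup>2 \<partial>?V)" if x: "x \<in> {0..1}" for x
  proof -
    have "(\<integral>w. (f (x, w))\<^sup>2 \<partial>?V) - (\<integral>w. f (x, w) \<partial>?V)\<^sup>2
      \<le> (\<integral>z. (\<integral>y. (f (x, y, z))\<^sup>2 \<partial>?U) - (\<integral>y. f (x, y, z) \<partial>?U)\<^sup>2 \<partial>?U)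
       + (\<integral>y. (\<integral>z. (f (x, y, z))\<^sup>2 \<partial>?U) - (\<integral>z. f (x, y, z) \<partial>?U)\<^sup>2 \<partial>?U)"
      by (rule UM2.variance_pair_le[OF mfx, of _ B])
        (use B x in \<open>auto simp: space_cube_measure space_pair_measure space_unit_measure\<close>)
    also have "(\<integral>z. (\<integral>y. (f (x, y, z))\<^sup>2 \<partial>?U) - (\<integral>y. f (x, y, z) \<partial>?U)\<^sup>2 \<partial>?U) \<le> (\<integral>z. (\<integral>y. (fy (x, y, z))\<^sup>2 \<partial>?U) \<partial>?U)"
    proof (rule integral_mono')
      show "integrable ?U (\<lambda>z. \<integral>y. (fy (x, y, z))\<^sup>2 \<partial>?U)"
        using UM2.integrable_snd[of "\<lambda>y z. (fy (x, y, z))\<^sup>2"] iV[OF c(3), of x] by (simp add: split_def)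
      show "(\<integral>y. (f (x, y, z))\<^sup>2 \<partial>?U) - (\<integral>y. f (x, y, z) \<partial>?U)\<^sup>2 \<le> (\<integral>y. (fy (x, y, z))\<^sup>2 \<partial>?U)" for z
        by (rule poincare_unit[OF dy sec(2)[OF c(3)]])
    qed simp
    also have "\<dots> = (\<integral>w. (fy (x, w))\<^sup>2 \<partial>?V)"
      using UM2.integral_snd[of "\<lambda>y z. (fy (x, y, z))\<^sup>2"] iV[OF c(3), of x] by (simp add: split_def)
    also have "(\<integral>y. (\<integral>z. (f (x, y, z))\<^sup>2 \<partial>?U) - (\<integral>z. f (x, y, z) \<partial>?U)\<^sup>2 \<partial>?U) \<le> (\<integral>y. (\<integral>z. (fz (x, y, z))\<^sup>2 \<partial>?U) \<partial>?U)"
    proof (rule integral_mono')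
      show "integrable ?U (\<lambda>y. \<integral>z. (fz (x, y, z))\<^sup>2 \<partial>?U)"
        using UM2.integrable_fst'[OF iV[OF c(4), of x]] by simp
      show "(\<integral>z. (f (x, y, z))\<^sup>2 \<partial>?U) - (\<integral>z. f (x, y, z) \<partial>?U)\<^sup>2 \<le> (\<integral>z. (fz (x, y, z))\<^sup>2 \<partial>?U)" for y
        by (rule poincare_unit[OF dz sec(3)[OF c(4)]])
    qed simp
    also have "\<dots> = (\<integral>w. (fz (x, w))\<^sup>2 \<partial>?V)"
      using UM2.integral_fst'[OF iV[OF c(4), of x]] by simp
    finally show ?thesis by simp
  qed
  have i3: "integrable ?U (\<lambda>x. \<integral>w. (h (x, w))\<^sup>2 \<partial>?V)" if "continuous_on UNIV h" for h :: "real \<times> real \<times> real \<Rightarrow> real"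
    using UM3.integrable_fst'[OF iQ[OF that]] by simp
  have "(\<integral>v. (f v)\<^sup>2 \<partial>cube_measure) - (\<integral>v. f v \<partial>cube_measure)\<^sup>2
      \<le> (\<integral>w. (\<integral>x. (f (x, w))\<^sup>2 \<partial>?U) - (\<integral>x. f (x, w) \<partial>?U)\<^sup>2 \<partial>?V)
       + (\<integral>x. (\<integral>w. (f (x, w))\<^sup>2 \<partial>?V) - (\<integral>w. f (x, w) \<partial>?V)\<^sup>2 \<partial>?U)"
    unfolding cube_measure_def
    by (rule UM3.variance_pair_le[OF mf]) (use B in \<open>simp add: cube_measure_def\<close>)
  also have "(\<integral>x. (\<integral>w. (f (x, w))\<^sup>2 \<partial>?V) - (\<integral>w. f (x, w) \<partial>?V)\<^sup>2 \<partial>?U)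
      \<le> (\<integral>x. (\<integral>w. (fy (x, w))\<^sup>2 \<partial>?V) + (\<integral>w. (fz (x, w))\<^sup>2 \<partial>?V) \<partial>?U)"
    by (rule integral_mono') (use 2 i3[OF c(3)] i3[OF c(4)] in \<open>auto simp: space_unit_measure\<close>)
  also have "\<dots> = (\<integral>x. (\<integral>w. (fy (x, w))\<^sup>2 \<partial>?V) \<partial>?U) + (\<integral>x. (\<integral>w. (fz (x, w))\<^sup>2 \<partial>?V) \<partial>?U)"
    by (rule Bochner_Integration.integral_add[OF i3[OF c(3)] i3[OF c(4)]])
  also have "(\<integral>x. (\<integral>w. (fy (x, w))\<^sup>2 \<partial>?V) \<partial>?U) = (\<integral>v. (fy v)\<^sup>2 \<partial>cube_measure)"
    using UM3.integral_fst'[OF iQ[OF c(3)]] by (simp add: cube_measure_def)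
  also have "(\<integral>x. (\<integral>w. (fz (x, w))\<^sup>2 \<partial>?V) \<partial>?U) = (\<integral>v. (fz v)\<^sup>2 \<partial>cube_measure)"
    using UM3.integral_fst'[OF iQ[OF c(4)]] by (simp add: cube_measure_def)
  finally show ?thesis using 1 by linarith
qed

text \<open>The weight is a function of z and comes out of the inner x-integral, which is the
  increment of a function with equal values at both ends. Together with the y-version this carries
  the integration by parts for the eigenform.\<close>

lemma integral_cube_deriv_x:
  fixes f fx :: "real \<times> real \<times> real \<Rightarrow> real"
  assumes c: "continuous_on UNIV fx" "continuous_on UNIV h"
    and d: "\<And>x y z. ((\<lambda>t. f (t, y, z)) has_real_derivative fx (x, y, z)) (at x)"
    and p: "\<And>y z. f (1, y, z) = f (0, y, z)"
  shows "(\<integral>v. h (snd (snd v)) * fx v \<partial>cube_measure) = 0"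
proof -
  have sec: "continuous_on UNIV (\<lambda>t. fx (t, y, z))" for y z
    by (rule continuous_on_compose2[OF c(1)], intro continuous_intros, simp)+
  have ch: "continuous_on UNIV (\<lambda>v. h (snd (snd v)) :: real)"
    by (rule continuous_on_compose2[OF c(2)], intro continuous_intros, simp)+
  have "integrable cube_measure (\<lambda>v. h (snd (snd v)) * fx v)"
    by (intro continuous_cube(3) continuous_intros ch c(1))
  then have "(\<integral>v. h (snd (snd v)) * fx v \<partial>cube_measure)
      = (\<integral>w. (\<integral>x. h (snd w) * fx (x, w) \<partial>unit_measure) \<partial>(unit_measure \<Otimes>\<^sub>M unit_measure))"
    using UM3.integral_snd[of "\<lambda>x w. h (snd w) * fx (x, w)"] by (simp add: cube_measure_def split_def)
  also have "\<dots> = 0"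
  proof -
    have "(\<integral>x. fx (x, w) \<partial>unit_measure) = 0" for w
      using integral_unit_deriv[OF d sec, of "fst w" "snd w"] p[of "fst w" "snd w"] by simp
    then show ?thesis by simp
  qed
  finally show ?thesis .
qed

lemma integral_cube_deriv_y:
  fixes f fy :: "real \<times> real \<times> real \<Rightarrow> real"
  assumes c: "continuous_on UNIV fy" "continuous_on UNIV h"
    and d: "\<And>x y z. ((\<lambda>t. f (x, t, z)) has_real_derivative fy (x, y, z)) (at y)"
    and p: "\<And>x z. f (x, 1, z) = f (x, 0, z)"
  shows "(\<integral>v. h (snd (snd v)) * fy v \<partial>cube_measure) = 0"
proof -
  let ?V = "unit_measure \<Otimes>\<^sub>M unit_measure"
  have sec: "continuous_on UNIV (\<lambda>t. fy (x, t, z))" "continuous_on UNIV (\<lambda>w. fy (x, w))" for x z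
    by (rule continuous_on_compose2[OF c(1)], intro continuous_intros, simp)+
  have ch: "continuous_on UNIV (\<lambda>v. h (snd (snd v)) :: real)" "continuous_on UNIV (\<lambda>v. h (snd v) :: real)"
    by (rule continuous_on_compose2[OF c(2)], intro continuous_intros, simp)+
  have "integrable cube_measure (\<lambda>v. h (snd (snd v)) * fy v)"
    by (intro continuous_cube(3) continuous_intros ch c(1))
  then have "(\<integral>v. h (snd (snd v)) * fy v \<partial>cube_measure)
      = (\<integral>x. (\<integral>w. h (snd w) * fy (x, w) \<partial>?V) \<partial>unit_measure)"
    using UM3.integral_fst'[of "\<lambda>v. h (snd (snd v)) * fy v"] by (simp add: cube_measure_def)
  also have "\<dots> = (\<integral>x. 0 \<partial>unit_measure)"
  proof (rule Bochner_Integration.integral_cong[OF refl])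
    fix x
    have "integrable ?V (\<lambda>w. h (snd w) * fy (x, w))"
      by (intro continuous_square continuous_intros ch sec)
    then have "(\<integral>w. h (snd w) * fy (x, w) \<partial>?V)
        = (\<integral>z. (\<integral>y. h z * fy (x, y, z) \<partial>unit_measure) \<partial>unit_measure)"
      using UM2.integral_snd[of "\<lambda>y z. h z * fy (x, y, z)"] by (simp add: split_def)
    also have "\<dots> = 0" using integral_unit_deriv[OF d sec(1)] p by simp
    finally show "(\<integral>w. h (snd w) * fy (x, w) \<partial>?V) = 0" .
  qed
  finally show ?thesis by simp
qed

text \<open>\<open>h\<close> exceeds half of its value at \<open>v\<close> on a product
  neighbourhood, which meets the cube in a set of positive measure. This is how the norm of a
  nonzero form is seen to be positive.\<close>

lemma integral_cube_pos:
  fixes h :: "real \<times> real \<times> real \<Rightarrow> real"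
  assumes c: "continuous_on UNIV h" and nn: "\<And>v. 0 \<le> h v"
    and v: "v \<in> {0..1} \<times> {0..1} \<times> {0..1}" "0 < h v"
  shows "0 < (\<integral>v. h v \<partial>cube_measure)"
proof -
  obtain x y z where xyz: "v = (x, y, z)" "x \<in> {0..1}" "y \<in> {0..1}" "z \<in> {0..1}" using v(1) by auto
  have "open {w. h v / 2 < h w}" by (intro open_Collect_less continuous_intros c)
  moreover have "v \<in> {w. h v / 2 < h w}" using v(2) by simp
  ultimately obtain A B where AB: "open A" "open B" "x \<in> A" "(y, z) \<in> B" "A \<times> B \<subseteq> {w. h v / 2 < h w}"
    unfolding xyz by (rule open_prod_elim) auto
  from AB(2,4) obtain C D where CD: "open C" "open D" "y \<in> C" "z \<in> D" "C \<times> D \<subseteq> B"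
    by (rule open_prod_elim) auto
  \<comment> \<open>The point may be an endpoint of the unit interval, so the ball around it is
    clipped to [0, 1]; what remains still has positive length.\<close>
  have pos: "0 < measure unit_measure (S \<inter> {0..1})" if S: "open S" "s \<in> S" "s \<in> {0..1}" for S :: "real set" and s
  proof -
    obtain e where e: "0 < e" "cball s e \<subseteq> S" using S open_contains_cball by metis
    let ?I = "{max 0 (s - e)..min 1 (s + e)}"
    have sub: "?I \<subseteq> S \<inter> {0..1}" using e by (auto simp: cball_def dist_real_def abs_le_iff)
    have "0 < measure lborel ?I" using e S(3) by (auto simp: max_def min_def)
    also have "\<dots> = measure unit_measure ?I"
      unfolding unit_measure_def by (subst measure_restrict_space) auto
    also have "\<dots> \<le> measure unit_measure (S \<inter> {0..1})"
      by (rule UM.finite_measure_mono[OF sub]) (use S in \<open>auto simp: unit_measure_def sets_restrict_space\<close>)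
    finally show ?thesis .
  qed
  define E where "E = (A \<inter> {0..1}) \<times> (C \<inter> {0..1}) \<times> (D \<inter> {0..1})"
  have s: "S \<inter> {0..1} \<in> sets unit_measure" if "open S" for S
    using that by (auto simp: unit_measure_def sets_restrict_space)
  have Em: "E \<in> sets cube_measure" unfolding E_def cube_measure_def
    by (intro pair_measureI s AB CD)
  have "measure cube_measure E = measure unit_measure (A \<inter> {0..1}) * (measure unit_measure (C \<inter> {0..1}) * measure unit_measure (D \<inter> {0..1}))"
    unfolding E_def cube_measure_def
    by (simp add: measure_def UM.emeasure_pair_measure_Times UM2.P.emeasure_pair_measure_Times s AB CD
        pair_measureI enn2real_mult)
  then have "0 < measure cube_measure E" using pos AB CD xyz by simp
  then have "0 < h v / 2 * measure cube_measure E" using v(2) by simp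
  also have "\<dots> = (\<integral>w. h v / 2 * indicator E w \<partial>cube_measure)" using Em by simp
  also have "\<dots> \<le> (\<integral>w. h w \<partial>cube_measure)"
  proof (rule integral_mono[OF _ continuous_cube(3)[OF c]])
    show "integrable cube_measure (\<lambda>w. h v / 2 * indicator E w)" using Em by (simp add: CM.emeasure_eq_measure)
    show "h v / 2 * indicator E w \<le> h w" for w
    proof (cases "w \<in> E")
      case True
      then have "w \<in> A \<times> B" using CD(5) unfolding E_def by auto
      then have "h v / 2 < h w" using AB(5) by blast
      then show ?thesis using True by simp
    qed (use nn in simp)
  qed
  finally show ?thesis .
qed

section \<open>The metric and its volume measure\<close>

definition torus_borel :: "coord measure" where
  "torus_borel = sigma torus_set {U. openin torus_top U}"

lemma openin_torus_subset: "openin torus_top U \<Longrightarrow> U \<subseteq> torus_set"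
  using openin_subset[of torus_top U] by simp

lemma space_torus_borel [simp]: "space torus_borel = torus_set"
  unfolding torus_borel_def by (rule space_measure_of) (auto dest: openin_torus_subset)

lemma sets_torus_borel: "sets torus_borel = sigma_sets torus_set {U. openin torus_top U}"
  unfolding torus_borel_def by (rule sets_measure_of) (auto dest: openin_torus_subset)

lemma openin_torus_borel: "openin torus_top U \<Longrightarrow> U \<in> sets torus_borel"
  unfolding sets_torus_borel by (rule sigma_sets.Basic) simp

abbreviation proj_torus :: "real \<times> real \<times> real \<Rightarrow> coord" where
  "proj_torus v \<equiv> wrap (vec3 v)"

lemma measurable_proj_torus [measurable]: "proj_torus \<in> borel \<rightarrow>\<^sub>M torus_borel"
  unfolding torus_borel_def
proof (rule measurable_measure_of)
  show "{U. openin torus_top U} \<subseteq> Pow torus_set" by (auto dest: openin_torus_subset)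
  show "proj_torus \<in> space borel \<rightarrow> torus_set" by simp
  fix U assume "U \<in> {U. openin torus_top U}"
  then have "open {v. proj_torus v \<in> U}"
    using openin_continuous_map_preimage[OF continuous_map_vec3_wrap] by auto
  then show "proj_torus -` U \<inter> space borel \<in> sets borel" by (simp add: vimage_def)
qed

section \<open>Measurable coordinates and integrals of periodic functions\<close>

lemma frac_arg_cis: "frac (Im (Ln (cis (2 * pi * t))) / (2 * pi)) = frac t"
proof -
  have "cis (Arg (cis (2 * pi * t))) = cis (2 * pi * t)" by (simp add: cis_Arg sgn_eq)
  then have "cis (2 * pi * (Im (Ln (cis (2 * pi * t))) / (2 * pi))) = cis (2 * pi * t)"
    by (simp add: Arg_eq_Im_Ln)
  then show ?thesis unfolding cis_2pi_eq_iff .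
qed

text \<open>The coordinate jumps where opposite faces are glued. It is Borel all the same, as the
  fractional part of the argument, divided by 2 pi, of the continuous circle coordinate.\<close>

lemma measurable_torus_coord:
  assumes "i < 3"
  shows "(\<lambda>p. p i) \<in> borel_measurable torus_borel"
proof -
  have c: "(\<lambda>p. cis (2 * pi * p i)) \<in> torus_borel \<rightarrow>\<^sub>M borel"
  proof (rule borel_measurableI)
    fix S :: "complex set" assume "open S"
    then have "openin torus_top {p \<in> torus_set. cis (2 * pi * p i) \<in> S}"
      using openin_continuous_map_preimage[OF continuous_map_torus_cis[OF assms], of S] by simp
    then have "{p \<in> torus_set. cis (2 * pi * p i) \<in> S} \<in> sets torus_borel" by (rule openin_torus_borel)
    moreover have "(\<lambda>p. cis (2 * pi * p i)) -` S \<inter> space torus_borel = {p \<in> torus_set. cis (2 * pi * p i) \<in> S}" by auto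
    ultimately show "(\<lambda>p. cis (2 * pi * p i)) -` S \<inter> space torus_borel \<in> sets torus_borel" by simp
  qed
  have "(\<lambda>z. Im z / (2 * pi)) \<in> borel_measurable borel"
    by (intro borel_measurable_continuous_onI continuous_intros) simp
  moreover have "(frac :: real \<Rightarrow> real) \<in> borel_measurable borel"
    using borel_measurable_diff[OF measurable_ident_sets[OF refl] borel_measurable_real_floor]
    by (simp add: frac_def[abs_def])
  ultimately have "(\<lambda>p. frac (Im (Ln (cis (2 * pi * p i))) / (2 * pi))) \<in> borel_measurable torus_borel"
    by (intro measurable_compose[OF measurable_compose[OF measurable_compose[OF c Ln_measurable]]])
  then show ?thesis
    by (rule measurable_cong[THEN iffD1, rotated]) (use assms in \<open>simp only: frac_arg_cis torus_set_frac space_torus_borel\<close>)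
qed

text \<open>The integer part of \<open>a\<close> is shifted away, leaving b in [0, 1). The interval
  (b, b + 1) is then split at 1, and the part beyond 1 is moved back by 1 to (0, b). Single points
  are null sets.\<close>

lemma nn_integral_periodic_unit:
  fixes \<phi> :: "real \<Rightarrow> ennreal"
  assumes [measurable]: "\<phi> \<in> borel_measurable borel" and per: "\<And>x y. frac x = frac y \<Longrightarrow> \<phi> x = \<phi> y"
  shows "(\<integral>\<^sup>+x. \<phi> x \<partial>unit_measure) = (\<integral>\<^sup>+x. indicator {a<..<a+1} x * \<phi> x \<partial>lborel)"
proof -
  define b where "b = frac a"
  have b: "0 \<le> b" "b < 1" unfolding b_def by (simp_all add: frac_lt_1)
  have "(\<integral>\<^sup>+x. indicator {a<..<a+1} x * \<phi> x \<partial>lborel)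
      = (\<integral>\<^sup>+x. indicator {a<..<a+1} (\<lfloor>a\<rfloor> + 1 * x) * \<phi> (\<lfloor>a\<rfloor> + 1 * x) \<partial>lborel)"
    by (subst nn_integral_real_affine[where c = 1 and t = "\<lfloor>a\<rfloor>"]) simp_all
  also have "\<dots> = (\<integral>\<^sup>+x. indicator {b<..<b+1} x * \<phi> x \<partial>lborel)"
  proof (rule nn_integral_cong)
    fix x :: real
    have "\<phi> (\<lfloor>a\<rfloor> + 1 * x) = \<phi> x" by (rule per) simp
    then show "indicator {a<..<a+1} (\<lfloor>a\<rfloor> + 1 * x) * \<phi> (\<lfloor>a\<rfloor> + 1 * x) = indicator {b<..<b+1} x * \<phi> x"
      by (auto simp: indicator_def b_def frac_def)
  qed
  also have "\<dots> = (\<integral>\<^sup>+x. indicator {b<..1} x * \<phi> x + indicator {1<..<b+1} x * \<phi> x \<partial>lborel)"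
  proof (rule nn_integral_cong_AE)
    have "AE x in lborel. x \<noteq> 1" by (rule AE_lborel_singleton)
    then show "AE x in lborel. indicator {b<..<b+1} x * \<phi> x = indicator {b<..1} x * \<phi> x + indicator {1<..<b+1} x * \<phi> x"
      by eventually_elim (use b in \<open>auto simp: indicator_def\<close>)
  qed
  also have "\<dots> = (\<integral>\<^sup>+x. indicator {b<..1} x * \<phi> x \<partial>lborel) + (\<integral>\<^sup>+x. indicator {1<..<b+1} x * \<phi> x \<partial>lborel)"
    by (rule nn_integral_add; measurable)
  also have "(\<integral>\<^sup>+x. indicator {1<..<b+1} x * \<phi> x \<partial>lborel) = (\<integral>\<^sup>+x. indicator {1<..<b+1} (1 + 1 * x) * \<phi> (1 + 1 * x) \<partial>lborel)"
    by (subst nn_integral_real_affine[where c = 1 and t = "1"]) simp_all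
  also have "\<dots> = (\<integral>\<^sup>+x. indicator {0<..<b} x * \<phi> x \<partial>lborel)"
  proof (rule nn_integral_cong)
    fix x :: real
    have "\<phi> (1 + 1 * x) = \<phi> x" by (rule per) (simp add: frac_eq_iff_Ints)
    then show "indicator {1<..<b+1} (1 + 1 * x) * \<phi> (1 + 1 * x) = indicator {0<..<b} x * \<phi> x"
      by (auto simp: indicator_def)
  qed
  also have "(\<integral>\<^sup>+x. indicator {b<..1} x * \<phi> x \<partial>lborel) + (\<integral>\<^sup>+x. indicator {0<..<b} x * \<phi> x \<partial>lborel)
      = (\<integral>\<^sup>+x. indicator {b<..1} x * \<phi> x + indicator {0<..<b} x * \<phi> x \<partial>lborel)"
    by (rule nn_integral_add[symmetric]; measurable)
  also have "\<dots> = (\<integral>\<^sup>+x. \<phi> x * indicator {0..1} x \<partial>lborel)"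
  proof (rule nn_integral_cong_AE)
    have "AE x in lborel. x \<noteq> 0" "AE x in lborel. x \<noteq> b" by (rule AE_lborel_singleton)+
    then show "AE x in lborel. indicator {b<..1} x * \<phi> x + indicator {0<..<b} x * \<phi> x = \<phi> x * indicator {0..1} x"
      by eventually_elim (use b in \<open>auto simp: indicator_def\<close>)
  qed
  also have "\<dots> = (\<integral>\<^sup>+x. \<phi> x \<partial>unit_measure)"
    unfolding unit_measure_def by (subst nn_integral_restrict_space) auto
  finally show ?thesis by simp
qed

lemma sigma_finite_lborel_pair: "sigma_finite_measure (lborel \<Otimes>\<^sub>M lborel :: (real \<times> real) measure)"
  unfolding lborel_prod by (rule sigma_finite_lborel)

text \<open>Fubini, with the one-dimensional statement applied from the innermost variable outwards;
  each inner integral is again periodic in the next variable.\<close>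

lemma nn_integral_periodic_cube:
  fixes F :: "real \<times> real \<times> real \<Rightarrow> ennreal"
  assumes [measurable]: "F \<in> borel_measurable borel"
    and per: "\<And>x y z x' y' z'. frac x = frac x' \<Longrightarrow> frac y = frac y' \<Longrightarrow> frac z = frac z' \<Longrightarrow> F (x, y, z) = F (x', y', z')"
  shows "(\<integral>\<^sup>+v. F v \<partial>cube_measure)
    = (\<integral>\<^sup>+v. indicator ({a<..<a+1} \<times> {b<..<b+1} \<times> {c<..<c+1}) v * F v \<partial>(lborel \<Otimes>\<^sub>M (lborel \<Otimes>\<^sub>M lborel)))"
proof -
  let ?L = "lborel \<Otimes>\<^sub>M (lborel \<Otimes>\<^sub>M lborel) :: (real \<times> real \<times> real) measure"
  let ?U = unit_measure
  let ?A = "\<lambda>x. indicator {a<..<a+1} x :: ennreal"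
  let ?B = "\<lambda>y. indicator {b<..<b+1} y :: ennreal"
  let ?C = "\<lambda>z. indicator {c<..<c+1} z :: ennreal"
  let ?box = "{a<..<a+1} \<times> {b<..<b+1} \<times> {c<..<c+1}"
  have F1: "(\<lambda>(x, y, z). F (x, y, z)) \<in> borel_measurable (?U \<Otimes>\<^sub>M (?U \<Otimes>\<^sub>M ?U))"
    using measurable_compose[OF measurable_cube_measure assms(1)] unfolding cube_measure_def by (simp add: split_def)
  have F2: "(\<lambda>(y, z). F (x, y, z)) \<in> borel_measurable (?U \<Otimes>\<^sub>M ?U)" for x
  proof -
    have "(\<lambda>w. F (x, w)) \<in> borel_measurable borel" by measurable
    from measurable_compose[OF measurable_unit_pair this] show ?thesis by (simp add: split_def)
  qed
  have mz: "(\<lambda>z. F (x, y, z)) \<in> borel_measurable borel" for x y by measurable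
  have "(\<integral>\<^sup>+v. F v \<partial>cube_measure) = (\<integral>\<^sup>+x. \<integral>\<^sup>+y. \<integral>\<^sup>+z. F (x, y, z) \<partial>?U \<partial>?U \<partial>?U)"
  proof -
    have "(\<integral>\<^sup>+v. F v \<partial>cube_measure) = (\<integral>\<^sup>+x. \<integral>\<^sup>+w. F (x, w) \<partial>(?U \<Otimes>\<^sub>M ?U) \<partial>?U)"
      unfolding cube_measure_def by (rule UM2.P.nn_integral_fst[symmetric]) (use F1 in \<open>simp add: split_def\<close>)
    moreover have "(\<integral>\<^sup>+w. F (x, w) \<partial>(?U \<Otimes>\<^sub>M ?U)) = (\<integral>\<^sup>+y. \<integral>\<^sup>+z. F (x, y, z) \<partial>?U \<partial>?U)" for x
      by (rule UM.nn_integral_fst[symmetric]) (use F2[of x] in \<open>simp add: split_def\<close>)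
    ultimately show ?thesis by simp
  qed
  also have "\<dots> = (\<integral>\<^sup>+x. \<integral>\<^sup>+y. \<integral>\<^sup>+z. ?C z * F (x, y, z) \<partial>lborel \<partial>?U \<partial>?U)"
    by (intro nn_integral_cong nn_integral_periodic_unit mz per) auto
  also have "\<dots> = (\<integral>\<^sup>+x. \<integral>\<^sup>+y. ?B y * (\<integral>\<^sup>+z. ?C z * F (x, y, z) \<partial>lborel) \<partial>lborel \<partial>?U)"
  proof (rule nn_integral_cong, rule nn_integral_periodic_unit)
    show "(\<lambda>y. \<integral>\<^sup>+z. ?C z * F (x, y, z) \<partial>lborel) \<in> borel_measurable borel" for x by measurable
    show "(\<integral>\<^sup>+z. ?C z * F (x, y, z) \<partial>lborel) = (\<integral>\<^sup>+z. ?C z * F (x, y', z) \<partial>lborel)"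
      if "frac y = frac y'" for x y y' using per[OF refl that refl] by simp
  qed
  also have "\<dots> = (\<integral>\<^sup>+x. ?A x * (\<integral>\<^sup>+y. ?B y * (\<integral>\<^sup>+z. ?C z * F (x, y, z) \<partial>lborel) \<partial>lborel) \<partial>lborel)"
  proof (rule nn_integral_periodic_unit)
    show "(\<lambda>x. \<integral>\<^sup>+y. ?B y * (\<integral>\<^sup>+z. ?C z * F (x, y, z) \<partial>lborel) \<partial>lborel) \<in> borel_measurable borel"
      by measurable
    show "(\<integral>\<^sup>+y. ?B y * (\<integral>\<^sup>+z. ?C z * F (x, y, z) \<partial>lborel) \<partial>lborel)
        = (\<integral>\<^sup>+y. ?B y * (\<integral>\<^sup>+z. ?C z * F (x', y, z) \<partial>lborel) \<partial>lborel)"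
      if "frac x = frac x'" for x x' using per[OF that refl refl] by simp
  qed
  also have "\<dots> = (\<integral>\<^sup>+x. \<integral>\<^sup>+y. \<integral>\<^sup>+z. indicator ?box (x, y, z) * F (x, y, z) \<partial>lborel \<partial>lborel \<partial>lborel)"
    by (simp add: indicator_times nn_integral_cmult[symmetric] mult.assoc)
  also have "\<dots> = (\<integral>\<^sup>+x. \<integral>\<^sup>+w. indicator ?box (x, w) * F (x, w) \<partial>(lborel \<Otimes>\<^sub>M lborel) \<partial>lborel)"
    by (intro nn_integral_cong lborel.nn_integral_fst) (measurable, simp add: borel_prod)
  also have "\<dots> = (\<integral>\<^sup>+v. indicator ?box v * F v \<partial>?L)"
  proof (rule sigma_finite_measure.nn_integral_fst)
    show "sigma_finite_measure (lborel \<Otimes>\<^sub>M lborel :: (real \<times> real) measure)"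
      by (rule sigma_finite_lborel_pair)
    show "(\<lambda>v. indicator ?box v * F v) \<in> borel_measurable ?L"
      unfolding lborel_prod by (intro borel_measurable_times_ennreal borel_measurable_indicator) (auto simp: borel_open open_Times)
  qed
  finally show ?thesis .
qed

lemma measurable_vec3 [measurable]: "vec3 \<in> borel \<rightarrow>\<^sub>M lebesgue_n 3"
proof (rule measurable_PiM_single')
  fix i :: nat assume "i \<in> {..<3}"
  then consider "i = 0" | "i = Suc 0" | "i = 2" by fastforce
  then show "(\<lambda>v. vec3 v i) \<in> borel \<rightarrow>\<^sub>M lborel"
    unfolding measurable_lborel2
    by cases (simp_all, (intro borel_measurable_continuous_onI continuous_intros)+)
qed (auto simp: PiE_iff)

text \<open>The volume of a manifold is defined by integrals over extensional functions on the index
  set, while the computations run over triples. A product measure is determined by its values on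
  boxes, and those agree.\<close>

lemma lebesgue_3_eq_distr: "lebesgue_n 3 = distr (lborel \<Otimes>\<^sub>M (lborel \<Otimes>\<^sub>M lborel)) (lebesgue_n 3) vec3"
proof -
  let ?L = "lborel \<Otimes>\<^sub>M (lborel \<Otimes>\<^sub>M lborel) :: (real \<times> real \<times> real) measure"
  interpret product_sigma_finite "\<lambda>_::nat. lborel :: real measure" ..
  have "distr ?L (lebesgue_n 3) vec3 = lebesgue_n 3"
  proof (rule PiM_eqI)
    fix A :: "nat \<Rightarrow> real set" assume A: "\<And>i. i \<in> {..<3} \<Longrightarrow> A i \<in> sets lborel"
    have m: "vec3 \<in> ?L \<rightarrow>\<^sub>M lebesgue_n 3"
      by (simp add: lborel_prod)
    have v: "vec3 -` (PiE {..<3} A) \<inter> space ?L = A 0 \<times> A 1 \<times> A 2"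
    proof (rule Set.set_eqI)
      fix v :: "real \<times> real \<times> real"
      have "vec3 v \<in> PiE {..<3} A \<longleftrightarrow> (\<forall>i<3. vec3 v i \<in> A i)" by (simp add: PiE_iff Ball_def)
      then show "v \<in> vec3 -` (PiE {..<3} A) \<inter> space ?L \<longleftrightarrow> v \<in> A 0 \<times> A 1 \<times> A 2"
        unfolding all_less_3 by (simp add: space_pair_measure mem_Times_iff)
    qed
    have "emeasure (distr ?L (lebesgue_n 3) vec3) (PiE {..<3} A)
        = emeasure ?L (A 0 \<times> A 1 \<times> A 2)"
      using A by (subst emeasure_distr[OF m]) (simp_all add: sets_PiM_I_finite v)
    also have "\<dots> = emeasure lborel (A 0) * (emeasure lborel (A 1) * emeasure lborel (A 2))"
      using A by (simp add: sigma_finite_measure.emeasure_pair_measure_Times[OF sigma_finite_lborel_pair]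
          lborel.emeasure_pair_measure_Times)
    also have "\<dots> = (\<Prod>i<3. emeasure lborel (A i))" by (simp add: eval_nat_numeral mult.assoc)
    finally show "emeasure (distr ?L (lebesgue_n 3) vec3) (PiE {..<3} A) = (\<Prod>i<3. emeasure lborel (A i))" .
  qed simp_all
  then show ?thesis by simp
qed

text \<open>The uniqueness half of gluing a measure from charts: one set of the cover at a time is
  split off from \<open>B\<close>, so that the pieces are disjoint and their measures add
  up.\<close>

lemma measure_eq_on_finite_cover:
  assumes "finite I" "sets \<mu> = sets \<nu>" "\<And>i. i \<in> I \<Longrightarrow> D i \<in> sets \<mu>"
    and eq: "\<And>i B. i \<in> I \<Longrightarrow> B \<in> sets \<mu> \<Longrightarrow> B \<subseteq> D i \<Longrightarrow> emeasure \<mu> B = emeasure \<nu> B"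
  shows "B \<in> sets \<mu> \<Longrightarrow> B \<subseteq> (\<Union>i\<in>I. D i) \<Longrightarrow> emeasure \<mu> B = emeasure \<nu> B"
  using assms
proof (induction I arbitrary: B rule: finite_induct)
  case (insert i I)
  have D: "D i \<in> sets \<mu>" using insert.prems by simp
  have B1: "B \<inter> D i \<in> sets \<mu>" and B2: "B - D i \<in> sets \<mu>" using D insert.prems by auto
  have U: "(B \<inter> D i) \<union> (B - D i) = B" "(B \<inter> D i) \<inter> (B - D i) = {}" by auto
  have "emeasure \<mu> (B - D i) = emeasure \<nu> (B - D i)"
  proof (rule insert.IH[OF B2 _ insert.prems(3)])
    show "B - D i \<subseteq> \<Union> (D ` I)" using insert.prems(2) by auto
    show "D j \<in> sets \<mu>" if "j \<in> I" for j using insert.prems(4) that by blast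
    show "emeasure \<mu> C = emeasure \<nu> C" if "j \<in> I" "C \<in> sets \<mu>" "C \<subseteq> D j" for j C
      by (rule insert.prems(5)[OF insertI2[OF that(1)] that(2,3)])
  qed
  moreover have "emeasure \<mu> (B \<inter> D i) = emeasure \<nu> (B \<inter> D i)"
    by (rule insert.prems(5)[OF insertI1 B1]) auto
  ultimately show ?case
    using plus_emeasure[OF B1 B2 U(2)] plus_emeasure[OF B1[unfolded insert.prems(3)] B2[unfolded insert.prems(3)] U(2)]
    unfolding U(1) by simp
qed simp

section \<open>The family of metrics and its volume measure\<close>

definition log_scale :: "real \<Rightarrow> nat \<Rightarrow> real \<Rightarrow> real" where
  "log_scale e i z = (if i = 0 then e * sin (2 * pi * z) / (2 * pi)
     else if i = 1 then e * cos (2 * pi * z) / (2 * pi) else 0)"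

text \<open>The components are given by the same formula in every chart; this is a tensor because
  the formula is 1-periodic in z and the Jacobians are identities.\<close>

definition torus_manifold :: "real \<Rightarrow> coord riemannian" where
  "torus_manifold e = \<lparr>mdim = 3, mtop = torus_top, atlas = torus_atlas,
     metric = (\<lambda>c x i j. if i = j then exp (2 * log_scale e i (x 2)) else 0)\<rparr>"

lemma torus_manifold_simps [simp]:
  "mdim (torus_manifold e) = 3" "mtop (torus_manifold e) = torus_top" "atlas (torus_manifold e) = torus_atlas"
  "metric (torus_manifold e) c x i j = (if i = j then exp (2 * log_scale e i (x 2)) else 0)"
  by (simp_all add: torus_manifold_def)

lemma log_scale_simps [simp]: "log_scale e 2 z = 0"
  by (simp add: log_scale_def)

lemma log_scale_periodic: "frac y = frac z \<Longrightarrow> log_scale e i y = log_scale e i z"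
  using cis_2pi_cong[of y z] by (simp add: log_scale_def complex_eq_iff)

lemma continuous_log_scale [continuous_intros]:
  fixes f :: "'a::t2_space \<Rightarrow> real"
  shows
  "continuous_on S f \<Longrightarrow> continuous_on S (\<lambda>x. log_scale e i (f x))"
proof -
  assume f: "continuous_on S f"
  have "continuous_on S (\<lambda>x. e * sin (2 * pi * f x) / (2 * pi))"
    by (intro continuous_on_divide continuous_on_mult continuous_on_const continuous_on_sin continuous_on_cos f) simp
  moreover have "continuous_on S (\<lambda>x. e * cos (2 * pi * f x) / (2 * pi))"
    by (intro continuous_on_divide continuous_on_mult continuous_on_const continuous_on_sin continuous_on_cos f) simp
  ultimately show ?thesis unfolding log_scale_def by (cases "i = 0"; cases "i = 1") simp_all
qed

definition vol_density :: "real \<Rightarrow> real \<Rightarrow> real" where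
  "vol_density e z = exp (log_scale e 0 z + log_scale e 1 z)"

lemma continuous_vol_density [continuous_intros]:
  fixes f :: "'a::t2_space \<Rightarrow> real"
  shows
  "continuous_on S f \<Longrightarrow> continuous_on S (\<lambda>x. vol_density e (f x))"
  unfolding vol_density_def by (intro continuous_intros)

lemma measurable_vol_density: "(\<lambda>v. ennreal (vol_density e (snd (snd v)))) \<in> borel_measurable (borel :: (real \<times> real \<times> real) measure)"
  by (intro measurable_compose[OF _ measurable_ennreal] borel_measurable_continuous_onI continuous_intros)

lemma sqrt_det_torus: "sqrt (Determinant.det (metric_matrix (torus_manifold e) c x)) = vol_density e (x 2)"
proof -
  let ?A = "metric_matrix (torus_manifold e) c x"
  have "Determinant.det ?A = prod_list (diag_mat ?A)"
    by (rule det_upper_triangular) (auto simp: metric_matrix_def)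
  also have "\<dots> = exp (2 * log_scale e 0 (x 2)) * exp (2 * log_scale e 1 (x 2))"
    by (simp add: diag_mat_def metric_matrix_def eval_nat_numeral log_scale_def)
  also have "\<dots> = (vol_density e (x 2))\<^sup>2"
    by (simp add: vol_density_def exp_add power_mult_distrib exp_double)
  finally show ?thesis by (simp add: vol_density_def)
qed

text \<open>An explicit candidate for the definite description: the measure with this density on the
  unit cube, pushed forward along the covering map.\<close>

definition torus_volume :: "real \<Rightarrow> coord measure" where
  "torus_volume e = distr (density cube_measure (\<lambda>v. ennreal (vol_density e (snd (snd v))))) torus_borel proj_torus"

lemma measurable_proj_cube: "proj_torus \<in> cube_measure \<rightarrow>\<^sub>M torus_borel"
  by (rule measurable_compose[OF measurable_cube_measure measurable_proj_torus])

lemma measurable_density_cube: "(\<lambda>v. ennreal (vol_density e (snd (snd v)))) \<in> borel_measurable cube_measure"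
  by (rule measurable_compose[OF measurable_cube_measure measurable_vol_density])

text \<open>A set inside one chart domain lifts to the open cube of that chart, where the covering
  map inverts the chart. Periodicity lets this cube replace the standard one in the
  integral.\<close>

lemma torus_volume_chart:
  assumes B: "B \<in> sets torus_borel" and sub: "B \<subseteq> fst (torus_chart a)"
  shows "emeasure (torus_volume e) B =
    (\<integral>\<^sup>+x\<in>snd (torus_chart a) ` B. ennreal (vol_density e (x 2)) \<partial>lebesgue_n 3)"
proof -
  let ?S = "snd (torus_chart a) ` B"
  let ?F = "\<lambda>v. ennreal (vol_density e (snd (snd v))) * indicator B (proj_torus v)"
  let ?box = "{a 0<..<a 0+1} \<times> {a 1<..<a 1+1} \<times> {a 2<..<a 2+1}"
  let ?L = "lborel \<Otimes>\<^sub>M (lborel \<Otimes>\<^sub>M lborel) :: (real \<times> real \<times> real) measure"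
  have mB: "(\<lambda>v. indicator B (proj_torus v) :: ennreal) \<in> borel_measurable borel"
    by (rule measurable_compose[OF measurable_proj_torus borel_measurable_indicator[OF B]])
  have mF: "?F \<in> borel_measurable borel"
    by (intro borel_measurable_times_ennreal measurable_vol_density mB)
  have wrap_cong: "wrap x = wrap y" if "\<And>i. i < 3 \<Longrightarrow> frac (x i) = frac (y i)" for x y
    using that by (auto simp: wrap_def)
  have img: "x \<in> ?S \<longleftrightarrow> x \<in> cube a \<and> wrap x \<in> B" for x
  proof
    assume "x \<in> ?S"
    then obtain p where p: "p \<in> B" "x = snd (torus_chart a) p" by blast
    then show "x \<in> cube a \<and> wrap x \<in> B"
      using chart_in_cube[of p a] wrap_chart[of p a] sub by auto
  next
    assume "x \<in> cube a \<and> wrap x \<in> B"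
    then show "x \<in> ?S" using chart_wrap[of x a] by (metis image_eqI)
  qed
  have cube_vec3: "vec3 v \<in> cube a \<longleftrightarrow> v \<in> ?box" for v
    unfolding cube_iff all_less_3 by (simp add: mem_Times_iff)
  have mvec: "vec3 \<in> ?L \<rightarrow>\<^sub>M lebesgue_n 3" by (simp add: lborel_prod measurable_vec3)
  let ?G = "\<lambda>x. ennreal (vol_density e (x 2)) * indicator (?S) x"
  let ?t = "\<lambda>x::coord. (x 0, x 1, x 2)"
  have mt: "?t \<in> lebesgue_n 3 \<rightarrow>\<^sub>M borel"
  proof -
    have "(\<lambda>x::coord. x i) \<in> lebesgue_n 3 \<rightarrow>\<^sub>M borel" if "i < 3" for i
      using measurable_component_singleton[of i "{..<3}" "\<lambda>_. lborel :: real measure"] that by simp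
    then have "?t \<in> lebesgue_n 3 \<rightarrow>\<^sub>M borel \<Otimes>\<^sub>M (borel \<Otimes>\<^sub>M borel)" by (intro measurable_Pair) simp_all
    then show ?thesis by (simp add: borel_prod)
  qed
  \<comment> \<open>A forward image under the chart is not visibly measurable; within the cube it is
    the preimage of \<open>B\<close> under the covering map, whose indicator is.\<close>
  have "(\<lambda>v. indicator ?box v * ?F v) \<in> borel_measurable borel"
    by (intro borel_measurable_times_ennreal mF borel_measurable_indicator) (auto simp: borel_open open_Times)
  from measurable_compose[OF mt this]
  have mG: "?G \<in> borel_measurable (lebesgue_n 3)"
  proof (rule measurable_cong[THEN iffD1, rotated])
    fix x :: coord assume "x \<in> space (lebesgue_n 3)"
    then have x: "vec3 (?t x) = x" by (intro vec3_coords) (simp add: space_PiM PiE_iff)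
    have "indicator (?S) x = (indicator ?box (?t x) * indicator B (wrap x) :: ennreal)"
      using cube_vec3[of "?t x"] img[of x] unfolding x by (simp add: indicator_def)
    then show "indicator ?box (?t x) * ?F (?t x) = ?G x" unfolding x by (simp add: mult_ac)
  qed
  have "emeasure (torus_volume e) B = (\<integral>\<^sup>+v. ?F v \<partial>cube_measure)"
    unfolding torus_volume_def
    using measurable_sets[OF measurable_proj_cube B]
    by (simp add: emeasure_distr measurable_proj_cube B emeasure_density measurable_density_cube)
      (intro nn_integral_cong, simp add: indicator_def)
  also have "\<dots> = (\<integral>\<^sup>+v. indicator ?box v * ?F v \<partial>?L)"
  proof (rule nn_integral_periodic_cube[OF mF])
    fix x y z x' y' z' :: real
    assume f: "frac x = frac x'" "frac y = frac y'" "frac z = frac z'"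
    have "proj_torus (x, y, z) = proj_torus (x', y', z')"
      by (rule wrap_cong) (use f in \<open>auto simp: less_3_iff\<close>)
    then show "?F (x, y, z) = ?F (x', y', z')"
      using log_scale_periodic[OF f(3)] by (simp add: vol_density_def)
  qed
  also have "\<dots> = (\<integral>\<^sup>+v. ?G (vec3 v) \<partial>?L)"
    using cube_vec3 img by (intro nn_integral_cong) (simp add: indicator_def)
  also have "\<dots> = (\<integral>\<^sup>+x. ?G x \<partial>distr ?L (lebesgue_n 3) vec3)"
    by (rule nn_integral_distr[OF mvec, symmetric], unfold measurable_distr_eq1, rule mG)
  also have "\<dots> = (\<integral>\<^sup>+x. ?G x \<partial>lebesgue_n 3)" unfolding lebesgue_3_eq_distr[symmetric] ..
  finally show ?thesis .
qed

lemma volume_measure_torus: "volume_measure (torus_manifold e) = torus_volume e"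
  unfolding volume_measure_def torus_manifold_simps sqrt_det_torus topspace_torus sets_torus_borel[symmetric]
proof (rule the_equality)
  show "sets (torus_volume e) = sets torus_borel \<and> (\<forall>c\<in>torus_atlas. \<forall>B\<in>sets (torus_volume e). B \<subseteq> fst c \<longrightarrow>
      emeasure (torus_volume e) B = (\<integral>\<^sup>+x\<in>snd c ` B. ennreal (vol_density e (x 2)) \<partial>lebesgue_n 3))"
    using torus_volume_chart by (auto simp: torus_atlas_def) (auto simp: torus_volume_def)
next
  fix \<mu> assume \<mu>: "sets \<mu> = sets torus_borel \<and> (\<forall>c\<in>torus_atlas. \<forall>B\<in>sets \<mu>. B \<subseteq> fst c \<longrightarrow>
      emeasure \<mu> B = (\<integral>\<^sup>+x\<in>snd c ` B. ennreal (vol_density e (x 2)) \<partial>lebesgue_n 3))"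
  have st: "sets (torus_volume e) = sets torus_borel" by (simp add: torus_volume_def)
  \<comment> \<open>Compactness gives a finite subcover by chart domains, and on each of them the
    defining property fixes the measure.\<close>
  obtain \<F> where \<F>: "finite \<F>" "\<F> \<subseteq> range (\<lambda>a. fst (torus_chart a))" "torus_set \<subseteq> \<Union>\<F>"
  proof -
    have "topspace torus_top \<subseteq> \<Union> (range (\<lambda>a. fst (torus_chart a)))"
      unfolding topspace_torus using torus_set_covered by blast
    moreover have "\<forall>U\<in>range (\<lambda>a. fst (torus_chart a)). openin torus_top U"
      using openin_torus_chart by blast
    ultimately show ?thesis
      using compact_torus[unfolded compact_space_alt, THEN spec, of "range (\<lambda>a. fst (torus_chart a))"] that
      unfolding topspace_torus by blast
  qed
  show "\<mu> = torus_volume e"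
  proof (rule measure_eqI)
    show "sets \<mu> = sets (torus_volume e)" using \<mu> st by simp
    fix B assume B: "B \<in> sets \<mu>"
    show "emeasure \<mu> B = emeasure (torus_volume e) B"
    proof (rule measure_eq_on_finite_cover[OF \<F>(1), of \<mu> _ "\<lambda>D. D"])
      show "sets \<mu> = sets (torus_volume e)" using \<mu> st by simp
      show "D \<in> sets \<mu>" if "D \<in> \<F>" for D
        using that \<F>(2) openin_torus_chart openin_torus_borel \<mu> by auto
      show "B \<in> sets \<mu>" by fact
      show "B \<subseteq> (\<Union>D\<in>\<F>. D)" using sets.sets_into_space[of B torus_borel] B \<mu> \<F>(3) by auto
      fix D C assume D: "D \<in> \<F>" and C: "C \<in> sets \<mu>" "C \<subseteq> D"
      obtain a where "D = fst (torus_chart a)" using D \<F>(2) by auto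
      then show "emeasure \<mu> C = emeasure (torus_volume e) C"
        using \<mu> C torus_volume_chart[of C a e] unfolding torus_atlas_def by auto
    qed
  qed
qed

text \<open>Here the definite description disappears: an integral over the manifold becomes the
  integral of a periodic function over the unit cube.\<close>

lemma integral_volume_torus:
  fixes F :: "real \<times> real \<times> real \<Rightarrow> real"
  assumes c: "continuous_on UNIV F"
    and per: "\<And>x y z. F (frac x, frac y, frac z) = F (x, y, z)"
    and f: "\<And>p. p \<in> torus_set \<Longrightarrow> f p = F (p 0, p 1, p 2)"
  shows "(LINT p|volume_measure (torus_manifold e). f p) = (\<integral>v. vol_density e (snd (snd v)) * F v \<partial>cube_measure)"
proof -
  have "(\<lambda>p. (p 0, p 1, p 2)) \<in> torus_borel \<rightarrow>\<^sub>M borel \<Otimes>\<^sub>M (borel \<Otimes>\<^sub>M borel)"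
    by (intro measurable_Pair measurable_torus_coord) auto
  then have "(\<lambda>p. (p 0, p 1, p 2)) \<in> torus_borel \<rightarrow>\<^sub>M borel" by (simp add: borel_prod)
  from measurable_compose[OF this borel_measurable_continuous_onI[OF c]]
  have m: "f \<in> borel_measurable torus_borel"
    by (rule measurable_cong[THEN iffD1, rotated]) (simp add: f)
  have fp: "f (proj_torus v) = F v" for v
    using per[of "fst v" "fst (snd v)" "snd (snd v)"] by (simp add: f wrap_apply)
  have "(LINT p|volume_measure (torus_manifold e). f p)
      = (\<integral>v. f (proj_torus v) \<partial>density cube_measure (\<lambda>v. ennreal (vol_density e (snd (snd v)))))"
    unfolding volume_measure_torus torus_volume_def
    by (rule integral_distr[OF _ m]) (simp add: measurable_proj_cube)
  also have "\<dots> = (\<integral>v. vol_density e (snd (snd v)) *\<^sub>R F v \<partial>cube_measure)"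
    unfolding fp
    by (rule integral_density)
      (auto intro!: continuous_cube(1) c continuous_intros simp: vol_density_def)
  finally show ?thesis by simp
qed

section \<open>Levi-Civita connection, Ricci curvature and diameter\<close>

text \<open>The algorithm enters through its specification alone: failure is excluded because the
  matrix is a unit, and any inverse that is returned equals the diagonal one by
  associativity.\<close>

lemma diag_mat_inverse:
  fixes d :: "nat \<Rightarrow> real"
  assumes "\<And>i. i < n \<Longrightarrow> d i \<noteq> 0"
  shows "the (mat_inverse (Matrix.mat n n (\<lambda>(i, j). if i = j then d i else 0)))
    = Matrix.mat n n (\<lambda>(i, j). if i = j then inverse (d i) else 0)"
proof -
  let ?A = "Matrix.mat n n (\<lambda>(i, j). if i = j then d i else 0)"
  let ?B = "Matrix.mat n n (\<lambda>(i, j). if i = j then inverse (d i) else 0)"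
  have A: "?A \<in> carrier_mat n n" and B: "?B \<in> carrier_mat n n" by simp_all
  have s: "(\<Sum>k = 0..<n. (if i = k then a i else 0) * (if k = j then b k else 0)) = (if i = j then a i * b i else 0)"
    if "i < n" for i j and a b :: "nat \<Rightarrow> real"
  proof -
    have "(\<Sum>k = 0..<n. (if i = k then a i else 0) * (if k = j then b k else 0))
        = (\<Sum>k = 0..<n. if i = k then (if i = j then a i * b i else 0) else 0)"
      by (rule sum.cong) auto
    also have "\<dots> = (if i = j then a i * b i else 0)" using that by simp
    finally show ?thesis .
  qed
  have prod: "Matrix.mat n n (\<lambda>(i, j). if i = j then a i else 0) * Matrix.mat n n (\<lambda>(i, j). if i = j then b i else 0) = 1\<^sub>m n"
    if "\<And>i. i < n \<Longrightarrow> a i * b i = 1" for a b :: "nat \<Rightarrow> real"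
  proof (rule eq_matI)
    fix i j assume "i < dim_row (1\<^sub>m n)" "j < dim_col (1\<^sub>m n)"
    then have ij: "i < n" "j < n" by simp_all
    have "(Matrix.mat n n (\<lambda>(i, j). if i = j then a i else 0) * Matrix.mat n n (\<lambda>(i, j). if i = j then b i else 0)) $$ (i, j)
        = (\<Sum>k = 0..<n. (if i = k then a i else 0) * (if k = j then b k else 0))"
      using ij by (simp add: scalar_prod_def)
    then show "(Matrix.mat n n (\<lambda>(i, j). if i = j then a i else 0) * Matrix.mat n n (\<lambda>(i, j). if i = j then b i else 0)) $$ (i, j) = 1\<^sub>m n $$ (i, j)"
      unfolding s[OF ij(1)] using ij that by simp
  qed simp_all
  have AB: "?A * ?B = 1\<^sub>m n" and BA: "?B * ?A = 1\<^sub>m n"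
    by (rule prod, use assms in simp)+
  show ?thesis
  proof (cases "mat_inverse ?A")
    case None
    have "?A \<in> Units (ring_mat TYPE(real) n ())"
      using A B AB BA by (auto simp: Units_def ring_mat_def)
    then show ?thesis using mat_inverse(1)[OF A None, of "()"] by blast
  next
    case (Some C)
    from mat_inverse(2)[OF A Some] have C: "?A * C = 1\<^sub>m n" "C \<in> carrier_mat n n" by auto
    have "C = (?B * ?A) * C" using C BA by simp
    also have "\<dots> = ?B * (?A * C)" by (rule assoc_mult_mat[OF B A C(2)])
    also have "\<dots> = ?B" using C B by simp
    finally show ?thesis using Some by simp
  qed
qed

lemma cometric_torus:
  assumes "i < 3" "j < 3"
  shows "cometric (torus_manifold e) c x i j = (if i = j then exp (- 2 * log_scale e i (x 2)) else 0)"
proof -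
  have "metric_matrix (torus_manifold e) c x = Matrix.mat 3 3 (\<lambda>(i, j). if i = j then exp (2 * log_scale e i (x 2)) else 0)"
    by (simp add: metric_matrix_def)
  then show ?thesis
    using diag_mat_inverse[of 3 "\<lambda>i. exp (2 * log_scale e i (x 2))"] assms
    by (simp add: cometric_def exp_minus)
qed

definition dlog_scale :: "real \<Rightarrow> nat \<Rightarrow> real \<Rightarrow> real" where
  "dlog_scale e i z = (if i = 0 then e * cos (2 * pi * z) else if i = 1 then - e * sin (2 * pi * z) else 0)"

definition ddlog_scale :: "real \<Rightarrow> nat \<Rightarrow> real \<Rightarrow> real" where
  "ddlog_scale e i z = (if i = 0 then - e * (2 * pi) * sin (2 * pi * z)
     else if i = 1 then - e * (2 * pi) * cos (2 * pi * z) else 0)"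

lemma DERIV_log_scale: "(log_scale e i has_real_derivative dlog_scale e i z) (at z)"
proof -
  have "((\<lambda>z. e * sin (2 * pi * z) / (2 * pi)) has_real_derivative e * cos (2 * pi * z)) (at z)"
    "((\<lambda>z. e * cos (2 * pi * z) / (2 * pi)) has_real_derivative - e * sin (2 * pi * z)) (at z)"
    by (auto intro!: derivative_eq_intros)
  then show ?thesis unfolding log_scale_def[abs_def] dlog_scale_def by (cases "i = 0"; cases "i = 1") simp_all
qed

lemma DERIV_dlog_scale: "(dlog_scale e i has_real_derivative ddlog_scale e i z) (at z)"
proof -
  have "((\<lambda>z. e * cos (2 * pi * z)) has_real_derivative - e * (2 * pi) * sin (2 * pi * z)) (at z)"
    "((\<lambda>z. - e * sin (2 * pi * z)) has_real_derivative - e * (2 * pi) * cos (2 * pi * z)) (at z)"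
    by (auto intro!: derivative_eq_intros)
  then show ?thesis unfolding dlog_scale_def[abs_def] ddlog_scale_def by (cases "i = 0"; cases "i = 1") simp_all
qed

lemma dlog_scale_2 [simp]: "dlog_scale e 2 z = 0" "ddlog_scale e 2 z = 0"
  by (simp_all add: dlog_scale_def ddlog_scale_def)

lemma DERIV_exp_log_scale:
  "((\<lambda>z. exp (2 * log_scale e i z)) has_real_derivative 2 * dlog_scale e i z * exp (2 * log_scale e i z)) (at z)"
  by (auto intro!: derivative_eq_intros DERIV_log_scale)

text \<open>With h_i the logarithmic scales and 2 the index of z: Gamma^i_{i2} = Gamma^i_{2i} = h_i'
  and Gamma^2_{ii} = - h_i' exp(2 h_i). The indices i = j = k = 2 fall into the first case, where
  the value is h_2' = 0.\<close>

definition torus_christoffel :: "real \<Rightarrow> real \<Rightarrow> nat \<Rightarrow> nat \<Rightarrow> nat \<Rightarrow> real" where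
  "torus_christoffel e z k i j =
     (if i = k \<and> j = 2 \<or> i = 2 \<and> j = k then dlog_scale e k z
      else if k = 2 \<and> i = j then - dlog_scale e i z * exp (2 * log_scale e i z) else 0)"

lemma pderiv_at_metric:
  "pderiv_at m (\<lambda>y. metric (torus_manifold e) c y i j) x =
     (if i = j \<and> m = 2 then 2 * dlog_scale e i (x 2) * exp (2 * log_scale e i (x 2)) else 0)"
proof (cases "i = j")
  case True
  then show ?thesis
    using pderiv_at_coord(1)[where \<phi> = "\<lambda>z. exp (2 * log_scale e i z)" and x = x and j = 2, OF DERIV_exp_log_scale, of m]
    by simp
qed simp

lemma christoffel_torus:
  assumes "k < 3" "i < 3" "j < 3"
  shows "christoffel (torus_manifold e) c x k i j = torus_christoffel e (x 2) k i j"
proof -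
  let ?g = "\<lambda>i. exp (2 * log_scale e i (x 2))"
  let ?d = "\<lambda>i. dlog_scale e i (x 2)"
  \<comment> \<open>The inverse metric is diagonal, so of the sum over l only l = k
    survives.\<close>
  have "christoffel (torus_manifold e) c x k i j
      = (1/2) * (inverse (?g k) * ((if j = k \<and> i = 2 then 2 * ?d j * ?g j else 0)
          + (if i = k \<and> j = 2 then 2 * ?d i * ?g i else 0) - (if i = j \<and> k = 2 then 2 * ?d i * ?g i else 0)))"
    unfolding christoffel_def pderiv_at_metric torus_manifold_simps(1)
    using assms by (subst sum.remove[of _ k]) (auto simp: cometric_torus exp_minus intro!: sum.neutral)
  also have "\<dots> = torus_christoffel e (x 2) k i j"
    by (auto simp: torus_christoffel_def)
  finally show ?thesis .
qed

definition torus_dchristoffel :: "real \<Rightarrow> real \<Rightarrow> nat \<Rightarrow> nat \<Rightarrow> nat \<Rightarrow> real" where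
  "torus_dchristoffel e z k i j =
     (if i = k \<and> j = 2 \<or> i = 2 \<and> j = k then ddlog_scale e k z
      else if k = 2 \<and> i = j then - (ddlog_scale e i z + 2 * (dlog_scale e i z)\<^sup>2) * exp (2 * log_scale e i z) else 0)"

lemma DERIV_torus_christoffel:
  "((\<lambda>z. torus_christoffel e z k i j) has_real_derivative torus_dchristoffel e z k i j) (at z)"
proof -
  have "((\<lambda>z. - dlog_scale e i z * exp (2 * log_scale e i z)) has_real_derivative
      - (ddlog_scale e i z + 2 * (dlog_scale e i z)\<^sup>2) * exp (2 * log_scale e i z)) (at z)"
    by (auto intro!: derivative_eq_intros DERIV_log_scale DERIV_dlog_scale simp: algebra_simps power2_eq_square)
  then show ?thesis unfolding torus_christoffel_def[abs_def] torus_dchristoffel_def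
    using DERIV_dlog_scale[of e k z] by (auto split: if_split)
qed

lemma pderiv_at_christoffel:
  assumes "k < 3" "i < 3" "j < 3"
  shows "pderiv_at m (\<lambda>y. christoffel (torus_manifold e) c y k i j) x
    = (if m = 2 then torus_dchristoffel e (x 2) k i j else 0)"
  unfolding christoffel_torus[OF assms] by (rule pderiv_at_coord(1)[where \<phi> = "\<lambda>z. torus_christoffel e z k i j", OF DERIV_torus_christoffel])

text \<open>The Ricci tensor of a metric warped along z; with so few nonzero Christoffel symbols all
  nine index pairs are evaluated directly.\<close>

lemma ricci_torus:
  assumes "j < 3" "k < 3"
  shows "ricci (torus_manifold e) c x j k = (if j \<noteq> k then 0
    else if j = 2 then - (ddlog_scale e 0 (x 2) + ddlog_scale e 1 (x 2) + (dlog_scale e 0 (x 2))\<^sup>2 + (dlog_scale e 1 (x 2))\<^sup>2)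
    else - exp (2 * log_scale e j (x 2)) * (ddlog_scale e j (x 2) + dlog_scale e j (x 2) * (dlog_scale e 0 (x 2) + dlog_scale e 1 (x 2))))"
proof -
  have "riemann (torus_manifold e) c x i k i j =
      (if i = 2 then torus_dchristoffel e (x 2) i j k else 0) - (if j = 2 then torus_dchristoffel e (x 2) i i k else 0)
      + (\<Sum>m<3. torus_christoffel e (x 2) i i m * torus_christoffel e (x 2) m j k
            - torus_christoffel e (x 2) i j m * torus_christoffel e (x 2) m i k)" if "i < 3" for i
    unfolding riemann_def pderiv_at_christoffel[OF that assms] pderiv_at_christoffel[OF that that assms(2)]
      torus_manifold_simps(1)
    using assms that by (simp add: christoffel_torus)
  then have "ricci (torus_manifold e) c x j k = (\<Sum>i<3.
      (if i = 2 then torus_dchristoffel e (x 2) i j k else 0) - (if j = 2 then torus_dchristoffel e (x 2) i i k else 0)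
      + (\<Sum>m<3. torus_christoffel e (x 2) i i m * torus_christoffel e (x 2) m j k
            - torus_christoffel e (x 2) i j m * torus_christoffel e (x 2) m i k))"
    unfolding ricci_def by simp
  moreover from assms have "j = 0 \<or> j = 1 \<or> j = 2" "k = 0 \<or> k = 1 \<or> k = 2" by auto
  ultimately show ?thesis
    unfolding sum_less_3
    by (elim disjE) (simp_all add: torus_christoffel_def torus_dchristoffel_def power2_eq_square algebra_simps)
qed

lemma dlog_scale_bound: "0 \<le> e \<Longrightarrow> \<bar>dlog_scale e i z\<bar> \<le> e"
proof -
  assume e: "0 \<le> e"
  have "e * \<bar>cos (2 * pi * z)\<bar> \<le> e * 1" "e * \<bar>sin (2 * pi * z)\<bar> \<le> e * 1"
    by (intro mult_left_mono e abs_cos_le_one abs_sin_le_one)+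
  then show ?thesis using e by (simp add: dlog_scale_def abs_mult)
qed

text \<open>The second derivatives have amplitude 2 pi e, and pi < 4.\<close>

lemma ddlog_scale_bound: "0 \<le> e \<Longrightarrow> \<bar>ddlog_scale e i z\<bar> \<le> 8 * e"
proof -
  assume e: "0 \<le> e"
  have p: "0 \<le> e * (2 * pi)" "e * (2 * pi) \<le> e * 8"
    using e pi_less_4 mult_left_mono[of "2 * pi" 8 e] by simp_all
  have "e * (2 * pi) * \<bar>cos (2 * pi * z)\<bar> \<le> e * 8 * 1"
    by (rule mult_mono[OF p(2) abs_cos_le_one]) (use e in simp_all)
  moreover have "e * (2 * pi) * \<bar>sin (2 * pi * z)\<bar> \<le> e * 8 * 1"
    by (rule mult_mono[OF p(2) abs_sin_le_one]) (use e in simp_all)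
  ultimately have "e * (2 * pi) * \<bar>cos (2 * pi * z)\<bar> \<le> 8 * e" "e * (2 * pi) * \<bar>sin (2 * pi * z)\<bar> \<le> 8 * e"
    by (simp_all only: mult_1_right mult.commute[of e 8])
  then show ?thesis using e by (simp add: ddlog_scale_def abs_mult mult.assoc)
qed

text \<open>Second derivatives contribute at most 8 e each, products of first derivatives at most e
  each because e <= 1. The worst case is the zz-component with 8 e + 8 e + e + e, below 20 e; as n -
  1 = 2, the curvature parameter \<kappa> is 10 e.\<close>

lemma ricci_ge_torus:
  assumes "0 \<le> e" "e \<le> 1"
  shows "ricci_ge (torus_manifold e) (- (real 3 - 1) * (10 * e))"
  unfolding ricci_ge_def
proof (intro ballI allI)
  fix c and x :: coord and v :: "nat \<Rightarrow> real"
  let ?z = "x (2::nat)"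
  have ab: "\<bar>dlog_scale e i ?z * dlog_scale e j ?z\<bar> \<le> e" for i j
  proof -
    have "\<bar>dlog_scale e i ?z\<bar> * \<bar>dlog_scale e j ?z\<bar> \<le> e * 1"
      by (rule mult_mono) (use dlog_scale_bound[of e] assms in \<open>auto intro: order_trans\<close>)
    then show ?thesis by (simp add: abs_mult)
  qed
  have A: "ddlog_scale e i ?z + dlog_scale e i ?z * (dlog_scale e 0 ?z + dlog_scale e 1 ?z) \<le> 20 * e" for i
    using ddlog_scale_bound[OF assms(1), of i ?z] ab[of i 0] ab[of i 1] assms by (simp add: distrib_left)
  have B: "ddlog_scale e 0 ?z + ddlog_scale e 1 ?z + (dlog_scale e 0 ?z)\<^sup>2 + (dlog_scale e 1 ?z)\<^sup>2 \<le> 20 * e"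
    using ddlog_scale_bound[OF assms(1), of 0 ?z] ddlog_scale_bound[OF assms(1), of 1 ?z] ab[of 0 0] ab[of 1 1] assms
    by (simp add: power2_eq_square)
  have C: "ricci (torus_manifold e) c x i i * v i * v i \<ge> - (20 * e) * (exp (2 * log_scale e i ?z) * v i * v i)" if "i < 3" for i
  proof -
    have "- (20 * e) * exp (2 * log_scale e i ?z) \<le> ricci (torus_manifold e) c x i i"
    proof (cases "i = 2")
      case True
      then show ?thesis using B by (simp add: ricci_torus)
    next
      case False
      then show ?thesis using mult_left_mono[OF A[of i], of "exp (2 * log_scale e i ?z)"] that by (simp add: ricci_torus algebra_simps)
    qed
    from mult_right_mono[OF this, of "v i * v i"] show ?thesis by (simp add: mult.assoc)
  qed
  have D: "ricci (torus_manifold e) c x i j = 0" if "i < 3" "j < 3" "i \<noteq> j" for i j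
    using that by (simp add: ricci_torus)
  show "(\<Sum>i<mdim (torus_manifold e). \<Sum>j<mdim (torus_manifold e). ricci (torus_manifold e) c x i j * v i * v j)
      \<ge> - (real 3 - 1) * (10 * e) * (\<Sum>i<mdim (torus_manifold e). \<Sum>j<mdim (torus_manifold e). metric (torus_manifold e) c x i j * v i * v j)"
    unfolding torus_manifold_simps sum_less_3
    using C[of 0] C[of 1] C[of 2] by (simp add: D distrib_left)
qed

section \<open>Tensor fields on the torus and the Riemannian metric\<close>

lemma sum_delta_3: "(j::nat) < 3 \<Longrightarrow> (\<Sum>l<3. (if j = l then 1 else 0) * f l) = (f j :: real)"
  by (auto simp: less_3_iff sum_less_3)

lemma sum_jacobian_torus:
  assumes "x \<in> overlap (torus_chart a) (torus_chart b)" "i < 3"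
  shows "(\<Sum>j<3. jacobian (torus_chart a) (torus_chart b) x j i * f j) = f i"
proof -
  have "(\<Sum>j<3. jacobian (torus_chart a) (torus_chart b) x j i * f j) = (\<Sum>j<3. (if i = j then 1 else 0) * f j)"
    using assms by (intro sum.cong refl) (simp add: jacobian_torus)
  then show ?thesis unfolding sum_delta_3[OF assms(2)] .
qed

text \<open>With identity Jacobians the sum in the transformation law collapses, and components have
  to agree at coordinates of the same point of the torus.\<close>

lemma one_form_torus_iff:
  "one_form 3 torus_atlas \<omega> \<longleftrightarrow>
    (\<forall>a. \<forall>i<3. smooth_fun 3 (cube a) (\<lambda>x. \<omega> (torus_chart a) x i)) \<and>
    (\<forall>a b x. x \<in> cube a \<longrightarrow> (\<forall>i<3. frac (x i) \<noteq> frac (b i)) \<longrightarrow> (\<forall>i<3.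
      \<omega> (torus_chart a) x i = \<omega> (torus_chart b) (\<lambda>i\<in>{..<3}. shift_into (b i) (x i)) i))"
proof -
  have "(\<Sum>j<3. jacobian (torus_chart a) (torus_chart b) x j i * \<omega> (torus_chart b) (transition (torus_chart a) (torus_chart b) x) j)
      = \<omega> (torus_chart b) (\<lambda>i\<in>{..<3}. shift_into (b i) (x i)) i"
    if "x \<in> overlap (torus_chart a) (torus_chart b)" "i < 3" for a b x i
    unfolding sum_jacobian_torus[OF that] using that(1) by (simp add: transition_torus overlap_torus)
  then show ?thesis unfolding one_form_def torus_atlas_def by (auto simp: overlap_torus)
qed

lemma two_tensor_torus_iff:
  "two_tensor 3 torus_atlas T \<longleftrightarrow>
    (\<forall>a. \<forall>i<3. \<forall>j<3. smooth_fun 3 (cube a) (\<lambda>x. T (torus_chart a) x i j)) \<and>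
    (\<forall>a b x. x \<in> cube a \<longrightarrow> (\<forall>i<3. frac (x i) \<noteq> frac (b i)) \<longrightarrow> (\<forall>i<3. \<forall>j<3.
      T (torus_chart a) x i j = T (torus_chart b) (\<lambda>i\<in>{..<3}. shift_into (b i) (x i)) i j))"
proof -
  have "(\<Sum>k<3. \<Sum>l<3. jacobian (torus_chart a) (torus_chart b) x k i * jacobian (torus_chart a) (torus_chart b) x l j
        * T (torus_chart b) (transition (torus_chart a) (torus_chart b) x) k l)
      = T (torus_chart b) (\<lambda>i\<in>{..<3}. shift_into (b i) (x i)) i j"
    if "x \<in> overlap (torus_chart a) (torus_chart b)" "i < 3" "j < 3" for a b x i j
    unfolding mult.assoc sum_distrib_left[symmetric] sum_jacobian_torus[OF that(1,2)] sum_jacobian_torus[OF that(1,3)]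
    using that(1) by (simp add: transition_torus overlap_torus)
  then show ?thesis unfolding two_tensor_def torus_atlas_def by (auto simp: overlap_torus)
qed

text \<open>Smoothness of the coefficients is obtained from the complex derivatives of an entire extension.\<close>

definition entire_scale :: "real \<Rightarrow> nat \<Rightarrow> complex \<Rightarrow> complex" where
  "entire_scale e i z = (if i = 0 then of_real e * sin (2 * of_real pi * z) / (2 * of_real pi)
     else if i = 1 then of_real e * cos (2 * of_real pi * z) / (2 * of_real pi) else 0)"

lemma entire_scale_real: "entire_scale e i (of_real t) = of_real (log_scale e i t)"
  unfolding entire_scale_def log_scale_def
  by (simp flip: sin_of_real cos_of_real)

lemma entire_scale_holomorphic: "entire_scale e i holomorphic_on UNIV"
proof -
  have "(\<lambda>z. of_real e * sin (2 * of_real pi * z) / (2 * of_real pi)) holomorphic_on UNIV"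
    "(\<lambda>z. of_real e * cos (2 * of_real pi * z) / (2 * of_real pi)) holomorphic_on UNIV"
    by (intro holomorphic_intros; simp)+
  then show ?thesis unfolding entire_scale_def[abs_def] by (cases "i = 0"; cases "i = 1") simp_all
qed

lemma smooth_fun_exp_scale: "smooth_fun 3 U (\<lambda>x. exp (2 * log_scale e i (x 2)))"
proof -
  have "smooth_fun 3 U (\<lambda>x. Re ((\<lambda>z. exp (2 * entire_scale e i z)) (of_real (x 2))))"
    by (rule smooth_fun_holomorphic) (intro holomorphic_intros entire_scale_holomorphic, simp)
  moreover have "Re (exp (2 * entire_scale e i (of_real t))) = exp (2 * log_scale e i t)" for t
    unfolding entire_scale_real by (metis Re_complex_of_real exp_of_real of_real_mult of_real_numeral)
  ultimately show ?thesis by simp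
qed

text \<open>The product is half the derivative of exp(2 h_i), so it is the real part of half the
  complex derivative of an entire function. The diagonal entries of the Hessian of z have this
  form.\<close>

lemma smooth_fun_dlog_scale: "smooth_fun 3 U (\<lambda>x. dlog_scale e i (x 2) * exp (2 * log_scale e i (x 2)))"
proof -
  let ?f = "\<lambda>z. deriv (\<lambda>z. exp (2 * entire_scale e i z)) z / 2"
  have h: "(\<lambda>z. exp (2 * entire_scale e i z)) holomorphic_on UNIV"
    by (intro holomorphic_intros entire_scale_holomorphic)
  have "?f holomorphic_on UNIV" by (intro holomorphic_intros holomorphic_deriv h) auto
  then have s: "smooth_fun 3 U (\<lambda>x. Re (?f (of_real (x 2))))"
    by (rule smooth_fun_holomorphic) simp
  have "Re (?f (of_real t)) = dlog_scale e i t * exp (2 * log_scale e i t)" for t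
  proof -
    have "((\<lambda>t. Re (exp (2 * entire_scale e i (of_real t)))) has_real_derivative
        Re (deriv (\<lambda>z. exp (2 * entire_scale e i z)) (of_real t))) (at t)"
      by (intro has_field_derivative_Re has_vector_derivative_real_field holomorphic_derivI[OF h open_UNIV UNIV_I])
    moreover have "(\<lambda>t. Re (exp (2 * entire_scale e i (of_real t)))) = (\<lambda>t. exp (2 * log_scale e i t))"
      unfolding entire_scale_real by (metis Re_complex_of_real exp_of_real of_real_mult of_real_numeral)
    ultimately have "Re (deriv (\<lambda>z. exp (2 * entire_scale e i z)) (of_real t)) = 2 * dlog_scale e i t * exp (2 * log_scale e i t)"
      using DERIV_unique[OF _ DERIV_exp_log_scale] by metis
    then show ?thesis by simp
  qed
  then show ?thesis using s by simp
qed

lemma riemannian_manifold_torus: "riemannian_manifold (torus_manifold e)"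
  unfolding riemannian_manifold_def riemannian_metric_def torus_manifold_simps(1-3) two_tensor_torus_iff
proof (intro conjI smooth_manifold_torus allI impI ballI)
  fix a i j
  show "smooth_fun 3 (cube a) (\<lambda>x. metric (torus_manifold e) (torus_chart a) x i j)"
    by (cases "i = j") (simp_all add: smooth_fun_exp_scale)
next
  fix a b x :: coord and i j
  have "log_scale e k (shift_into (b 2) (x 2)) = log_scale e k (x 2)" for k by (rule log_scale_periodic) simp
  then show "metric (torus_manifold e) (torus_chart a) x i j =
      metric (torus_manifold e) (torus_chart b) (\<lambda>i\<in>{..<3}. shift_into (b i) (x i)) i j" by simp
next
  fix c and x :: coord and v :: "nat \<Rightarrow> real" assume v: "\<exists>i<3. v i \<noteq> 0"
  then obtain i where i: "i < 3" "v i \<noteq> 0" by blast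
  have "0 < (\<Sum>i<3. exp (2 * log_scale e i (x 2)) * (v i)\<^sup>2)"
    by (rule sum_pos2[of _ i]) (use i in auto)
  then show "0 < (\<Sum>i<3. \<Sum>j<3. metric (torus_manifold e) c x i j * v i * v j)"
    unfolding sum_less_3 by (simp add: power2_eq_square mult.assoc)
qed auto

section \<open>Closedness and the diameter bound\<close>

lemma closed_connected_torus: "closed_connected (torus_manifold e)"
  unfolding closed_connected_def
  using wrap_in_torus[of "\<lambda>_. 0"] by (auto simp: compact_torus connected_torus simp del: wrap_in_torus)

text \<open>From pi > 3 one gets |h_i| <= e / 6.\<close>

lemma log_scale_le: "0 \<le> e \<Longrightarrow> e \<le> 1 \<Longrightarrow> \<bar>2 * log_scale e i z\<bar> \<le> e / 3"
proof -
  assume e: "0 \<le> e" "e \<le> 1"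
  have "\<bar>e * c / (2 * pi)\<bar> \<le> e / 6" if "\<bar>c\<bar> \<le> 1" for c
  proof -
    have "\<bar>e * c / (2 * pi)\<bar> = e * \<bar>c\<bar> / (2 * pi)" using e by (simp add: abs_mult)
    also have "\<dots> \<le> e * 1 / 6" using e that pi_gt3 by (intro frac_le mult_left_mono) auto
    finally show ?thesis by simp
  qed
  note b = this[OF abs_sin_le_one, of "2 * pi * z"] this[OF abs_cos_le_one, of "2 * pi * z"]
  have "\<bar>log_scale e i z\<bar> \<le> e / 6"
  proof (cases "i = 0 \<or> i = 1")
    case True
    then show ?thesis using b unfolding log_scale_def by (elim disjE) (simp_all only: simp_thms if_True if_False one_neq_zero)
  qed (use e in \<open>simp add: log_scale_def\<close>)
  then show ?thesis by simp
qed

text \<open>The straight path between the chosen representatives. It stays in the convex set [0,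
  1)^3 and so never crosses a glued face. It need not be a shortest path; an upper bound on the
  diameter does not ask for that.\<close>

definition segment :: "coord \<Rightarrow> coord \<Rightarrow> real \<Rightarrow> coord" where
  "segment p q t = (\<lambda>i\<in>{..<3}. p i + t * (q i - p i))"

lemma segment_in_torus:
  assumes "p \<in> torus_set" "q \<in> torus_set" "0 \<le> t" "t \<le> 1"
  shows "segment p q t \<in> torus_set"
proof -
  have "0 \<le> p i + t * (q i - p i) \<and> p i + t * (q i - p i) < 1" if "i < 3" for i
  proof -
    have pq: "0 \<le> p i" "p i < 1" "0 \<le> q i" "q i < 1" using assms that by (auto simp: torus_set_def PiE_iff)
    have e: "p i + t * (q i - p i) = (1 - t) * p i + t * q i" by (simp add: algebra_simps)
    have "(1 - t) * p i + t * q i < 1"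
    proof (rule convex_bound_lt[of "p i" 1 "q i" "1 - t" t])
    qed (use pq assms in auto)
    then show ?thesis unfolding e using pq assms by simp
  qed
  then show ?thesis by (auto simp: torus_set_def segment_def)
qed

text \<open>The coordinate formula of a chart makes sense off the torus set as well, so the
  derivative is two-sided even at the endpoints of the segment.\<close>

lemma segment_chart_has_derivative:
  assumes "segment p q t \<in> fst (torus_chart a)" "i < 3"
  shows "((\<lambda>t. snd (torus_chart a) (segment p q t) i) has_real_derivative (q i - p i)) (at t)"
proof -
  have "frac (segment p q t i) \<noteq> frac (a i)"
    using assms by (auto simp: torus_chart_def torus_set_frac)
  then have "frac (p i + t * (q i - p i)) \<noteq> frac (a i)" using assms(2) by (simp add: segment_def)
  from shift_into_has_derivative[OF this]
  have "((\<lambda>t. shift_into (a i) (p i + t * (q i - p i))) has_real_derivative 1 * (q i - p i)) (at t)"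
    by (rule DERIV_chain2) (auto intro!: derivative_eq_intros)
  then show ?thesis using assms(2) by (simp add: torus_chart_def segment_def)
qed

lemma piecewise_C1_segment:
  assumes "p \<in> torus_set" "q \<in> torus_set"
  shows "piecewise_C1_curve (torus_manifold e) (segment p q)"
  unfolding piecewise_C1_curve_def torus_manifold_simps
proof (intro conjI ballI allI impI)
  show "pathin torus_top (segment p q)" unfolding pathin_def
  proof (rule continuous_map_into_torus)
    show "segment p q t \<in> torus_set" if "t \<in> topspace (top_of_set {0..1})" for t
      using that segment_in_torus[OF assms] by simp
    show "continuous_map (top_of_set {0..1}) euclidean (\<lambda>t. cis (2 * pi * segment p q t i))" if "i < 3" for i
      using that by (simp add: segment_def) (intro continuous_intros)
  qed
next
  fix c s u and i :: nat
  assume c: "c \<in> torus_atlas" and su: "0 \<le> s \<and> s \<le> u \<and> u \<le> 1 \<and> segment p q ` {s..u} \<subseteq> fst c" and i: "i < 3"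
  obtain a where a: "c = torus_chart a" using c by (auto simp: torus_atlas_def)
  have "(\<lambda>t. snd c (segment p q t) i) C1_differentiable_on {s..u}"
    unfolding C1_differentiable_on_def
  \<comment> \<open>Near each parameter the path is, in the chart, a translate of the segment, so
    its derivative is constant.\<close>
  proof (intro exI[of _ "\<lambda>_. q i - p i"] conjI ballI)
    fix t assume "t \<in> {s..u}"
    then have "segment p q t \<in> fst (torus_chart a)" using su a by auto
    from segment_chart_has_derivative[OF this i]
    show "((\<lambda>t. snd c (segment p q t) i) has_vector_derivative q i - p i) (at t)"
      unfolding a has_real_derivative_iff_has_vector_derivative .
  qed simp
  then show "(\<lambda>t. snd c (segment p q t) i) piecewise_C1_differentiable_on {s..u}"
    by (rule C1_differentiable_imp_piecewise)
qed

lemma speed_segment_le: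
  assumes pq: "p \<in> torus_set" "q \<in> torus_set" and t: "0 \<le> t" "t \<le> 1" and e: "0 \<le> e" "e \<le> 1"
  shows "speed (torus_manifold e) (segment p q) t \<le> 3"
proof -
  let ?c = "chart_at (torus_manifold e) (segment p q t)"
  have "\<exists>c. c \<in> torus_atlas \<and> segment p q t \<in> fst c"
    using torus_set_covered[OF segment_in_torus[OF pq t]] unfolding torus_atlas_def by blast
  then have "?c \<in> torus_atlas \<and> segment p q t \<in> fst ?c"
    unfolding chart_at_def torus_manifold_simps by (rule someI_ex)
  then obtain a where a: "?c = torus_chart a" "segment p q t \<in> fst (torus_chart a)"
    by (auto simp: torus_atlas_def)
  let ?x = "snd (torus_chart a) (segment p q t)"
  let ?g = "\<lambda>i. exp (2 * log_scale e i (?x 2))"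
  have vel: "velocity (torus_chart a) (segment p q) t i = q i - p i" if "i < 3" for i
    unfolding velocity_def by (rule DERIV_imp_deriv[OF segment_chart_has_derivative[OF a(2) that]])
  \<comment> \<open>Here exp(2 h_i) <= exp 1 <= 3 and the coordinates differ by at most 1. Three
    such terms give speed at most sqrt 9, whence D = 3.\<close>
  have bound: "?g i * (q i - p i) * (q i - p i) \<le> 3" if "i < 3" for i
  proof -
    have "\<bar>q i - p i\<bar> \<le> 1" using pq that by (auto simp: torus_set_def PiE_iff abs_le_iff) (smt (verit) lessThan_iff)+
    then have "\<bar>q i - p i\<bar> * \<bar>q i - p i\<bar> \<le> 1 * 1" by (intro mult_mono) auto
    moreover have "?g i \<le> exp 1" using log_scale_le[OF e, of i "?x 2"] e by (simp add: abs_le_iff)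
    then have "?g i \<le> 3" using exp_le by linarith
    ultimately have "?g i * (\<bar>q i - p i\<bar> * \<bar>q i - p i\<bar>) \<le> 3 * 1" by (intro mult_mono) auto
    then show ?thesis by (simp add: mult.assoc)
  qed
  have "speed (torus_manifold e) (segment p q) t
      = sqrt (\<Sum>i<3. ?g i * (q i - p i) * (q i - p i))"
    unfolding speed_def at_point_def Let_def a(1) torus_manifold_simps sum_less_3 by (simp add: vel)
  also have "\<dots> \<le> sqrt 9"
    using bound[of 0] bound[of 1] bound[of 2] unfolding sum_less_3 by (intro real_sqrt_le_mono) simp
  also have "sqrt 9 = (3::real)" by (rule real_sqrt_unique) simp_all
  finally show ?thesis .
qed

lemma diameter_torus_le:
  assumes e: "0 \<le> e" "e \<le> 1"
  shows "riemannian_diameter (torus_manifold e) \<le> ennreal 3"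
  unfolding riemannian_diameter_def
proof (intro SUP_least)
  fix p q assume "p \<in> topspace (mtop (torus_manifold e))" "q \<in> topspace (mtop (torus_manifold e))"
  then have pq: "p \<in> torus_set" "q \<in> torus_set" by simp_all
  have "segment p q 0 = p" "segment p q 1 = q"
    using pq by (auto simp: segment_def torus_set_def PiE_iff extensional_def fun_eq_iff)
  then have "riemannian_dist (torus_manifold e) p q \<le> curve_length (torus_manifold e) (segment p q)"
    unfolding riemannian_dist_def using piecewise_C1_segment[OF pq] by (intro INF_lower) simp
  also have "\<dots> \<le> (\<integral>\<^sup>+t. ennreal 3 * indicator {0..1::real} t \<partial>lborel)"
    unfolding curve_length_def
  proof (rule nn_integral_mono)
    fix t :: real
    show "ennreal (speed (torus_manifold e) (segment p q) t) * indicator {0..1} t \<le> ennreal 3 * indicator {0..1} t"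
    proof (cases "t \<in> {0..1}")
      case True
      then have "speed (torus_manifold e) (segment p q) t \<le> 3" using speed_segment_le[OF pq _ _ e] by simp
      from ennreal_leI[OF this] True show ?thesis by simp
    qed simp
  qed
  also have "\<dots> = ennreal 3" by (simp add: nn_integral_cmult)
  finally show "riemannian_dist (torus_manifold e) p q \<le> ennreal 3" .
qed

section \<open>One-forms as periodic functions\<close>

text \<open>Despite the name, the value is the lower corner of the unit cube that has
  \<open>x\<close> as its centre.\<close>

definition centre :: "coord \<Rightarrow> coord" where
  "centre x = (\<lambda>i. x i - 1/2)"

definition triple :: "coord \<Rightarrow> real \<times> real \<times> real" where
  "triple x = (x 0, x 1, x 2)"

lemma triple_vec3 [simp]: "triple (vec3 v) = v"
  by (simp add: triple_def)

lemma vec3_triple: "x \<in> cube a \<Longrightarrow> vec3 (triple x) = x"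
  unfolding triple_def by (rule vec3_coords) (simp add: cube_iff)

lemma in_cube_centre: "x \<in> extensional {..<3} \<Longrightarrow> x \<in> cube (centre x)"
  by (simp add: cube_iff centre_def)

text \<open>By the transformation law the coefficients of a 1-form in all charts are restrictions of one periodic
  function on \<open>\<real>\<^sup>3\<close>; at \<open>v\<close> it is read off in the chart whose image is the unit cube centred at \<open>v\<close>.\<close>

definition form_coeff :: "coord field1 \<Rightarrow> nat \<Rightarrow> real \<times> real \<times> real \<Rightarrow> real" where
  "form_coeff \<omega> i v = \<omega> (torus_chart (centre (vec3 v))) (vec3 v) i"

text \<open>The chart is fixed at the base point before differentiating. Any other chart around the
  point gives the same derivative, since the components agree nearby.\<close>

definition form_deriv :: "coord field1 \<Rightarrow> nat \<Rightarrow> nat \<Rightarrow> real \<times> real \<times> real \<Rightarrow> real" where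
  "form_deriv \<omega> m i v = pderiv_at m (\<lambda>y. \<omega> (torus_chart (centre (vec3 v))) y i) (vec3 v)"

text \<open>Points of the cube of \<open>b\<close> avoid its cuts, so the transformation law applies
  at \<open>x\<close>; the only point of that cube congruent to \<open>x\<close> is
  \<open>y\<close>.\<close>

lemma form_chart_cong:
  assumes "one_form 3 torus_atlas \<omega>" "x \<in> cube a" "y \<in> cube b" "\<And>i. i < 3 \<Longrightarrow> frac (x i) = frac (y i)" "i < 3"
  shows "\<omega> (torus_chart a) x i = \<omega> (torus_chart b) y i"
proof -
  have "\<forall>i<3. frac (x i) \<noteq> frac (b i)"
    using assms(3,4) frac_neq_in_interval by (auto simp: cube_iff)
  then have "\<omega> (torus_chart a) x i = \<omega> (torus_chart b) (\<lambda>i\<in>{..<3}. shift_into (b i) (x i)) i"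
    using assms(1,2,5) unfolding one_form_torus_iff by blast
  also have "(\<lambda>i\<in>{..<3}. shift_into (b i) (x i)) = y"
  proof
    fix i show "(\<lambda>i\<in>{..<3}. shift_into (b i) (x i)) i = y i"
    proof (cases "i < 3")
      case True
      then have "shift_into (b i) (x i) = y i"
        using assms(3,4) by (intro shift_into_unique) (auto simp: cube_iff less_imp_le)
      then show ?thesis using True by simp
    next
      case False
      then show ?thesis using assms(3) by (simp add: cube_iff extensional_def)
    qed
  qed
  finally show ?thesis .
qed

lemma form_coeff_chart:
  assumes "one_form 3 torus_atlas \<omega>" "x \<in> cube a" "i < 3"
  shows "\<omega> (torus_chart a) x i = form_coeff \<omega> i (triple x)"
  unfolding form_coeff_def vec3_triple[OF assms(2)]
  by (rule form_chart_cong[OF assms(1,2) in_cube_centre refl assms(3)]) (use assms(2) in \<open>simp add: cube_iff\<close>)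

lemma form_coeff_periodic:
  assumes "one_form 3 torus_atlas \<omega>" "\<And>i. i < 3 \<Longrightarrow> frac (vec3 v i) = frac (vec3 w i)" "i < 3"
  shows "form_coeff \<omega> i v = form_coeff \<omega> i w"
  unfolding form_coeff_def
  by (rule form_chart_cong[OF assms(1) in_cube_centre in_cube_centre assms(2,3)]) simp_all

lemma form_deriv_chart:
  assumes "one_form 3 torus_atlas \<omega>" "x \<in> cube a" "i < 3" "m < 3"
  shows "pderiv_at m (\<lambda>y. \<omega> (torus_chart a) y i) x = form_deriv \<omega> m i (triple x)"
  unfolding form_deriv_def vec3_triple[OF assms(2)]
proof (rule pderiv_at_cong)
  have "x \<in> extensional {..<3}" using assms(2) by (simp add: cube_iff)
  then show "x \<in> cube a \<inter> cube (centre x)" using assms(2) in_cube_centre by simp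
  show "openin (euclid 3) (cube a \<inter> cube (centre x))" by (intro openin_Int openin_cube)
  show "\<omega> (torus_chart a) y i = \<omega> (torus_chart (centre x)) y i" if "y \<in> cube a \<inter> cube (centre x)" for y
    by (rule form_chart_cong[OF assms(1) _ _ refl assms(3)]) (use that in auto)
qed (rule assms(4))

lemma continuous_map_vec3: "continuous_map euclidean (euclid 3) vec3"
  unfolding continuous_map_componentwise
proof (intro conjI ballI subsetI)
  fix y assume "y \<in> vec3 ` topspace euclidean"
  then show "y \<in> extensional {..<3}" by auto
next
  fix i :: nat assume "i \<in> {..<3}"
  then consider "i = 0" | "i = Suc 0" | "i = 2" by fastforce
  then show "continuous_map euclidean euclideanreal (\<lambda>v. vec3 v i)"
    unfolding continuous_map_iff_continuous2 by cases (simp_all, (intro continuous_intros)+)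
qed

text \<open>The preimages of the cubes under \<open>vec3\<close> form an open cover of R^3, and
  continuity is local.\<close>

lemma continuous_on_glue:
  assumes c: "\<And>a. continuous_map (subtopology (euclid 3) (cube a)) euclideanreal (h a)"
    and e: "\<And>a x. x \<in> cube a \<Longrightarrow> H (triple x) = h a x"
  shows "continuous_on UNIV H"
proof -
  let ?S = "\<lambda>a. {v. vec3 v \<in> cube a}"
  have o: "open (?S a)" for a
    using openin_continuous_map_preimage[OF continuous_map_vec3 openin_cube[of a]] by simp
  have "continuous_on (?S a) H" for a
  proof -
    have "continuous_map (top_of_set (?S a)) (subtopology (euclid 3) (cube a)) vec3"
      unfolding continuous_map_in_subtopology
      by (intro conjI continuous_map_from_subtopology continuous_map_vec3) auto
    from continuous_map_compose[OF this c[of a]]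
    have "continuous_on (?S a) (\<lambda>v. h a (vec3 v))" by (simp add: o_def)
    moreover have "H v = h a (vec3 v)" if "v \<in> ?S a" for v using e[of "vec3 v" a] that by simp
    ultimately show ?thesis using continuous_on_cong[of "?S a" "?S a" H "\<lambda>v. h a (vec3 v)"] by simp
  qed
  then have "continuous_on (\<Union>a\<in>UNIV. ?S a) H" using o by (intro continuous_on_open_UN) auto
  moreover have "(\<Union>a\<in>UNIV. ?S a) = UNIV" using in_cube_centre[OF vec3_extensional] by blast
  ultimately show ?thesis by simp
qed

lemma one_form_C1:
  assumes "one_form 3 torus_atlas \<omega>" "i < 3"
  shows "continuous_map (subtopology (euclid 3) (cube a)) euclideanreal (\<lambda>x. \<omega> (torus_chart a) x i)"
    and "m < 3 \<Longrightarrow> x \<in> cube a \<Longrightarrow> (\<lambda>t. \<omega> (torus_chart a) (x(m := t)) i) differentiable at (x m)"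
    and "m < 3 \<Longrightarrow> continuous_map (subtopology (euclid 3) (cube a)) euclideanreal (pderiv_at m (\<lambda>x. \<omega> (torus_chart a) x i))"
proof -
  have "Ck_on (Suc 0) 3 (cube a) (\<lambda>x. \<omega> (torus_chart a) x i)"
    using assms unfolding one_form_torus_iff smooth_fun_def by blast
  then show "continuous_map (subtopology (euclid 3) (cube a)) euclideanreal (\<lambda>x. \<omega> (torus_chart a) x i)"
    and "m < 3 \<Longrightarrow> x \<in> cube a \<Longrightarrow> (\<lambda>t. \<omega> (torus_chart a) (x(m := t)) i) differentiable at (x m)"
    and "m < 3 \<Longrightarrow> continuous_map (subtopology (euclid 3) (cube a)) euclideanreal (pderiv_at m (\<lambda>x. \<omega> (torus_chart a) x i))"
    unfolding Ck_on.simps by blast+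
qed

lemma continuous_form_coeff:
  assumes "one_form 3 torus_atlas \<omega>" "i < 3"
  shows "continuous_on UNIV (form_coeff \<omega> i)"
  by (rule continuous_on_glue[OF one_form_C1(1)[OF assms] form_coeff_chart[OF assms(1) _ assms(2), symmetric]])

lemma continuous_form_deriv:
  assumes "one_form 3 torus_atlas \<omega>" "i < 3" "m < 3"
  shows "continuous_on UNIV (form_deriv \<omega> m i)"
  by (rule continuous_on_glue[OF one_form_C1(3)[OF assms] form_deriv_chart[OF assms(1) _ assms(2,3), symmetric]])

lemma DERIV_form_coeff:
  assumes "one_form 3 torus_atlas \<omega>" "i < 3" "m < 3"
  shows "((\<lambda>t. form_coeff \<omega> i (triple ((vec3 v)(m := t)))) has_real_derivative form_deriv \<omega> m i v) (at (vec3 v m))"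
proof -
  let ?a = "centre (vec3 v)"
  have v: "vec3 v \<in> cube ?a" by (rule in_cube_centre) simp
  have "(\<lambda>t. \<omega> (torus_chart ?a) ((vec3 v)(m := t)) i) differentiable at (vec3 v m)"
    by (rule one_form_C1(2)[OF assms v])
  then have d: "((\<lambda>t. \<omega> (torus_chart ?a) ((vec3 v)(m := t)) i) has_real_derivative form_deriv \<omega> m i v) (at (vec3 v m))"
    unfolding form_deriv_def pderiv_at_def by (simp only: DERIV_deriv_iff_real_differentiable)
  have ev: "eventually (\<lambda>t. \<omega> (torus_chart ?a) ((vec3 v)(m := t)) i = form_coeff \<omega> i (triple ((vec3 v)(m := t)))) (nhds (vec3 v m))"
    using eventually_upd_in_open[OF openin_cube v assms(3)]
    by eventually_elim (rule form_coeff_chart[OF assms(1) _ assms(2)])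
  show ?thesis using d unfolding DERIV_cong_ev[OF refl ev refl] .
qed

lemma DERIV_form_coeff_xyz:
  assumes "one_form 3 torus_atlas \<omega>" "i < 3"
  shows "((\<lambda>t. form_coeff \<omega> i (t, y, z)) has_real_derivative form_deriv \<omega> 0 i (x, y, z)) (at x)"
    and "((\<lambda>t. form_coeff \<omega> i (x, t, z)) has_real_derivative form_deriv \<omega> 1 i (x, y, z)) (at y)"
    and "((\<lambda>t. form_coeff \<omega> i (x, y, t)) has_real_derivative form_deriv \<omega> 2 i (x, y, z)) (at z)"
  using DERIV_form_coeff[OF assms, of 0 "(x, y, z)"] DERIV_form_coeff[OF assms, of 1 "(x, y, z)"]
    DERIV_form_coeff[OF assms, of 2 "(x, y, z)"]
  by (simp_all add: triple_def)

text \<open>Modulo 1, the coordinate line through \<open>w\<close> is the line through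
  \<open>v\<close> with its parameter shifted by an integer; derivatives are unique.\<close>

lemma form_deriv_periodic:
  assumes "one_form 3 torus_atlas \<omega>" "i < 3" "m < 3" and f: "\<And>i. i < 3 \<Longrightarrow> frac (vec3 v i) = frac (vec3 w i)"
  shows "form_deriv \<omega> m i v = form_deriv \<omega> m i w"
proof -
  define k where "k = vec3 w m - vec3 v m"
  have "frac (vec3 w m) = frac (vec3 v m)" using f[OF assms(3)] by simp
  then have k: "k \<in> \<int>" unfolding k_def by (simp only: frac_eq_iff_Ints)
  have "((\<lambda>t. form_coeff \<omega> i (triple ((vec3 w)(m := t + k)))) has_real_derivative form_deriv \<omega> m i w) (at (vec3 v m))"
    using DERIV_form_coeff[OF assms(1-3), of w] DERIV_shift[of "\<lambda>t. form_coeff \<omega> i (triple ((vec3 w)(m := t)))" _ "vec3 v m" k]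
    by (simp add: k_def)
  moreover have "form_coeff \<omega> i (triple ((vec3 w)(m := t + k))) = form_coeff \<omega> i (triple ((vec3 v)(m := t)))" for t
  proof (rule form_coeff_periodic[OF assms(1) _ assms(2)])
    fix j :: nat assume j: "j < 3"
    have e: "vec3 (triple ((vec3 u)(m := s))) = (vec3 u)(m := s)" for u s
      unfolding triple_def by (rule vec3_coords) (use assms(3) in \<open>auto simp: extensional_def vec3_def\<close>)
    have "frac (t + k) = frac t" using k by (simp add: frac_eq_iff_Ints)
    then show "frac (vec3 (triple ((vec3 w)(m := t + k))) j) = frac (vec3 (triple ((vec3 v)(m := t))) j)"
      unfolding e using f[OF j] by (cases "j = m") simp_all
  qed
  ultimately show ?thesis using DERIV_unique[OF DERIV_form_coeff[OF assms(1-3), of v]] by simp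
qed

section \<open>Covariant derivatives and L2 products as integrals of periodic functions\<close>

definition nabla_coeff :: "real \<Rightarrow> coord field1 \<Rightarrow> nat \<Rightarrow> nat \<Rightarrow> real \<times> real \<times> real \<Rightarrow> real" where
  "nabla_coeff e \<omega> i j v = form_deriv \<omega> i j v - (\<Sum>k<3. torus_christoffel e (snd (snd v)) k i j * form_coeff \<omega> k v)"

lemma nabla_chart:
  assumes "one_form 3 torus_atlas \<omega>" "x \<in> cube a" "i < 3" "j < 3"
  shows "nabla (torus_manifold e) \<omega> (torus_chart a) x i j = nabla_coeff e \<omega> i j (triple x)"
proof -
  have "(\<Sum>k<3. christoffel (torus_manifold e) (torus_chart a) x k i j * \<omega> (torus_chart a) x k)
      = (\<Sum>k<3. torus_christoffel e (x 2) k i j * form_coeff \<omega> k (triple x))"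
    using assms by (intro sum.cong) (simp_all add: christoffel_torus form_coeff_chart)
  then show ?thesis
    unfolding nabla_def nabla_coeff_def torus_manifold_simps(1) form_deriv_chart[OF assms(1,2,4,3)]
    by (simp add: triple_def)
qed

lemma continuous_dlog_scale: "continuous_on UNIV (dlog_scale e i)"
  by (rule DERIV_continuous_on) (rule has_field_derivative_at_within[OF DERIV_dlog_scale])

lemma continuous_torus_christoffel: "continuous_on UNIV (\<lambda>z. torus_christoffel e z k i j)"
  by (rule DERIV_continuous_on) (rule has_field_derivative_at_within[OF DERIV_torus_christoffel])

lemma continuous_snd_snd:
  fixes f :: "real \<Rightarrow> real"
  assumes "continuous_on UNIV f"
  shows "continuous_on UNIV (\<lambda>v::real \<times> real \<times> real. f (snd (snd v)))"
  by (rule continuous_on_compose2[OF assms], intro continuous_intros, simp)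

lemma continuous_nabla_coeff:
  assumes "one_form 3 torus_atlas \<omega>" "i < 3" "j < 3"
  shows "continuous_on UNIV (nabla_coeff e \<omega> i j)"
  unfolding nabla_coeff_def[abs_def]
  by (intro continuous_on_diff continuous_on_sum continuous_on_mult continuous_form_deriv continuous_form_coeff
      continuous_snd_snd continuous_torus_christoffel assms) simp

lemma dlog_scale_periodic: "frac y = frac z \<Longrightarrow> dlog_scale e i y = dlog_scale e i z"
  using cis_2pi_cong[of y z] by (simp add: dlog_scale_def complex_eq_iff)

lemma torus_christoffel_periodic: "frac y = frac z \<Longrightarrow> torus_christoffel e y k i j = torus_christoffel e z k i j"
  using dlog_scale_periodic[of y z] log_scale_periodic[of y z] by (simp add: torus_christoffel_def)

lemma nabla_coeff_periodic:
  assumes "one_form 3 torus_atlas \<omega>" "i < 3" "j < 3" and f: "\<And>i. i < 3 \<Longrightarrow> frac (vec3 v i) = frac (vec3 w i)"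
  shows "nabla_coeff e \<omega> i j v = nabla_coeff e \<omega> i j w"
proof -
  have z: "frac (snd (snd v)) = frac (snd (snd w))" using f[of 2] by simp
  have "(\<Sum>k<3. torus_christoffel e (snd (snd v)) k i j * form_coeff \<omega> k v)
      = (\<Sum>k<3. torus_christoffel e (snd (snd w)) k i j * form_coeff \<omega> k w)"
  proof (rule sum.cong[OF refl])
    fix k :: nat assume "k \<in> {..<3}"
    then have "k < 3" by simp
    from form_coeff_periodic[OF assms(1) f this] torus_christoffel_periodic[OF z]
    show "torus_christoffel e (snd (snd v)) k i j * form_coeff \<omega> k v
        = torus_christoffel e (snd (snd w)) k i j * form_coeff \<omega> k w" by simp
  qed
  moreover have "form_deriv \<omega> i j v = form_deriv \<omega> i j w"
    by (rule form_deriv_periodic[OF assms(1,3,2) f])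
  ultimately show ?thesis unfolding nabla_coeff_def by (simp only:)
qed

text \<open>Whichever chart the choice operator returns, it has the point in its domain; this is all
  that the later arguments rely on.\<close>

lemma at_point_torus:
  assumes "p \<in> torus_set"
  obtains a x where "x \<in> cube a" "at_point (torus_manifold e) F p = F (torus_chart a) x" "\<And>i. i < 3 \<Longrightarrow> frac (x i) = p i"
proof -
  let ?c = "chart_at (torus_manifold e) p"
  have "\<exists>c. c \<in> torus_atlas \<and> p \<in> fst c"
    using torus_set_covered[OF assms] unfolding torus_atlas_def by blast
  then have "?c \<in> torus_atlas \<and> p \<in> fst ?c"
    unfolding chart_at_def torus_manifold_simps by (rule someI_ex)
  then obtain a where a: "?c = torus_chart a" "p \<in> fst (torus_chart a)" by (auto simp: torus_atlas_def)
  show thesis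
  proof (rule that[of "snd (torus_chart a) p" a])
    show "snd (torus_chart a) p \<in> cube a" by (rule chart_in_cube[OF a(2)])
    show "at_point (torus_manifold e) F p = F (torus_chart a) (snd (torus_chart a) p)"
      by (simp add: at_point_def Let_def a(1))
    show "frac (snd (torus_chart a) p i) = p i" if "i < 3" for i
      using wrap_chart[OF a(2)] that by (metis wrap_apply)
  qed
qed

text \<open>The factor sqrt(det g) g^{ii} in the L2 product of 1-forms; \<open>weight2\<close> is
  its analogue sqrt(det g) g^{ii} g^{jj} for 2-tensors.\<close>

definition weight1 :: "real \<Rightarrow> nat \<Rightarrow> real \<times> real \<times> real \<Rightarrow> real" where
  "weight1 e i v = vol_density e (snd (snd v)) * exp (- 2 * log_scale e i (snd (snd v)))"

definition weight2 :: "real \<Rightarrow> nat \<Rightarrow> nat \<Rightarrow> real \<times> real \<times> real \<Rightarrow> real" where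
  "weight2 e i j v = vol_density e (snd (snd v)) * (exp (- 2 * log_scale e i (snd (snd v))) * exp (- 2 * log_scale e j (snd (snd v))))"

lemma continuous_weight: "continuous_on UNIV (weight1 e i)" "continuous_on UNIV (weight2 e i j)"
  unfolding weight1_def[abs_def] weight2_def[abs_def]
  by (intro continuous_intros)+

lemma frac_vec3: "frac (vec3 (frac x, frac y, frac z) i) = frac (vec3 (x, y, z) i)" if "i < 3"
  using that by (auto simp: less_3_iff)

text \<open>The local expressions of the integrand all come from one periodic function, so the chart
  chosen at each point is immaterial.\<close>

lemma integral_at_point_torus:
  assumes c: "continuous_on UNIV F"
    and per: "\<And>v w. (\<And>i. i < 3 \<Longrightarrow> frac (vec3 v i) = frac (vec3 w i)) \<Longrightarrow> F v = F w"
    and f: "\<And>a x. x \<in> cube a \<Longrightarrow> f (torus_chart a) x = F (triple x)"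
  shows "(LINT p|volume_measure (torus_manifold e). at_point (torus_manifold e) f p)
    = (\<integral>v. vol_density e (snd (snd v)) * F v \<partial>cube_measure)"
proof (rule integral_volume_torus[OF c])
  show "F (frac x, frac y, frac z) = F (x, y, z)" for x y z
    by (rule per) (rule frac_vec3)
  fix p assume p: "p \<in> torus_set"
  obtain a x where x: "x \<in> cube a" "at_point (torus_manifold e) f p = f (torus_chart a) x"
    "\<And>i. i < 3 \<Longrightarrow> frac (x i) = p i"
    by (rule at_point_torus[OF p, of e f], rule that)
  have "F (triple x) = F (p 0, p 1, p 2)"
    by (rule per) (use x(3) p in \<open>auto simp: triple_def less_3_iff torus_set_frac\<close>)
  then show "at_point (torus_manifold e) f p = F (p 0, p 1, p 2)" using x f by simp
qed

lemma L2_inner1_torus: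
  assumes "one_form 3 torus_atlas \<alpha>" "one_form 3 torus_atlas \<beta>"
  shows "L2_inner1 (torus_manifold e) \<alpha> \<beta>
    = (\<integral>v. (\<Sum>i<3. weight1 e i v * form_coeff \<alpha> i v * form_coeff \<beta> i v) \<partial>cube_measure)"
proof -
  let ?F = "\<lambda>v. \<Sum>i<3. exp (- 2 * log_scale e i (snd (snd v))) * form_coeff \<alpha> i v * form_coeff \<beta> i v"
  have "L2_inner1 (torus_manifold e) \<alpha> \<beta> = (\<integral>v. vol_density e (snd (snd v)) * ?F v \<partial>cube_measure)"
    unfolding L2_inner1_def
    unfolding inner1_def torus_manifold_simps(1)
  proof (rule integral_at_point_torus)
    show "continuous_on UNIV ?F"
      by (intro continuous_on_sum continuous_on_mult continuous_form_coeff assms continuous_intros) simp_all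
  next
    fix v w assume f: "\<And>i. i < 3 \<Longrightarrow> frac (vec3 v i) = frac (vec3 w i)"
    have "frac (snd (snd v)) = frac (snd (snd w))" using f[of 2] by simp
    then show "?F v = ?F w"
      using form_coeff_periodic[OF assms(1) f] form_coeff_periodic[OF assms(2) f]
        log_scale_periodic[of "snd (snd v)" "snd (snd w)"]
      by (intro sum.cong) simp_all
  next
    fix a x assume x: "x \<in> cube a"
    show "(\<Sum>i<3. \<Sum>j<3. cometric (torus_manifold e) (torus_chart a) x i j * \<alpha> (torus_chart a) x i * \<beta> (torus_chart a) x j) = ?F (triple x)"
      unfolding sum_less_3 using form_coeff_chart[OF assms(1) x] form_coeff_chart[OF assms(2) x]
      by (simp add: cometric_torus triple_def)
  qed
  then show ?thesis by (simp add: weight1_def sum_distrib_left mult.assoc)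
qed

lemma L2_inner2_torus:
  assumes "one_form 3 torus_atlas \<alpha>" "one_form 3 torus_atlas \<beta>"
  shows "L2_inner2 (torus_manifold e) (nabla (torus_manifold e) \<alpha>) (nabla (torus_manifold e) \<beta>)
    = (\<integral>v. (\<Sum>i<3. \<Sum>j<3. weight2 e i j v * nabla_coeff e \<alpha> i j v * nabla_coeff e \<beta> i j v) \<partial>cube_measure)"
proof -
  let ?M = "torus_manifold e"
  let ?F = "\<lambda>v. \<Sum>i<3. \<Sum>j<3. exp (- 2 * log_scale e i (snd (snd v))) * exp (- 2 * log_scale e j (snd (snd v)))
      * nabla_coeff e \<alpha> i j v * nabla_coeff e \<beta> i j v"
  have "L2_inner2 ?M (nabla ?M \<alpha>) (nabla ?M \<beta>) = (\<integral>v. vol_density e (snd (snd v)) * ?F v \<partial>cube_measure)"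
    unfolding L2_inner2_def
    unfolding inner2_def torus_manifold_simps(1)
  proof (rule integral_at_point_torus)
    show "continuous_on UNIV ?F"
      by (intro continuous_on_sum continuous_on_mult continuous_nabla_coeff assms continuous_intros) simp_all
  next
    fix v w assume f: "\<And>i. i < 3 \<Longrightarrow> frac (vec3 v i) = frac (vec3 w i)"
    have "frac (snd (snd v)) = frac (snd (snd w))" using f[of 2] by simp
    then show "?F v = ?F w"
      using nabla_coeff_periodic[OF assms(1) _ _ f] nabla_coeff_periodic[OF assms(2) _ _ f]
        log_scale_periodic[of "snd (snd v)" "snd (snd w)"]
      by (intro sum.cong) simp_all
  next
    fix a x assume x: "x \<in> cube a"
    show "(\<Sum>i<3. \<Sum>j<3. \<Sum>k<3. \<Sum>l<3. cometric ?M (torus_chart a) x i k * cometric ?M (torus_chart a) x j l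
            * nabla ?M \<alpha> (torus_chart a) x i j * nabla ?M \<beta> (torus_chart a) x k l) = ?F (triple x)"
    proof (intro sum.cong refl)
      fix i j :: nat assume "i \<in> {..<3}" "j \<in> {..<3}"
      then have ij: "i < 3" "j < 3" by simp_all
      \<comment> \<open>The diagonal inverse metric is written with Kronecker deltas, which collapse
        the two inner sums.\<close>
      have "(\<Sum>k<3. \<Sum>l<3. cometric ?M (torus_chart a) x i k * cometric ?M (torus_chart a) x j l
            * nabla ?M \<alpha> (torus_chart a) x i j * nabla ?M \<beta> (torus_chart a) x k l)
        = (\<Sum>k<3. (if i = k then 1 else 0) * (\<Sum>l<3. (if j = l then 1 else 0) *
            (exp (- 2 * log_scale e i (x 2)) * exp (- 2 * log_scale e j (x 2))
            * nabla_coeff e \<alpha> i j (triple x) * nabla_coeff e \<beta> k l (triple x))))"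
        unfolding sum_distrib_left using ij
        by (intro sum.cong refl) (simp add: cometric_torus nabla_chart[OF assms(1) x] nabla_chart[OF assms(2) x])
      also have "\<dots> = exp (- 2 * log_scale e i (x 2)) * exp (- 2 * log_scale e j (x 2))
            * nabla_coeff e \<alpha> i j (triple x) * nabla_coeff e \<beta> i j (triple x)"
        using ij by (simp only: sum_delta_3)
      finally show "(\<Sum>k<3. \<Sum>l<3. cometric ?M (torus_chart a) x i k * cometric ?M (torus_chart a) x j l
            * nabla ?M \<alpha> (torus_chart a) x i j * nabla ?M \<beta> (torus_chart a) x k l)
        = exp (- 2 * log_scale e i (snd (snd (triple x)))) * exp (- 2 * log_scale e j (snd (snd (triple x))))
            * nabla_coeff e \<alpha> i j (triple x) * nabla_coeff e \<beta> i j (triple x)"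
        by (simp add: triple_def)
    qed
  qed
  then show ?thesis by (simp add: weight2_def sum_distrib_left mult.assoc)
qed

section \<open>The eigenform and the bottom of the spectrum\<close>

definition dz_form :: "coord field1" where
  "dz_form c x i = (if i = 2 then 1 else 0)"

lemma one_form_dz: "one_form 3 torus_atlas (\<lambda>c x i. k * dz_form c x i)"
  unfolding one_form_torus_iff dz_form_def by simp

lemma form_coeff_dz: "form_coeff (\<lambda>c x i. k * dz_form c x i) i v = (if i = 2 then k else 0)"
  by (simp add: form_coeff_def dz_form_def)

text \<open>The components of dz are constant, so only - Gamma^2_{ij} remains.\<close>

lemma nabla_dz:
  assumes "i < 3" "j < 3"
  shows "nabla (torus_manifold e) dz_form c x i j = (if i = j then dlog_scale e i (x 2) * exp (2 * log_scale e i (x 2)) else 0)"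
  unfolding nabla_def torus_manifold_simps(1) sum_less_3 using assms
  by (auto simp: dz_form_def christoffel_torus torus_christoffel_def)

lemma nabla_coeff_dz:
  assumes "i < 3" "j < 3"
  shows "nabla_coeff e dz_form i j v = (if i = j then dlog_scale e i (snd (snd v)) * exp (2 * log_scale e i (snd (snd v))) else 0)"
  unfolding nabla_coeff_def sum_less_3 using assms
  by (auto simp: form_deriv_def form_coeff_def dz_form_def torus_christoffel_def)

lemma two_tensor_nabla_dz: "two_tensor 3 torus_atlas (nabla (torus_manifold e) dz_form)"
  unfolding two_tensor_torus_iff
proof (intro conjI allI impI)
  fix a and i j :: nat assume "i < 3" "j < 3"
  then show "smooth_fun 3 (cube a) (\<lambda>x. nabla (torus_manifold e) dz_form (torus_chart a) x i j)"
    by (cases "i = j") (simp_all add: nabla_dz smooth_fun_dlog_scale)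
next
  fix a b x :: coord and i j :: nat assume ij: "i < 3" "j < 3"
  have "frac (shift_into (b 2) (x 2)) = frac (x 2)" by simp
  from dlog_scale_periodic[OF this] log_scale_periodic[OF this] ij
  show "nabla (torus_manifold e) dz_form (torus_chart a) x i j
      = nabla (torus_manifold e) dz_form (torus_chart b) (\<lambda>i\<in>{..<3}. shift_into (b i) (x i)) i j"
    by (simp add: nabla_dz)
qed

lemma continuous_vol_exp_dlog:
  "continuous_on UNIV (\<lambda>z. vol_density e z * exp (- 2 * log_scale e i z) * dlog_scale e i z)"
  by (intro continuous_intros continuous_dlog_scale)

text \<open>Pairing the covariant derivative of \<alpha> with the Hessian of z leaves exp(-2 h_i)
  h_i' d_i \<alpha>_i for i = 0 and i = 1, plus (h_0'^2 + h_1'^2) \<alpha>_2. The first two terms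
  have weights in z alone and integrate to zero; the last one is e^2 times the pairing of \<alpha>
  with dz.\<close>

lemma rough_laplacian_dz: "rough_laplacian (torus_manifold e) dz_form (\<lambda>c x i. e\<^sup>2 * dz_form c x i)"
proof -
  let ?M = "torus_manifold e"
  have dz: "one_form 3 torus_atlas dz_form" using one_form_dz[of 1] by simp
  have main: "L2_inner2 ?M (nabla ?M \<alpha>) (nabla ?M dz_form) = L2_inner1 ?M \<alpha> (\<lambda>c x i. e\<^sup>2 * dz_form c x i)"
    if a: "one_form 3 torus_atlas \<alpha>" for \<alpha>
  proof -
    let ?w = "\<lambda>i z. vol_density e z * exp (- 2 * log_scale e i z) * dlog_scale e i z"
    let ?D = "\<lambda>i v. ?w i (snd (snd v)) * form_deriv \<alpha> i i v"
    let ?G = "\<lambda>v. vol_density e (snd (snd v)) * (e\<^sup>2 * form_coeff \<alpha> 2 v)"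
    have ex: "exp (- 2 * x) * exp (2 * x) = 1" for x :: real by (simp flip: exp_add)
    have sq: "(dlog_scale e 0 z)\<^sup>2 + (dlog_scale e 1 z)\<^sup>2 = e\<^sup>2" for z
      by (simp add: dlog_scale_def power_mult_distrib flip: distrib_left)
    have d: "weight2 e i i v * nabla_coeff e \<alpha> i i v * nabla_coeff e dz_form i i v
        = ?D i v + vol_density e (snd (snd v)) * (dlog_scale e i (snd (snd v)))\<^sup>2 * form_coeff \<alpha> 2 v"
      if "i = 0 \<or> i = 1" for i v
    proof -
      let ?z = "snd (snd v)"
      let ?E = "exp (- 2 * log_scale e i ?z)" and ?F = "exp (2 * log_scale e i ?z)"
      \<comment> \<open>In the diagonal entries with i = 0 or i = 1 the only nonzero Christoffel
        symbol is Gamma^2_{ii}.\<close>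
      have n: "nabla_coeff e \<alpha> i i v = form_deriv \<alpha> i i v + dlog_scale e i ?z * ?F * form_coeff \<alpha> 2 v"
        using that by (auto simp: nabla_coeff_def sum_less_3 torus_christoffel_def)
      have "weight2 e i i v * nabla_coeff e \<alpha> i i v * nabla_coeff e dz_form i i v
          = vol_density e ?z * (?E * ?E) * (form_deriv \<alpha> i i v + dlog_scale e i ?z * ?F * form_coeff \<alpha> 2 v) * (dlog_scale e i ?z * ?F)"
        using that unfolding n weight2_def by (auto simp: nabla_coeff_dz)
      \<comment> \<open>Regrouped so that every exp(2 h_i) meets an exp(-2 h_i) and cancels.\<close>
      also have "\<dots> = vol_density e ?z * ?E * (?E * ?F) * dlog_scale e i ?z * form_deriv \<alpha> i i v
          + vol_density e ?z * (?E * ?F) * (?E * ?F) * (dlog_scale e i ?z)\<^sup>2 * form_coeff \<alpha> 2 v"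
        by (simp only: power2_eq_square distrib_left distrib_right mult_ac)
      also have "\<dots> = ?D i v + vol_density e ?z * (dlog_scale e i ?z)\<^sup>2 * form_coeff \<alpha> 2 v"
        unfolding ex by simp
      finally show ?thesis .
    qed
    have "L2_inner2 ?M (nabla ?M \<alpha>) (nabla ?M dz_form) = (\<integral>v. ?D 0 v + ?D 1 v + ?G v \<partial>cube_measure)"
      unfolding L2_inner2_torus[OF a dz]
    proof (rule Bochner_Integration.integral_cong[OF refl])
      fix v :: "real \<times> real \<times> real"
      let ?z = "snd (snd v)"
      have "(\<Sum>i<3. \<Sum>j<3. weight2 e i j v * nabla_coeff e \<alpha> i j v * nabla_coeff e dz_form i j v)
        = weight2 e 0 0 v * nabla_coeff e \<alpha> 0 0 v * nabla_coeff e dz_form 0 0 v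
        + weight2 e 1 1 v * nabla_coeff e \<alpha> 1 1 v * nabla_coeff e dz_form 1 1 v"
        unfolding sum_less_3 by (simp add: nabla_coeff_dz)
      also have "\<dots> = ?D 0 v + ?D 1 v + vol_density e ?z * ((dlog_scale e 0 ?z)\<^sup>2 + (dlog_scale e 1 ?z)\<^sup>2) * form_coeff \<alpha> 2 v"
        unfolding d[OF disjI1[OF refl]] d[OF disjI2[OF refl]] by (simp add: algebra_simps)
      finally show "(\<Sum>i<3. \<Sum>j<3. weight2 e i j v * nabla_coeff e \<alpha> i j v * nabla_coeff e dz_form i j v) = ?D 0 v + ?D 1 v + ?G v"
        unfolding sq by (simp add: mult.assoc)
    qed
    also have "\<dots> = (\<integral>v. ?D 0 v \<partial>cube_measure) + (\<integral>v. ?D 1 v \<partial>cube_measure) + (\<integral>v. ?G v \<partial>cube_measure)"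
    proof -
      have "integrable cube_measure (?D i)" if "i < 3" for i
        by (intro continuous_cube(3) continuous_on_mult continuous_snd_snd[OF continuous_vol_exp_dlog] continuous_form_deriv a that)
      moreover have "integrable cube_measure ?G"
        by (intro continuous_cube(3) continuous_on_mult continuous_form_coeff a continuous_intros) simp
      ultimately show ?thesis by simp
    qed
    also have "(\<integral>v. ?D 0 v \<partial>cube_measure) = 0"
    proof (rule integral_cube_deriv_x[OF continuous_form_deriv[OF a] continuous_vol_exp_dlog DERIV_form_coeff_xyz(1)[OF a]])
      show "form_coeff \<alpha> 0 (1, y, z) = form_coeff \<alpha> 0 (0, y, z)" for y z
        by (rule form_coeff_periodic[OF a]) (auto simp: less_3_iff)
    qed simp_all
    also have "(\<integral>v. ?D 1 v \<partial>cube_measure) = 0"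
    proof (rule integral_cube_deriv_y[OF continuous_form_deriv[OF a] continuous_vol_exp_dlog DERIV_form_coeff_xyz(2)[OF a]])
      show "form_coeff \<alpha> 1 (x, 1, z) = form_coeff \<alpha> 1 (x, 0, z)" for x z
        by (rule form_coeff_periodic[OF a]) (auto simp: less_3_iff)
    qed simp_all
    also have "0 + 0 + (\<integral>v. ?G v \<partial>cube_measure) = L2_inner1 ?M \<alpha> (\<lambda>c x i. e\<^sup>2 * dz_form c x i)"
      unfolding L2_inner1_torus[OF a one_form_dz] form_coeff_dz
      by (simp add: sum_less_3 weight1_def mult_ac)
    finally show ?thesis .
  qed
  show ?thesis unfolding rough_laplacian_def nabla_adjoint_def torus_manifold_simps(1,3)
    using dz one_form_dz two_tensor_nabla_dz main by blast
qed

lemma rough_eigenvalue_dz: "rough_eigenvalue (torus_manifold e) (e\<^sup>2)"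
  unfolding rough_eigenvalue_def
proof (intro exI conjI)
  show "rough_laplacian (torus_manifold e) dz_form (\<lambda>c x i. e\<^sup>2 * dz_form c x i)" by (rule rough_laplacian_dz)
  have "vec3 0 \<in> cube (centre (vec3 0))" by (rule in_cube_centre) simp
  then show "nonzero_form (torus_manifold e) dz_form"
    unfolding nonzero_form_def torus_atlas_def
    by (auto simp: dz_form_def torus_atlas_def intro!: exI[of _ 2])
qed

section \<open>Orthogonality of eigenforms and the number of small eigenvalues\<close>

lemma L2_inner1_scale: "L2_inner1 M \<alpha> (\<lambda>c x i. k * \<beta> c x i) = k * L2_inner1 M \<alpha> \<beta>"
proof -
  have "inner1 M \<alpha> (\<lambda>c x i. k * \<beta> c x i) p = k * inner1 M \<alpha> \<beta> p" for p
    by (simp add: inner1_def at_point_def Let_def sum_distrib_left mult_ac)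
  then show ?thesis by (simp add: L2_inner1_def)
qed

lemma rough_laplacian_energy:
  assumes "rough_laplacian (torus_manifold e) \<omega> (\<lambda>c x i. k * \<omega> c x i)" "one_form 3 torus_atlas \<alpha>"
  shows "L2_inner2 (torus_manifold e) (nabla (torus_manifold e) \<alpha>) (nabla (torus_manifold e) \<omega>)
    = k * L2_inner1 (torus_manifold e) \<alpha> \<omega>"
  using assms unfolding rough_laplacian_def nabla_adjoint_def torus_manifold_simps L2_inner1_scale by blast

text \<open>Testing each eigenvalue equation with the other form and using symmetry shows that the
  L2 product is unchanged when its factor k is replaced by k', so it vanishes. Orthogonality of the
  covariant derivatives then makes the energy of a combination a sum over its members.\<close>

lemma L2_orthogonal:
  assumes "rough_laplacian (torus_manifold e) \<omega> (\<lambda>c x i. k * \<omega> c x i)"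
    and "rough_laplacian (torus_manifold e) \<omega>' (\<lambda>c x i. k' * \<omega>' c x i)" and "k \<noteq> k'"
  shows "L2_inner1 (torus_manifold e) \<omega> \<omega>' = 0"
    and "L2_inner2 (torus_manifold e) (nabla (torus_manifold e) \<omega>) (nabla (torus_manifold e) \<omega>') = 0"
proof -
  let ?M = "torus_manifold e"
  have f: "one_form 3 torus_atlas \<omega>" "one_form 3 torus_atlas \<omega>'"
    using assms unfolding rough_laplacian_def torus_manifold_simps by blast+
  have s1: "L2_inner1 ?M \<omega>' \<omega> = L2_inner1 ?M \<omega> \<omega>'"
    unfolding L2_inner1_torus[OF f] L2_inner1_torus[OF f(2,1)] by (simp add: mult_ac)
  have s2: "L2_inner2 ?M (nabla ?M \<omega>') (nabla ?M \<omega>)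
      = L2_inner2 ?M (nabla ?M \<omega>) (nabla ?M \<omega>')"
    unfolding L2_inner2_torus[OF f] L2_inner2_torus[OF f(2,1)] by (simp add: mult_ac)
  have "k' * L2_inner1 ?M \<omega> \<omega>' = k * L2_inner1 ?M \<omega> \<omega>'"
    using rough_laplacian_energy[OF assms(1) f(2)] rough_laplacian_energy[OF assms(2) f(1)] s1 s2 by simp
  then show z: "L2_inner1 ?M \<omega> \<omega>' = 0" using assms(3) by simp
  show "L2_inner2 ?M (nabla ?M \<omega>) (nabla ?M \<omega>') = 0"
    using rough_laplacian_energy[OF assms(2) f(1)] z by simp
qed

lemma L2_inner1_pos:
  assumes "one_form 3 torus_atlas \<omega>" "nonzero_form (torus_manifold e) \<omega>"
  shows "0 < L2_inner1 (torus_manifold e) \<omega> \<omega>"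
proof -
  obtain a x i where x: "x \<in> cube a" "i < 3" "\<omega> (torus_chart a) x i \<noteq> 0"
    using assms(2) by (auto simp: nonzero_form_def torus_atlas_def)
  \<comment> \<open>The point is moved into [0, 1)^3, because the integral sees only the unit
    cube.\<close>
  let ?v = "(frac (x 0), frac (x 1), frac (x 2))"
  have "form_coeff \<omega> i ?v = form_coeff \<omega> i (triple x)"
    unfolding triple_def by (rule form_coeff_periodic[OF assms(1) frac_vec3 x(2)])
  then have nz: "form_coeff \<omega> i ?v \<noteq> 0" using x form_coeff_chart[OF assms(1) x(1,2)] by simp
  have w: "0 < weight1 e i v" for i v by (simp add: weight1_def vol_density_def)
  show ?thesis unfolding L2_inner1_torus[OF assms(1,1)]
  proof (rule integral_cube_pos[of _ ?v])
    show "continuous_on UNIV (\<lambda>v. \<Sum>i<3. weight1 e i v * form_coeff \<omega> i v * form_coeff \<omega> i v)"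
      by (intro continuous_on_sum continuous_on_mult continuous_weight continuous_form_coeff assms) simp_all
    show "0 \<le> (\<Sum>i<3. weight1 e i v * form_coeff \<omega> i v * form_coeff \<omega> i v)" for v
      by (intro sum_nonneg) (simp add: w less_imp_le mult.assoc)
    show "?v \<in> {0..1} \<times> {0..1} \<times> {0..1}" by (simp add: frac_lt_1 less_imp_le)
    have "0 < form_coeff \<omega> i ?v * form_coeff \<omega> i ?v" using nz by (simp add: zero_less_mult_iff) linarith
    then show "0 < (\<Sum>i<3. weight1 e i ?v * form_coeff \<omega> i ?v * form_coeff \<omega> i ?v)"
      using x(2) by (intro sum_pos2[of _ i]) (simp_all add: w less_imp_le mult.assoc)
  qed
qed

text \<open>More vectors than the dimension are linearly dependent. Dependence is a notion for sets,
  so a repeated vector is treated apart, with coefficients 1 and -1.\<close>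

lemma exists_vanishing_combination:
  fixes f :: "'a \<Rightarrow> 'b::euclidean_space"
  assumes "finite S" "DIM('b) < card S"
  obtains c where "\<exists>x\<in>S. c x \<noteq> 0" "(\<Sum>x\<in>S. c x *\<^sub>R f x) = 0"
proof (cases "inj_on f S")
  case True
  then have "dependent (f ` S)" using assms by (intro dependent_biggerset) (simp add: card_image)
  then obtain u where u: "\<exists>v\<in>f ` S. u v \<noteq> 0" "(\<Sum>v\<in>f ` S. u v *\<^sub>R v) = 0"
    using dependent_finite[of "f ` S"] assms(1) by auto
  show ?thesis
    by (rule that[of "u \<circ> f"]) (use u True in \<open>auto simp: sum.reindex\<close>)
next
  case False
  then obtain x y where xy: "x \<in> S" "y \<in> S" "x \<noteq> y" "f x = f y" by (auto simp: inj_on_def)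
  let ?c = "\<lambda>z. (if z = x then 1 else 0) - (if z = y then 1 else 0) :: real"
  show ?thesis
  proof (rule that[of ?c])
    show "\<exists>z\<in>S. ?c z \<noteq> 0" using xy by (intro bexI[of _ x]) auto
    have "(\<Sum>z\<in>S. ?c z *\<^sub>R f z) = (\<Sum>z\<in>S. (if z = x then f z else 0)) - (\<Sum>z\<in>S. (if z = y then f z else 0))"
      unfolding sum_subtractf[symmetric] by (intro sum.cong) (auto simp: scaleR_diff_left)
    then show "(\<Sum>z\<in>S. ?c z *\<^sub>R f z) = 0" using xy assms(1) by (simp add: sum.delta)
  qed
qed

text \<open>Pythagoras for a weighted L2 product. The index set \<open>Q\<close> is abstract so that
  1-forms, with one index, and their covariant derivatives, with pairs of indices, are both
  covered.\<close>

lemma integral_square_orthogonal: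
  fixes F :: "'s \<Rightarrow> 'q \<Rightarrow> real \<times> real \<times> real \<Rightarrow> real"
  assumes "finite S" "finite Q"
    and cont: "\<And>q. q \<in> Q \<Longrightarrow> continuous_on UNIV (W q)" "\<And>s q. s \<in> S \<Longrightarrow> q \<in> Q \<Longrightarrow> continuous_on UNIV (F s q)"
    and orth: "\<And>s t. s \<in> S \<Longrightarrow> t \<in> S \<Longrightarrow> s \<noteq> t \<Longrightarrow> (\<integral>v. (\<Sum>q\<in>Q. W q v * F s q v * F t q v) \<partial>cube_measure) = 0"
  shows "(\<integral>v. (\<Sum>q\<in>Q. W q v * (\<Sum>s\<in>S. c s * F s q v)\<^sup>2) \<partial>cube_measure)
    = (\<Sum>s\<in>S. (c s)\<^sup>2 * (\<integral>v. (\<Sum>q\<in>Q. W q v * F s q v * F s q v) \<partial>cube_measure))"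
proof -
  have i: "integrable cube_measure (\<lambda>v. \<Sum>q\<in>Q. W q v * F s q v * F t q v)" if "s \<in> S" "t \<in> S" for s t
    by (intro continuous_cube(3) continuous_on_sum continuous_on_mult cont that)
  have "(\<Sum>q\<in>Q. W q v * (\<Sum>s\<in>S. c s * F s q v)\<^sup>2) = (\<Sum>s\<in>S. \<Sum>t\<in>S. c s * c t * (\<Sum>q\<in>Q. W q v * F s q v * F t q v))" for v
  proof -
    have "(\<Sum>q\<in>Q. W q v * (\<Sum>s\<in>S. c s * F s q v)\<^sup>2) = (\<Sum>q\<in>Q. \<Sum>s\<in>S. \<Sum>t\<in>S. c s * c t * (W q v * F s q v * F t q v))"
    proof (rule sum.cong[OF refl])
      fix q
      have "(\<Sum>s\<in>S. c s * F s q v)\<^sup>2 = (\<Sum>s\<in>S. \<Sum>t\<in>S. (c s * F s q v) * (c t * F t q v))"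
        by (simp only: power2_eq_square sum_product)
      then have "W q v * (\<Sum>s\<in>S. c s * F s q v)\<^sup>2 = (\<Sum>s\<in>S. \<Sum>t\<in>S. W q v * ((c s * F s q v) * (c t * F t q v)))"
        by (simp only: sum_distrib_left)
      also have "\<dots> = (\<Sum>s\<in>S. \<Sum>t\<in>S. c s * c t * (W q v * F s q v * F t q v))"
        by (intro sum.cong refl) (simp only: mult_ac)
      finally show "W q v * (\<Sum>s\<in>S. c s * F s q v)\<^sup>2 = (\<Sum>s\<in>S. \<Sum>t\<in>S. c s * c t * (W q v * F s q v * F t q v))" .
    qed
    also have "\<dots> = (\<Sum>s\<in>S. \<Sum>q\<in>Q. \<Sum>t\<in>S. c s * c t * (W q v * F s q v * F t q v))" by (rule sum.swap)
    also have "\<dots> = (\<Sum>s\<in>S. \<Sum>t\<in>S. \<Sum>q\<in>Q. c s * c t * (W q v * F s q v * F t q v))"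
      by (intro sum.cong refl sum.swap)
    finally show ?thesis by (simp only: sum_distrib_left)
  qed
  then have "(\<integral>v. (\<Sum>q\<in>Q. W q v * (\<Sum>s\<in>S. c s * F s q v)\<^sup>2) \<partial>cube_measure)
      = (\<integral>v. (\<Sum>s\<in>S. \<Sum>t\<in>S. c s * c t * (\<Sum>q\<in>Q. W q v * F s q v * F t q v)) \<partial>cube_measure)" by simp
  also have "\<dots> = (\<Sum>s\<in>S. \<Sum>t\<in>S. c s * c t * (\<integral>v. (\<Sum>q\<in>Q. W q v * F s q v * F t q v) \<partial>cube_measure))"
  proof -
    have "(\<integral>v. (\<Sum>t\<in>S. c s * c t * (\<Sum>q\<in>Q. W q v * F s q v * F t q v)) \<partial>cube_measure)
        = (\<Sum>t\<in>S. c s * c t * (\<integral>v. (\<Sum>q\<in>Q. W q v * F s q v * F t q v) \<partial>cube_measure))" if "s \<in> S" for s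
      by (subst Bochner_Integration.integral_sum)
        (rule integrable_mult_right, rule i[OF that], assumption, simp)
    moreover have "(\<integral>v. (\<Sum>s\<in>S. \<Sum>t\<in>S. c s * c t * (\<Sum>q\<in>Q. W q v * F s q v * F t q v)) \<partial>cube_measure)
        = (\<Sum>s\<in>S. (\<integral>v. (\<Sum>t\<in>S. c s * c t * (\<Sum>q\<in>Q. W q v * F s q v * F t q v)) \<partial>cube_measure))"
      by (rule Bochner_Integration.integral_sum) (intro Bochner_Integration.integrable_sum integrable_mult_right i)
    ultimately show ?thesis by simp
  qed
  also have "\<dots> = (\<Sum>s\<in>S. \<Sum>t\<in>S. if s = t then (c s)\<^sup>2 * (\<integral>v. (\<Sum>q\<in>Q. W q v * F s q v * F s q v) \<partial>cube_measure) else 0)"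
    using orth by (intro sum.cong refl) (auto simp: power2_eq_square)
  also have "\<dots> = (\<Sum>s\<in>S. (c s)\<^sup>2 * (\<integral>v. (\<Sum>q\<in>Q. W q v * F s q v * F s q v) \<partial>cube_measure))"
    using assms(1) by (intro sum.cong refl) (simp add: sum.delta')
  finally show ?thesis .
qed

text \<open>The flat energy density is controlled by the covariant one, as the Christoffel symbols are \<open>O(e)\<close>.\<close>

lemma sum_sq_deriv_le:
  fixes n d :: "nat \<Rightarrow> nat \<Rightarrow> real" and g :: "nat \<Rightarrow> real"
  assumes e: "0 \<le> e" "e \<le> 1/10"
    and d: "\<And>i j. i < 3 \<Longrightarrow> j < 3 \<Longrightarrow> d i j = n i j + (\<Sum>k<3. torus_christoffel e z k i j * g k)"
  shows "(\<Sum>i<3. \<Sum>j<3. (d i j)\<^sup>2) \<le> 2 * (\<Sum>i<3. \<Sum>j<3. (n i j)\<^sup>2) + 4/25 * (\<Sum>k<3. (g k)\<^sup>2)"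
proof -
  have sq: "(x + y)\<^sup>2 \<le> 2 * x\<^sup>2 + 2 * y\<^sup>2" for x y :: real
    using zero_le_power2[of "x - y"] by (simp add: power2_sum power2_diff)
  have sm: "(x * y)\<^sup>2 \<le> K\<^sup>2 * y\<^sup>2" if "\<bar>x\<bar> \<le> K" for x y K :: real
    unfolding power_mult_distrib using that by (intro mult_right_mono) (auto simp: abs_le_square_iff[symmetric])
  have D: "\<bar>dlog_scale e i z\<bar> \<le> 1/10" for i using dlog_scale_bound[OF e(1), of i z] e by linarith
  \<comment> \<open>The symbols with upper index 2 carry exp(2 h_i), which is at most 2 here; this
    doubles the bound 1/10 on h_i'.\<close>
  have E: "\<bar>- dlog_scale e i z * exp (2 * log_scale e i z)\<bar> \<le> 1/5" for i
  proof -
    have "2 * log_scale e i z \<le> 1/2" using log_scale_le[of e i z] e by (simp add: abs_le_iff)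
    then have "exp (2 * log_scale e i z) \<le> exp (1/2)" by simp
    also have "\<dots> \<le> 1 + 1/2 + (1/2)\<^sup>2" by (rule exp_bound) simp_all
    also have "\<dots> \<le> 2" by (simp add: power2_eq_square)
    finally have "\<bar>dlog_scale e i z\<bar> * exp (2 * log_scale e i z) \<le> 1/10 * 2"
      by (intro mult_mono D) auto
    then show ?thesis by (simp add: abs_mult)
  qed
  have c: "torus_christoffel e z 2 0 0 = - dlog_scale e 0 z * exp (2 * log_scale e 0 z)"
    "torus_christoffel e z 2 1 1 = - dlog_scale e 1 z * exp (2 * log_scale e 1 z)"
    "torus_christoffel e z 0 0 2 = dlog_scale e 0 z" "torus_christoffel e z 0 2 0 = dlog_scale e 0 z"
    "torus_christoffel e z 1 1 2 = dlog_scale e 1 z" "torus_christoffel e z 1 2 1 = dlog_scale e 1 z"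
    by (simp_all add: torus_christoffel_def)
  have e1: "d 0 0 = n 0 0 + torus_christoffel e z 2 0 0 * g 2" "d 1 1 = n 1 1 + torus_christoffel e z 2 1 1 * g 2"
    "d 0 2 = n 0 2 + torus_christoffel e z 0 0 2 * g 0" "d 2 0 = n 2 0 + torus_christoffel e z 0 2 0 * g 0"
    "d 1 2 = n 1 2 + torus_christoffel e z 1 1 2 * g 1" "d 2 1 = n 2 1 + torus_christoffel e z 1 2 1 * g 1"
    "d 0 1 = n 0 1" "d 1 0 = n 1 0" "d 2 2 = n 2 2"
    by (simp_all add: d sum_less_3 torus_christoffel_def)
  have b: "(d 0 0)\<^sup>2 \<le> 2 * (n 0 0)\<^sup>2 + 2 * ((1/5)\<^sup>2 * (g 2)\<^sup>2)" "(d 1 1)\<^sup>2 \<le> 2 * (n 1 1)\<^sup>2 + 2 * ((1/5)\<^sup>2 * (g 2)\<^sup>2)"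
    "(d 0 2)\<^sup>2 \<le> 2 * (n 0 2)\<^sup>2 + 2 * ((1/10)\<^sup>2 * (g 0)\<^sup>2)" "(d 2 0)\<^sup>2 \<le> 2 * (n 2 0)\<^sup>2 + 2 * ((1/10)\<^sup>2 * (g 0)\<^sup>2)"
    "(d 1 2)\<^sup>2 \<le> 2 * (n 1 2)\<^sup>2 + 2 * ((1/10)\<^sup>2 * (g 1)\<^sup>2)" "(d 2 1)\<^sup>2 \<le> 2 * (n 2 1)\<^sup>2 + 2 * ((1/10)\<^sup>2 * (g 1)\<^sup>2)"
    unfolding e1 c
    by (rule order_trans[OF sq], intro add_left_mono mult_left_mono sm D E, simp)+
  have b': "(d 0 1)\<^sup>2 \<le> 2 * (n 0 1)\<^sup>2" "(d 1 0)\<^sup>2 \<le> 2 * (n 1 0)\<^sup>2" "(d 2 2)\<^sup>2 \<le> 2 * (n 2 2)\<^sup>2"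
    unfolding e1 by simp_all
  define G where "G i = (g i)\<^sup>2" for i
  have nn: "0 \<le> G 0" "0 \<le> G 1" "0 \<le> G 2" by (simp_all add: G_def)
  have "(1/5 :: real)\<^sup>2 = 1/25" "(1/10 :: real)\<^sup>2 = 1/100" by (simp_all add: power2_eq_square)
  note b'' = b[unfolded this G_def[symmetric]]
  have "(\<Sum>i<3. \<Sum>j<3. (d i j)\<^sup>2) \<le>
      (2 * (n 0 0)\<^sup>2 + 2 * (1/25 * G 2) + 2 * (n 0 1)\<^sup>2 + (2 * (n 0 2)\<^sup>2 + 2 * (1/100 * G 0)))
      + (2 * (n 1 0)\<^sup>2 + (2 * (n 1 1)\<^sup>2 + 2 * (1/25 * G 2)) + (2 * (n 1 2)\<^sup>2 + 2 * (1/100 * G 1)))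
      + ((2 * (n 2 0)\<^sup>2 + 2 * (1/100 * G 0)) + (2 * (n 2 1)\<^sup>2 + 2 * (1/100 * G 1)) + 2 * (n 2 2)\<^sup>2)"
    unfolding sum_less_3 by (intro add_mono b'' b')
  \<comment> \<open>\<open>g 2\<close> occurs twice with factor 2/25, \<open>g 0\<close> and
    \<open>g 1\<close> twice each with factor 2/100. The largest total, 4/25, then serves for all
    three.\<close>
  also have "\<dots> = 2 * (\<Sum>i<3. \<Sum>j<3. (n i j)\<^sup>2) + 1/25 * G 0 + 1/25 * G 1 + 4/25 * G 2"
    unfolding sum_less_3 by (simp add: field_simps)
  also have "\<dots> \<le> 2 * (\<Sum>i<3. \<Sum>j<3. (n i j)\<^sup>2) + 4/25 * (\<Sum>k<3. G k)"
    using nn unfolding sum_less_3 distrib_left by linarith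
  finally show ?thesis unfolding G_def .
qed

text \<open>Here |h_i| <= 1/60. The exponent of \<open>weight1\<close> collects four such terms and
  that of \<open>weight2\<close> six, hence the bounds 1/15 and -1/10 on the exponents.\<close>

lemma weight_bounds:
  assumes e: "0 \<le> e" "e \<le> 1/10"
  shows "0 \<le> weight1 e i v" "weight1 e i v \<le> 5/4" "9/10 \<le> weight2 e i j v"
proof -
  let ?z = "snd (snd v)"
  have l: "\<bar>log_scale e k ?z\<bar> \<le> 1/60" for k using log_scale_le[of e k ?z] e by simp
  have w1: "weight1 e i v = exp (log_scale e 0 ?z + log_scale e 1 ?z - 2 * log_scale e i ?z)"
    by (simp add: weight1_def vol_density_def exp_diff exp_minus field_simps)
  have w2: "weight2 e i j v = exp (log_scale e 0 ?z + log_scale e 1 ?z - 2 * log_scale e i ?z - 2 * log_scale e j ?z)"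
    by (simp add: weight2_def vol_density_def exp_diff exp_minus exp_add field_simps)
  show "0 \<le> weight1 e i v" unfolding w1 by simp
  have "weight1 e i v \<le> exp (1/15)" unfolding w1 using l[of 0] l[of 1] l[of i] by (simp add: abs_le_iff)
  also have "\<dots> \<le> 1 + 1/15 + (1/15)\<^sup>2" by (rule exp_bound) simp_all
  also have "\<dots> \<le> 5/4" by (simp add: power2_eq_square)
  finally show "weight1 e i v \<le> 5/4" .
  have "9/10 \<le> 1 + (- (1/10)) + (0::real)" by simp
  also have "\<dots> \<le> exp (- (1/10))" using exp_ge_add_one_self[of "- (1/10)"] by simp
  also have "\<dots> \<le> weight2 e i j v" unfolding w2 using l[of 0] l[of 1] l[of i] l[of j] by (simp add: abs_le_iff)
  finally show "9/10 \<le> weight2 e i j v" .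
qed

text \<open>Three is the number of mean values to cancel. Orthogonality in both products keeps the
  Rayleigh quotient of any combination of the eigenforms at most 1/10, and the remaining estimates
  compare metric and flat quantities.\<close>

lemma card_small_eigenvalues:
  assumes e: "0 \<le> e" "e \<le> 1/10"
    and S: "finite S" "S \<subseteq> {k. 0 < k \<and> k < 1/10 \<and> rough_eigenvalue (torus_manifold e) k}"
  shows "card S \<le> 3"
proof (rule ccontr)
  assume "\<not> card S \<le> 3"
  then have card: "DIM(real \<times> real \<times> real) < card S" by simp
  let ?M = "torus_manifold e"
  \<comment> \<open>The eigenforms are indexed by their eigenvalues, so forms with different indices
    are orthogonal.\<close>
  have "\<forall>k\<in>S. \<exists>\<omega>. nonzero_form ?M \<omega> \<and> rough_laplacian ?M \<omega> (\<lambda>c x i. k * \<omega> c x i)"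
    using S unfolding rough_eigenvalue_def by blast
  then obtain \<omega> where \<omega>: "\<And>k. k \<in> S \<Longrightarrow> nonzero_form ?M (\<omega> k)"
      "\<And>k. k \<in> S \<Longrightarrow> rough_laplacian ?M (\<omega> k) (\<lambda>c x i. k * \<omega> k c x i)"
    by metis
  have of: "one_form 3 torus_atlas (\<omega> k)" if "k \<in> S" for k
    using \<omega>(2)[OF that] by (simp add: rough_laplacian_def)
  let ?F = "\<lambda>k i. form_coeff (\<omega> k) i"
  let ?m = "\<lambda>k i. (\<integral>v. ?F k i v \<partial>cube_measure)"
  obtain c where c: "\<exists>k\<in>S. c k \<noteq> 0" "(\<Sum>k\<in>S. c k *\<^sub>R (?m k 0, ?m k 1, ?m k 2)) = 0"
    by (rule exists_vanishing_combination[OF S(1) card])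
  define g where "g i v = (\<Sum>k\<in>S. c k * ?F k i v)" for i v
  define d where "d m i v = (\<Sum>k\<in>S. c k * form_deriv (\<omega> k) m i v)" for m i v
  define n where "n i j v = (\<Sum>k\<in>S. c k * nabla_coeff e (\<omega> k) i j v)" for i j v
  have cg: "continuous_on UNIV (g i)" if "i < 3" for i
    unfolding g_def[abs_def] by (intro continuous_on_sum continuous_on_mult continuous_on_const continuous_form_coeff of that)
  have cd: "continuous_on UNIV (d m i)" if "i < 3" "m < 3" for i m
    unfolding d_def[abs_def] by (intro continuous_on_sum continuous_on_mult continuous_on_const continuous_form_deriv of that)
  have cn: "continuous_on UNIV (n i j)" if "i < 3" "j < 3" for i j
    unfolding n_def[abs_def] by (intro continuous_on_sum continuous_on_mult continuous_on_const continuous_nabla_coeff of that)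
  have ig: "integrable cube_measure (\<lambda>v. (g i v)\<^sup>2)" if "i < 3" for i
    by (intro continuous_cube(3) continuous_on_power cg that)
  have id: "integrable cube_measure (\<lambda>v. (d m i v)\<^sup>2)" if "i < 3" "m < 3" for m i
    by (intro continuous_cube(3) continuous_on_power cd that)
  have inn: "integrable cube_measure (\<lambda>v. (n i j v)\<^sup>2)" if "i < 3" "j < 3" for i j
    by (intro continuous_cube(3) continuous_on_power cn that)
  have mean: "(\<integral>v. g i v \<partial>cube_measure) = 0" if i: "i < 3" for i
  proof -
    have "(\<integral>v. g i v \<partial>cube_measure) = (\<Sum>k\<in>S. c k * ?m k i)"
      unfolding g_def using i
      by (subst Bochner_Integration.integral_sum)
        (intro integrable_mult_right continuous_cube(3) continuous_form_coeff of, assumption+, simp)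
    also have "\<dots> = 0"
    proof -
      have "(\<Sum>k\<in>S. c k * ?m k 0) = fst (\<Sum>k\<in>S. c k *\<^sub>R (?m k 0, ?m k 1, ?m k 2))"
        "(\<Sum>k\<in>S. c k * ?m k 1) = fst (snd (\<Sum>k\<in>S. c k *\<^sub>R (?m k 0, ?m k 1, ?m k 2)))"
        "(\<Sum>k\<in>S. c k * ?m k 2) = snd (snd (\<Sum>k\<in>S. c k *\<^sub>R (?m k 0, ?m k 1, ?m k 2)))"
        by (simp_all add: fst_sum snd_sum)
      then show ?thesis using i unfolding c(2) by (auto simp: less_3_iff)
    qed
    finally show ?thesis .
  qed
  have poin: "(\<integral>v. (g i v)\<^sup>2 \<partial>cube_measure) \<le> (\<Sum>m<3. (\<integral>v. (d m i v)\<^sup>2 \<partial>cube_measure))" if i: "i < 3" for i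
  proof -
    have "(\<integral>v. (g i v)\<^sup>2 \<partial>cube_measure) - (\<integral>v. g i v \<partial>cube_measure)\<^sup>2
      \<le> (\<integral>v. (d 0 i v)\<^sup>2 \<partial>cube_measure) + (\<integral>v. (d 1 i v)\<^sup>2 \<partial>cube_measure) + (\<integral>v. (d 2 i v)\<^sup>2 \<partial>cube_measure)"
    proof (rule poincare_cube)
      show "((\<lambda>t. g i (t, y, z)) has_real_derivative d 0 i (x, y, z)) (at x)" for x y z
        unfolding g_def d_def by (intro DERIV_sum DERIV_cmult DERIV_form_coeff_xyz of i)
      show "((\<lambda>t. g i (x, t, z)) has_real_derivative d 1 i (x, y, z)) (at y)" for x y z
        unfolding g_def d_def by (intro DERIV_sum DERIV_cmult DERIV_form_coeff_xyz of i)
      show "((\<lambda>t. g i (x, y, t)) has_real_derivative d 2 i (x, y, z)) (at z)" for x y z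
        unfolding g_def d_def by (intro DERIV_sum DERIV_cmult DERIV_form_coeff_xyz of i)
    qed (use cg cd i in simp_all)
    then show ?thesis by (simp add: mean[OF i] sum_less_3)
  qed
  \<comment> \<open>\<open>NG\<close> is the squared flat norm of the combination, \<open>ND\<close>
    its flat Dirichlet energy, \<open>NN\<close> its covariant energy without weights.\<close>
  define NG where "NG = (\<Sum>i<3. (\<integral>v. (g i v)\<^sup>2 \<partial>cube_measure))"
  define ND where "ND = (\<Sum>m<3. \<Sum>i<3. (\<integral>v. (d m i v)\<^sup>2 \<partial>cube_measure))"
  define NN where "NN = (\<Sum>i<3. \<Sum>j<3. (\<integral>v. (n i j v)\<^sup>2 \<partial>cube_measure))"
  have "NG \<le> (\<Sum>i<3. \<Sum>m<3. (\<integral>v. (d m i v)\<^sup>2 \<partial>cube_measure))"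
    unfolding NG_def by (intro sum_mono poin) simp
  also have "\<dots> = ND" unfolding ND_def by (rule sum.swap)
  finally have GD: "NG \<le> ND" .
  have ND_int: "ND = (\<integral>v. (\<Sum>m<3. \<Sum>i<3. (d m i v)\<^sup>2) \<partial>cube_measure)"
    unfolding ND_def sum_less_3 using id by simp
  have NN_int: "NN = (\<integral>v. (\<Sum>i<3. \<Sum>j<3. (n i j v)\<^sup>2) \<partial>cube_measure)"
    unfolding NN_def sum_less_3 using inn by simp
  have NG_int: "NG = (\<integral>v. (\<Sum>i<3. (g i v)\<^sup>2) \<partial>cube_measure)"
    unfolding NG_def sum_less_3 using ig by simp
  \<comment> \<open>The Christoffel symbols are the same for all the eigenforms, so the correction
    passes through the combination.\<close>
  have dn: "d i j v = n i j v + (\<Sum>k<3. torus_christoffel e (snd (snd v)) k i j * g k v)" for i j v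
    unfolding d_def n_def g_def nabla_coeff_def
    by (simp add: right_diff_distrib sum_subtractf sum_distrib_left sum.distrib mult_ac sum.swap[of _ S])
  have isum: "integrable cube_measure (\<lambda>v. \<Sum>i<3. \<Sum>j<3. (n i j v)\<^sup>2)" "integrable cube_measure (\<lambda>v. \<Sum>i<3. (g i v)\<^sup>2)"
    "integrable cube_measure (\<lambda>v. \<Sum>i<3. \<Sum>j<3. (d i j v)\<^sup>2)"
    using ig id inn by (auto intro!: Bochner_Integration.integrable_sum)
  have "ND \<le> (\<integral>v. 2 * (\<Sum>i<3. \<Sum>j<3. (n i j v)\<^sup>2) + 4/25 * (\<Sum>i<3. (g i v)\<^sup>2) \<partial>cube_measure)"
    unfolding ND_int
  proof (rule integral_mono[OF isum(3)])
    show "integrable cube_measure (\<lambda>v. 2 * (\<Sum>i<3. \<Sum>j<3. (n i j v)\<^sup>2) + 4/25 * (\<Sum>i<3. (g i v)\<^sup>2))"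
      by (intro Bochner_Integration.integrable_add integrable_mult_right isum)
    show "(\<Sum>i<3. \<Sum>j<3. (d i j v)\<^sup>2) \<le> 2 * (\<Sum>i<3. \<Sum>j<3. (n i j v)\<^sup>2) + 4/25 * (\<Sum>i<3. (g i v)\<^sup>2)" for v
      by (rule sum_sq_deriv_le[OF e dn])
  qed
  also have "\<dots> = 2 * NN + 4/25 * NG" unfolding NN_int NG_int using isum by simp
  finally have DN: "ND \<le> 2 * NN + 4/25 * NG" .
  define N where "N k = L2_inner1 ?M (\<omega> k) (\<omega> k)" for k
  have N0: "0 < N k" if "k \<in> S" for k unfolding N_def by (rule L2_inner1_pos[OF of[OF that] \<omega>(1)[OF that]])
  have E1: "(\<integral>v. (\<Sum>i<3. weight1 e i v * (g i v)\<^sup>2) \<partial>cube_measure) = (\<Sum>k\<in>S. (c k)\<^sup>2 * N k)"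
  proof -
    have "(\<integral>v. (\<Sum>i<3. weight1 e i v * (g i v)\<^sup>2) \<partial>cube_measure)
        = (\<Sum>k\<in>S. (c k)\<^sup>2 * (\<integral>v. (\<Sum>i<3. weight1 e i v * ?F k i v * ?F k i v) \<partial>cube_measure))"
      unfolding g_def
    proof (rule integral_square_orthogonal[OF S(1) finite_lessThan])
      fix k l assume kl: "k \<in> S" "l \<in> S" "k \<noteq> l"
      show "(\<integral>v. (\<Sum>i<3. weight1 e i v * ?F k i v * ?F l i v) \<partial>cube_measure) = 0"
        using L2_orthogonal(1)[OF \<omega>(2)[OF kl(1)] \<omega>(2)[OF kl(2)] kl(3)] L2_inner1_torus[OF of[OF kl(1)] of[OF kl(2)]] by simp
    qed (simp_all add: continuous_weight continuous_form_coeff of)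
    then show ?thesis unfolding N_def by (simp add: L2_inner1_torus of)
  qed
  have E2: "(\<integral>v. (\<Sum>i<3. \<Sum>j<3. weight2 e i j v * (n i j v)\<^sup>2) \<partial>cube_measure) = (\<Sum>k\<in>S. (c k)\<^sup>2 * (k * N k))"
  proof -
    let ?Q = "{..<3::nat} \<times> {..<3::nat}"
    let ?n = "\<lambda>k q v. nabla_coeff e (\<omega> k) (fst q) (snd q) v"
    let ?w = "\<lambda>q v. weight2 e (fst q) (snd q) v"
    have "(\<integral>v. (\<Sum>q\<in>?Q. ?w q v * (\<Sum>k\<in>S. c k * ?n k q v)\<^sup>2) \<partial>cube_measure)
        = (\<Sum>k\<in>S. (c k)\<^sup>2 * (\<integral>v. (\<Sum>q\<in>?Q. ?w q v * ?n k q v * ?n k q v) \<partial>cube_measure))"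
    proof (rule integral_square_orthogonal[OF S(1)])
      fix k l assume kl: "k \<in> S" "l \<in> S" "k \<noteq> l"
      show "(\<integral>v. (\<Sum>q\<in>?Q. ?w q v * ?n k q v * ?n l q v) \<partial>cube_measure) = 0"
        using L2_orthogonal(2)[OF \<omega>(2)[OF kl(1)] \<omega>(2)[OF kl(2)] kl(3)] L2_inner2_torus[OF of[OF kl(1)] of[OF kl(2)]]
        by (simp add: sum.cartesian_product split_def)
    qed (auto simp: continuous_weight continuous_nabla_coeff of)
    moreover have "(\<integral>v. (\<Sum>q\<in>?Q. ?w q v * ?n k q v * ?n k q v) \<partial>cube_measure) = k * N k"
      if "k \<in> S" for k
      using rough_laplacian_energy[OF \<omega>(2)[OF that] of[OF that]] L2_inner2_torus[OF of[OF that] of[OF that]]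
      unfolding N_def by (simp add: sum.cartesian_product split_def)
    ultimately show ?thesis unfolding n_def by (simp add: sum.cartesian_product split_def)
  qed
  \<comment> \<open>The upper bound on \<open>weight1\<close> passes from the metric norm to the
    flat one; the lower bound on \<open>weight2\<close> afterwards controls the unweighted energy by
    the metric one.\<close>
  have "(\<Sum>k\<in>S. (c k)\<^sup>2 * N k) \<le> (\<integral>v. 5/4 * (\<Sum>i<3. (g i v)\<^sup>2) \<partial>cube_measure)"
    unfolding E1[symmetric]
  proof (rule integral_mono)
    show "integrable cube_measure (\<lambda>v. \<Sum>i<3. weight1 e i v * (g i v)\<^sup>2)"
      by (intro continuous_cube(3) continuous_on_sum continuous_on_mult continuous_weight continuous_on_power cg) simp
    show "integrable cube_measure (\<lambda>v. 5/4 * (\<Sum>i<3. (g i v)\<^sup>2))" by (intro integrable_mult_right isum)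
    show "(\<Sum>i<3. weight1 e i v * (g i v)\<^sup>2) \<le> 5/4 * (\<Sum>i<3. (g i v)\<^sup>2)" for v
      unfolding sum_distrib_left by (intro sum_mono mult_right_mono weight_bounds e) simp
  qed
  then have up: "(\<Sum>k\<in>S. (c k)\<^sup>2 * N k) \<le> 5/4 * NG" unfolding NG_int by simp
  have "(\<integral>v. 9/10 * (\<Sum>i<3. \<Sum>j<3. (n i j v)\<^sup>2) \<partial>cube_measure) \<le> (\<Sum>k\<in>S. (c k)\<^sup>2 * (k * N k))"
    unfolding E2[symmetric]
  proof (rule integral_mono)
    show "integrable cube_measure (\<lambda>v. \<Sum>i<3. \<Sum>j<3. weight2 e i j v * (n i j v)\<^sup>2)"
      by (intro continuous_cube(3) continuous_on_sum continuous_on_mult continuous_weight continuous_on_power cn) simp_all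
    show "integrable cube_measure (\<lambda>v. 9/10 * (\<Sum>i<3. \<Sum>j<3. (n i j v)\<^sup>2))" by (intro integrable_mult_right isum)
    show "9/10 * (\<Sum>i<3. \<Sum>j<3. (n i j v)\<^sup>2) \<le> (\<Sum>i<3. \<Sum>j<3. weight2 e i j v * (n i j v)\<^sup>2)" for v
      unfolding sum_distrib_left by (intro sum_mono mult_right_mono weight_bounds e) simp
  qed
  then have low: "9/10 * NN \<le> (\<Sum>k\<in>S. (c k)\<^sup>2 * (k * N k))" unfolding NN_int by simp
  have "(\<Sum>k\<in>S. (c k)\<^sup>2 * (k * N k)) \<le> (\<Sum>k\<in>S. 1/10 * ((c k)\<^sup>2 * N k))"
  proof (rule sum_mono)
    fix k assume k: "k \<in> S"
    then have "k * ((c k)\<^sup>2 * N k) \<le> 1/10 * ((c k)\<^sup>2 * N k)"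
      using S(2) N0[OF k] by (intro mult_right_mono) auto
    then show "(c k)\<^sup>2 * (k * N k) \<le> 1/10 * ((c k)\<^sup>2 * N k)" by (simp add: mult_ac)
  qed
  then have mid: "(\<Sum>k\<in>S. (c k)\<^sup>2 * (k * N k)) \<le> 1/10 * (\<Sum>k\<in>S. (c k)\<^sup>2 * N k)" by (simp add: sum_distrib_left)
  obtain k0 where k0: "k0 \<in> S" "c k0 \<noteq> 0" using c(1) by blast
  have "0 < (\<Sum>k\<in>S. (c k)\<^sup>2 * N k)"
    by (rule sum_pos2[OF S(1) k0(1)]) (use k0 N0 in \<open>auto simp: less_imp_le\<close>)
  \<comment> \<open>With P the squared metric norm: NN <= P/9 and 21/25 NG <= 2 NN, so P <= 5/4 NG
    <= 250/756 P, which is impossible for P > 0.\<close>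
  then show False using up low mid GD DN by linarith
qed

lemma first_eigenvalue_exists:
  assumes e: "0 < e" "e \<le> 1/10"
  obtains k where "first_positive_rough_eigenvalue (torus_manifold e) k" "k \<le> e\<^sup>2"
proof -
  let ?A = "{k. 0 < k \<and> k < 1/10 \<and> rough_eigenvalue (torus_manifold e) k}"
  have fin: "finite ?A"
  proof (rule ccontr)
    assume "infinite ?A"
    then obtain B where "finite B" "card B = 4" "B \<subseteq> ?A" using infinite_arbitrarily_large by blast
    then show False using card_small_eigenvalues[of e B] e by auto
  qed
  have "e\<^sup>2 \<le> (1/10)\<^sup>2" using e by (intro power_mono) auto
  \<comment> \<open>e^2 <= 1/100 lies below the threshold 1/10, so the finite set is nonempty; its
    minimum is below every positive eigenvalue outside it.\<close>
  then have mem: "e\<^sup>2 \<in> ?A" using e rough_eigenvalue_dz by (simp add: power2_eq_square)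
  have m: "Min ?A \<in> ?A" using Min_in[OF fin] mem by blast
  have le: "Min ?A \<le> k" if "k \<in> ?A" for k using Min_le[OF fin that] .
  show ?thesis
  proof (rule that[of "Min ?A"])
    show "Min ?A \<le> e\<^sup>2" by (rule le[OF mem])
    have "Min ?A \<le> k" if "0 < k" "rough_eigenvalue (torus_manifold e) k" for k
    proof (cases "k < 1/10")
      case True
      then show ?thesis using le[of k] that by simp
    next
      case False
      then show ?thesis using m by simp
    qed
    then show "first_positive_rough_eigenvalue (torus_manifold e) (Min ?A)"
      unfolding first_positive_rough_eigenvalue_def using m by simp
  qed
qed

theorem proposition1p2:
  shows "\<exists>n :: nat. \<forall>C :: real. C > 0 \<longrightarrow>
    (\<exists>(M :: (nat \<Rightarrow> real) riemannian) (\<kappa> :: real) (D :: real) (ev :: real).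
       riemannian_manifold M \<and> mdim M = n \<and> closed_connected M \<and>
       \<kappa> \<ge> 0 \<and> D > 0 \<and>
       ricci_ge M (- (real n - 1) * \<kappa>) \<and>
       riemannian_diameter M \<le> ennreal D \<and>
       first_positive_rough_eigenvalue M ev \<and>
       ev * D\<^sup>2 < C * exp (- C * sqrt (\<kappa> * D\<^sup>2)))"
proof (intro exI[of _ 3] allI impI)
  fix C :: real assume C: "C > 0"
  \<comment> \<open>With \<kappa> = 10 e and D = 3 the right-hand side of the desired inequality
    tends to C > 0, while the left-hand side is at most 9 e^2. A single small e therefore works for
    the given C.\<close>
  have "((\<lambda>e. C * exp (- C * sqrt (10 * e * 3\<^sup>2)) - e\<^sup>2 * 3\<^sup>2) \<longlongrightarrow> C * exp (- C * sqrt (10 * 0 * 3\<^sup>2)) - 0\<^sup>2 * 3\<^sup>2) (at_right 0)"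
    by (intro tendsto_intros)
  then have "eventually (\<lambda>e. 0 < C * exp (- C * sqrt (10 * e * 3\<^sup>2)) - e\<^sup>2 * 3\<^sup>2) (at_right 0)"
    by (rule order_tendstoD) (use C in simp)
  moreover have "eventually (\<lambda>e::real. e \<in> {0<..<1/10}) (at_right 0)"
    by (rule eventually_at_right_real) simp
  ultimately have "eventually (\<lambda>e. 0 < C * exp (- C * sqrt (10 * e * 3\<^sup>2)) - e\<^sup>2 * 3\<^sup>2 \<and> e \<in> {0<..<1/10}) (at_right 0)"
    by (rule eventually_conj)
  then obtain e where e: "e\<^sup>2 * 3\<^sup>2 < C * exp (- C * sqrt (10 * e * 3\<^sup>2))" "0 < e" "e < 1/10"
    using eventually_happens'[OF trivial_limit_at_right_real] by force
  obtain k where k: "first_positive_rough_eigenvalue (torus_manifold e) k" "k \<le> e\<^sup>2"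
    using first_eigenvalue_exists[of e] e by auto
  have "k * 3\<^sup>2 \<le> e\<^sup>2 * 3\<^sup>2" using k(2) by simp
  with e(1) have "k * 3\<^sup>2 < C * exp (- C * sqrt (10 * e * 3\<^sup>2))" by (rule le_less_trans[rotated])
  then show "\<exists>(M :: (nat \<Rightarrow> real) riemannian) \<kappa> D ev. riemannian_manifold M \<and> mdim M = 3 \<and> closed_connected M \<and>
       \<kappa> \<ge> 0 \<and> D > 0 \<and> ricci_ge M (- (real 3 - 1) * \<kappa>) \<and> riemannian_diameter M \<le> ennreal D \<and>
       first_positive_rough_eigenvalue M ev \<and> ev * D\<^sup>2 < C * exp (- C * sqrt (\<kappa> * D\<^sup>2))"
    using riemannian_manifold_torus closed_connected_torus ricci_ge_torus[of e] diameter_torus_le[of e] k(1) e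
    by (intro exI[of _ "torus_manifold e"] exI[of _ "10 * e"] exI[of _ 3] exI[of _ k] conjI) simp_all
qed

end
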